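(* Let $M$ be a smooth connected manifold with a smooth distribution $\widetilde{\mathcal D}\subset TM$ of rank $n\ge1$, let $g=\langle\cdot,\cdot\rangle$ be a pseudo-Riemannian metric on $M$ non-degenerate along $\widetilde{\mathcal D}$, with orthogonal complement $\mathcal D$ of rank $p\ge 1$, and let $\mathfrak T$ be the contorsion tensor of a statistical connection on $(M,g)$. The pair $(g,\mathfrak T)$ is critical for the action $$I:(g,\mathfrak T)\mapsto\int_M\mathrm S_{\mathfrak T}\,\mathrm d\mathrm{vol}_g$$ with respect to all variations of metric, and variations of $\mathfrak T$ corresponding to statistical connections, if and only if $$(\mathrm{Tr}^\top\mathfrak T)^\top=0=(\mathrm{Tr}^\perp\mathfrak T)^\perp$$ and $$(\mathfrak T_XY)^\perp=0=(\mathfrak T_UV)^\top\qquad\text{for all }X,Y\in\widetilde{\mathcal D},\ U,V\in\mathcal D.$$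
   Context: $TM=\widetilde{\mathcal D}\oplus\mathcal D$ is the $g$-orthogonal decomposition; $X^\top$ and $X^\perp$ denote the $\widetilde{\mathcal D}$- and $\mathcal D$-components of a vector $X$. The contorsion tensor of a linear connection $\bar\nabla$ is $\mathfrak T=\bar\nabla-\nabla$, where $\nabla$ is the Levi-Civita connection of $g$. For a $(1,2)$-tensor $\mathfrak T$ put $\langle\mathfrak T^*_XY,Z\rangle=\langle\mathfrak T_XZ,Y\rangle$ and $\mathfrak T^\wedge_XY=\mathfrak T_YX$. The connection $\nabla+\mathfrak T$ is statistical for $g$ if it is torsion-free and $\bar\nabla g$ is symmetric in all its entries, equivalently $\mathfrak T^\wedge=\mathfrak T$ and $\mathfrak T^*=\mathfrak T$. Let $\{E_a\}_{a=1}^n\subset\widetilde{\mathcal D}$, $\{\mathcal E_i\}_{i=1}^p\subset\mathcal D$ be a local adapted orthonormal frame with $\epsilon_a=\langle E_a,E_a\rangle$, $\epsilon_i=\langle\mathcal E_i,\mathcal E_i\rangle\in\{-1,1\}$; $\mathfrak T_a=\mathfrak T_{E_a}$, $\mathfrak T_i=\mathfrak T_{\mathcal E_i}$; $\mathrm{Tr}^\top\mathfrak T=\sum_a\epsilon_a\mathfrak T_aE_a$, $\mathrm{Tr}^\perp\mathfrak T=\sum_i\epsilon_i\mathfrak T_i\mathcal E_i$. The mixed scalar $\mathfrak T$-curvature, defined for an arbitrary $(1,2)$-tensor $\mathfrak T$, is $$\mathrm S_{\mathfrak T}=\sum_{a,i}\epsilon_a\epsilon_i\big(\langle[\mathfrak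 T_i,\mathfrak T_a]E_a,\mathcal E_i\rangle+\langle[\mathfrak T_a,\mathfrak T_i]\mathcal E_i,E_a\rangle\big).$$ Criticality: $\widetilde{\mathcal D}$ is fixed, while $\mathcal D$ is determined by the metric. Here $g$ and $\mathfrak T$ are independent variables. The pair $(g,\mathfrak T)$ is critical if for every relatively compact domain $\Omega\subset M$, the derivative at $t=0$ of the action (integral taken over $\Omega$ if it does not converge on $M$) vanishes for every smooth variation $g_t$ of $g=g_0$ among pseudo-Riemannian metrics, with $g_t=g$ outside a compact subset of $\Omega$ and the tensor $\mathfrak T$ fixed, and for every smooth variation $\mathfrak T_t$ of $\mathfrak T=\mathfrak T_0$ with $g$ fixed, $\partial_t\mathfrak T_t$ supported in $\Omega$, and every $\nabla+\mathfrak T_t$ statistical for $g$. *)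

theory Defs
  imports "HOL-Analysis.Analysis"
begin

subsection \<open>Smooth maps between open subsets of Euclidean spaces\<close>

text \<open>The set \<open>S\<close> is meant to be open.\<close>

primrec Ck_on :: "nat \<Rightarrow> 'v::euclidean_space set \<Rightarrow> ('v \<Rightarrow> 'w::real_normed_vector) \<Rightarrow> bool" where
  "Ck_on 0 = (\<lambda>S f. continuous_on S f)"
| "Ck_on (Suc k) = (\<lambda>S f. (\<forall>x\<in>S. f differentiable (at x)) \<and>
     (\<forall>v. Ck_on k S (\<lambda>x. frechet_derivative f (at x) v)))"

definition smooth_on :: "'v::euclidean_space set \<Rightarrow> ('v \<Rightarrow> 'w::real_normed_vector) \<Rightarrow> bool" where
  "smooth_on S f \<longleftrightarrow> (\<forall>k. Ck_on k S f)"


subsection \<open>Smooth manifolds\<close>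

text \<open>The manifold is the whole type \<open>'a\<close> (Hausdorff and second countable), with a smooth atlas
  which need not be maximal. A chart is a domain together with a map into the model space.\<close>

type_synonym ('a, 'v) chart = "'a set \<times> ('a \<Rightarrow> 'v)"

abbreviation chart_dom :: "('a, 'v) chart \<Rightarrow> 'a set" where
  "chart_dom c \<equiv> fst c"

abbreviation chart_inv :: "('a, 'v) chart \<Rightarrow> 'v \<Rightarrow> 'a" where
  "chart_inv c \<equiv> inv_into (fst c) (snd c)"

definition is_chart :: "('a::topological_space, 'v::euclidean_space) chart \<Rightarrow> bool" where
  "is_chart c \<longleftrightarrow> open (chart_dom c) \<and> open (snd c ` chart_dom c) \<and>
     (\<exists>h. homeomorphism (chart_dom c) (snd c ` chart_dom c) (snd c) h)"

definition transition :: "('a, 'v) chart \<Rightarrow> ('a, 'v) chart \<Rightarrow> 'v \<Rightarrow> 'v" where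
  "transition c d = snd d \<circ> chart_inv c"

definition smooth_atlas :: "('a::topological_space, 'v::euclidean_space) chart set \<Rightarrow> bool" where
  "smooth_atlas A \<longleftrightarrow> (\<forall>c\<in>A. is_chart c) \<and> (\<Union>c\<in>A. chart_dom c) = UNIV \<and>
     (\<forall>c\<in>A. \<forall>d\<in>A. smooth_on (snd c ` (chart_dom c \<inter> chart_dom d)) (transition c d))"

text \<open>The tangent space at every point \<open>x\<close> is the model space, a vector being identified with its
  components in one chart \<open>chart_at A x\<close> around \<open>x\<close> chosen once and for all. Since this chart jumps
  as \<open>x\<close> moves, smoothness of a field is always tested on its components in the charts of the
  atlas: \<open>from_coords A c x v\<close> is the tangent vector at \<open>x\<close> with components \<open>v\<close> in the chart \<open>c\<close>,
  and \<open>to_coords A c x\<close> returns the components in \<open>c\<close> of a tangent vector at \<open>x\<close>.\<close>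

definition chart_at :: "('a, 'v) chart set \<Rightarrow> 'a \<Rightarrow> ('a, 'v) chart" where
  "chart_at A x = (SOME c. c \<in> A \<and> x \<in> chart_dom c)"

definition from_coords ::
  "('a, 'v::euclidean_space) chart set \<Rightarrow> ('a, 'v) chart \<Rightarrow> 'a \<Rightarrow> 'v \<Rightarrow> 'v" where
  "from_coords A c x = frechet_derivative (transition c (chart_at A x)) (at (snd c x))"

definition to_coords ::
  "('a, 'v::euclidean_space) chart set \<Rightarrow> ('a, 'v) chart \<Rightarrow> 'a \<Rightarrow> 'v \<Rightarrow> 'v" where
  "to_coords A c x =
     frechet_derivative (transition (chart_at A x) c) (at (snd (chart_at A x) x))"


subsection \<open>Tensor fields and distributions\<close>

text \<open>Components in the chart \<open>c\<close>, at the point of coordinates \<open>y\<close>, of a \<open>(0,2)\<close>-tensor field and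
  of a \<open>(1,2)\<close>-tensor field (the latter read as \<open>T x X Y = T\<^sub>X Y\<close>).\<close>

definition coords02 :: "('a, 'v::euclidean_space) chart set \<Rightarrow> ('a, 'v) chart \<Rightarrow>
    ('a \<Rightarrow> 'v \<Rightarrow> 'v \<Rightarrow> real) \<Rightarrow> 'v \<Rightarrow> 'v \<Rightarrow> 'v \<Rightarrow> real" where
  "coords02 A c g y v w = (let x = chart_inv c y in
     g x (from_coords A c x v) (from_coords A c x w))"

definition coords12 :: "('a, 'v::euclidean_space) chart set \<Rightarrow> ('a, 'v) chart \<Rightarrow>
    ('a \<Rightarrow> 'v \<Rightarrow> 'v \<Rightarrow> 'v) \<Rightarrow> 'v \<Rightarrow> 'v \<Rightarrow> 'v \<Rightarrow> 'v" where
  "coords12 A c T y v w = (let x = chart_inv c y in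
     to_coords A c x (T x (from_coords A c x v) (from_coords A c x w)))"

text \<open>On the connected manifolds considered below the signature is automatically constant.\<close>

definition pseudo_riemannian :: "('a, 'v::euclidean_space) chart set \<Rightarrow>
    ('a \<Rightarrow> 'v \<Rightarrow> 'v \<Rightarrow> real) \<Rightarrow> bool" where
  "pseudo_riemannian A g \<longleftrightarrow>
     (\<forall>x. bilinear (g x) \<and> (\<forall>v w. g x v w = g x w v) \<and>
          (\<forall>v. (\<forall>w. g x v w = 0) \<longrightarrow> v = 0)) \<and>
     (\<forall>c\<in>A. \<forall>v w. smooth_on (snd c ` chart_dom c) (\<lambda>y. coords02 A c g y v w))"

definition tensor12 :: "('a, 'v::euclidean_space) chart set \<Rightarrow>
    ('a \<Rightarrow> 'v \<Rightarrow> 'v \<Rightarrow> 'v) \<Rightarrow> bool" where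
  "tensor12 A T \<longleftrightarrow> (\<forall>x. bilinear (T x)) \<and>
     (\<forall>c\<in>A. \<forall>v w. smooth_on (snd c ` chart_dom c) (\<lambda>y. coords12 A c T y v w))"

definition smooth_vector_field_on :: "('a, 'v::euclidean_space) chart set \<Rightarrow> 'a set \<Rightarrow>
    ('a \<Rightarrow> 'v) \<Rightarrow> bool" where
  "smooth_vector_field_on A V X \<longleftrightarrow>
     (\<forall>c\<in>A. smooth_on (snd c ` (chart_dom c \<inter> V))
        (\<lambda>y. to_coords A c (chart_inv c y) (X (chart_inv c y))))"

definition smooth_distribution :: "('a::topological_space, 'v::euclidean_space) chart set \<Rightarrow>
    nat \<Rightarrow> ('a \<Rightarrow> 'v set) \<Rightarrow> bool" where
  "smooth_distribution A n W \<longleftrightarrow> (\<forall>x. subspace (W x) \<and> dim (W x) = n) \<and>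
     (\<forall>x. \<exists>V X. open V \<and> x \<in> V \<and> (\<forall>i<n. smooth_vector_field_on A V (X i)) \<and>
        (\<forall>y\<in>V. W y = span ((\<lambda>i. X i y) ` {..<n})))"


subsection \<open>Statistical connections\<close>

text \<open>\<open>dmetric A c g y u v w\<close> is the derivative in direction \<open>u\<close> of the component \<open>g(v,w)\<close>;
  \<open>christoffel A c g y v w\<close> collects the Christoffel symbols \<open>v\<^sup>i w\<^sup>j \<Gamma>\<^sup>k\<^sub>i\<^sub>j\<close> of the Levi-Civita
  connection of \<open>g\<close>, given by the first-kind formula with the index not yet raised.\<close>

definition dmetric :: "('a, 'v::euclidean_space) chart set \<Rightarrow> ('a, 'v) chart \<Rightarrow>
    ('a \<Rightarrow> 'v \<Rightarrow> 'v \<Rightarrow> real) \<Rightarrow> 'v \<Rightarrow> 'v \<Rightarrow> 'v \<Rightarrow> 'v \<Rightarrow> real" where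
  "dmetric A c g y u v w = frechet_derivative (\<lambda>z. coords02 A c g z v w) (at y) u"

definition christoffel :: "('a, 'v::euclidean_space) chart set \<Rightarrow> ('a, 'v) chart \<Rightarrow>
    ('a \<Rightarrow> 'v \<Rightarrow> 'v \<Rightarrow> real) \<Rightarrow> 'v \<Rightarrow> 'v \<Rightarrow> 'v \<Rightarrow> 'v" where
  "christoffel A c g y v w = (THE z. \<forall>u. coords02 A c g y z u =
     (dmetric A c g y v w u + dmetric A c g y w v u - dmetric A c g y u v w) / 2)"

text \<open>Coefficients of the connection \<open>\<nabla> + T\<close>.\<close>

definition conn_coeff :: "('a, 'v::euclidean_space) chart set \<Rightarrow> ('a, 'v) chart \<Rightarrow>
    ('a \<Rightarrow> 'v \<Rightarrow> 'v \<Rightarrow> real) \<Rightarrow> ('a \<Rightarrow> 'v \<Rightarrow> 'v \<Rightarrow> 'v) \<Rightarrow> 'v \<Rightarrow> 'v \<Rightarrow> 'v \<Rightarrow> 'v" where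
  "conn_coeff A c g T y v w = christoffel A c g y v w + coords12 A c T y v w"

text \<open>\<open>(\<nabla> + T)\<^sub>u g\<close> evaluated on \<open>v\<close> and \<open>w\<close>, in the chart \<open>c\<close>.\<close>

definition nonmetricity :: "('a, 'v::euclidean_space) chart set \<Rightarrow> ('a, 'v) chart \<Rightarrow>
    ('a \<Rightarrow> 'v \<Rightarrow> 'v \<Rightarrow> real) \<Rightarrow> ('a \<Rightarrow> 'v \<Rightarrow> 'v \<Rightarrow> 'v) \<Rightarrow> 'v \<Rightarrow> 'v \<Rightarrow> 'v \<Rightarrow> 'v \<Rightarrow> real" where
  "nonmetricity A c g T y u v w = dmetric A c g y u v w
     - coords02 A c g y (conn_coeff A c g T y u v) w
     - coords02 A c g y v (conn_coeff A c g T y u w)"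

text \<open>\<open>T\<close> is the contorsion tensor of a statistical connection for \<open>g\<close>. The torsion is the
  antisymmetric part of the connection coefficients; symmetry of the nonmetricity in its last two
  entries and in its first two entries gives symmetry in all entries.\<close>

definition statistical :: "('a, 'v::euclidean_space) chart set \<Rightarrow>
    ('a \<Rightarrow> 'v \<Rightarrow> 'v \<Rightarrow> real) \<Rightarrow> ('a \<Rightarrow> 'v \<Rightarrow> 'v \<Rightarrow> 'v) \<Rightarrow> bool" where
  "statistical A g T \<longleftrightarrow> tensor12 A T \<and>
     (\<forall>c\<in>A. \<forall>y\<in>snd c ` chart_dom c. \<forall>u v w.
        conn_coeff A c g T y v w = conn_coeff A c g T y w v \<and>
        nonmetricity A c g T y u v w = nonmetricity A c g T y u w v \<and>
        nonmetricity A c g T y u v w = nonmetricity A c g T y v u w)"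


subsection \<open>Orthogonal decomposition and the mixed scalar curvature at a point\<close>

text \<open>Here \<open>b\<close> is the metric, \<open>W\<close> the fixed distribution and \<open>T\<close> the tensor, all at one point.\<close>

definition orth :: "('v \<Rightarrow> 'v \<Rightarrow> real) \<Rightarrow> 'v set \<Rightarrow> 'v set" where
  "orth b W = {v. \<forall>w\<in>W. b v w = 0}"

definition nondegenerate_on :: "('v::zero \<Rightarrow> 'v \<Rightarrow> real) \<Rightarrow> 'v set \<Rightarrow> bool" where
  "nondegenerate_on b W \<longleftrightarrow> (\<forall>v\<in>W. (\<forall>w\<in>W. b v w = 0) \<longrightarrow> v = 0)"

definition top_part :: "('v::euclidean_space \<Rightarrow> 'v \<Rightarrow> real) \<Rightarrow> 'v set \<Rightarrow> 'v \<Rightarrow> 'v" where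
  "top_part b W v = (THE u. u \<in> W \<and> v - u \<in> orth b W)"

definition perp_part :: "('v::euclidean_space \<Rightarrow> 'v \<Rightarrow> real) \<Rightarrow> 'v set \<Rightarrow> 'v \<Rightarrow> 'v" where
  "perp_part b W v = (THE u. u \<in> orth b W \<and> v - u \<in> W)"

definition orthonormal_frame ::
    "('v::euclidean_space \<Rightarrow> 'v \<Rightarrow> real) \<Rightarrow> 'v set \<Rightarrow> (nat \<Rightarrow> 'v) \<Rightarrow> bool" where
  "orthonormal_frame b W E \<longleftrightarrow>
     (\<forall>i<dim W. E i \<in> W \<and> b (E i) (E i) \<in> {-1, 1} \<and>
        (\<forall>j<dim W. j \<noteq> i \<longrightarrow> b (E i) (E j) = 0))"

text \<open>The traces below do not depend on the frame, so an arbitrary one is chosen at each point.\<close>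

definition frame :: "('v::euclidean_space \<Rightarrow> 'v \<Rightarrow> real) \<Rightarrow> 'v set \<Rightarrow> nat \<Rightarrow> 'v" where
  "frame b W = (SOME E. orthonormal_frame b W E)"

definition trace_on :: "('v::euclidean_space \<Rightarrow> 'v \<Rightarrow> real) \<Rightarrow> 'v set \<Rightarrow>
    ('v \<Rightarrow> 'v \<Rightarrow> 'v) \<Rightarrow> 'v" where
  "trace_on b W T = (let E = frame b W in
     \<Sum>i<dim W. b (E i) (E i) *\<^sub>R T (E i) (E i))"

abbreviation Tr_top :: "('v::euclidean_space \<Rightarrow> 'v \<Rightarrow> real) \<Rightarrow> 'v set \<Rightarrow>
    ('v \<Rightarrow> 'v \<Rightarrow> 'v) \<Rightarrow> 'v" where
  "Tr_top b W T \<equiv> trace_on b W T"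

abbreviation Tr_perp :: "('v::euclidean_space \<Rightarrow> 'v \<Rightarrow> real) \<Rightarrow> 'v set \<Rightarrow>
    ('v \<Rightarrow> 'v \<Rightarrow> 'v) \<Rightarrow> 'v" where
  "Tr_perp b W T \<equiv> trace_on b (orth b W) T"

definition mixed_scalar :: "('v::euclidean_space \<Rightarrow> 'v \<Rightarrow> real) \<Rightarrow> 'v set \<Rightarrow>
    ('v \<Rightarrow> 'v \<Rightarrow> 'v) \<Rightarrow> real" where
  "mixed_scalar b W T = (let E = frame b W; F = frame b (orth b W) in
     \<Sum>a<dim W. \<Sum>i<dim (orth b W). b (E a) (E a) * b (F i) (F i) *
       (b (T (F i) (T (E a) (E a)) - T (E a) (T (F i) (E a))) (F i)
      + b (T (E a) (T (F i) (F i)) - T (F i) (T (E a) (F i))) (E a)))"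


subsection \<open>Volume and action\<close>

definition vol_density :: "('a, real^'m) chart set \<Rightarrow> ('a, real^'m) chart \<Rightarrow>
    ('a \<Rightarrow> real^'m \<Rightarrow> real^'m \<Rightarrow> real) \<Rightarrow> real^'m \<Rightarrow> real" where
  "vol_density A c g y =
     sqrt \<bar>det (\<chi> i j. coords02 A c g y (axis i 1) (axis j 1))\<bar>"

text \<open>The Borel measure given in every chart by the density \<open>\<surd>\<bar>det g\<bar>\<close>; no orientation is
  needed.\<close>

definition vol :: "('a::topological_space, real^'m) chart set \<Rightarrow>
    ('a \<Rightarrow> real^'m \<Rightarrow> real^'m \<Rightarrow> real) \<Rightarrow> 'a measure" where
  "vol A g = (THE \<mu>. sets \<mu> = sets borel \<and>
     (\<forall>c\<in>A. \<forall>B\<in>sets borel. B \<subseteq> chart_dom c \<longrightarrow>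
        emeasure \<mu> B = (\<integral>\<^sup>+y\<in>snd c ` B. ennreal (vol_density A c g y) \<partial>lborel)))"

definition action :: "('a::topological_space, real^'m) chart set \<Rightarrow> ('a \<Rightarrow> (real^'m) set) \<Rightarrow>
    'a set \<Rightarrow> ('a \<Rightarrow> real^'m \<Rightarrow> real^'m \<Rightarrow> real) \<Rightarrow> ('a \<Rightarrow> real^'m \<Rightarrow> real^'m \<Rightarrow> real^'m) \<Rightarrow> real" where
  "action A W \<Omega> g T =
     (if integrable (vol A g) (\<lambda>x. mixed_scalar (g x) (W x) (T x))
      then (\<integral>x. mixed_scalar (g x) (W x) (T x) \<partial>vol A g)
      else (LINT x:\<Omega>|vol A g. mixed_scalar (g x) (W x) (T x)))"


subsection \<open>Variations and criticality\<close>

text \<open>Variations are parametrized by \<open>t\<close> in \<open>(-e, e)\<close> and smooth jointly in \<open>t\<close> and the point.\<close>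

definition metric_variation :: "('a::topological_space, 'v::euclidean_space) chart set \<Rightarrow>
    'a set \<Rightarrow> ('a \<Rightarrow> 'v \<Rightarrow> 'v \<Rightarrow> real) \<Rightarrow> real \<Rightarrow> (real \<Rightarrow> 'a \<Rightarrow> 'v \<Rightarrow> 'v \<Rightarrow> real) \<Rightarrow> bool" where
  "metric_variation A \<Omega> g e gt \<longleftrightarrow> e > 0 \<and> gt 0 = g \<and>
     (\<forall>t\<in>{-e<..<e}. pseudo_riemannian A (gt t)) \<and>
     (\<forall>c\<in>A. \<forall>v w. smooth_on ({-e<..<e} \<times> snd c ` chart_dom c)
        (\<lambda>(t, y). coords02 A c (gt t) y v w)) \<and>
     (\<exists>K. compact K \<and> K \<subseteq> \<Omega> \<and> (\<forall>t\<in>{-e<..<e}. \<forall>x. x \<notin> K \<longrightarrow> gt t x = g x))"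

definition statistical_variation :: "('a::topological_space, 'v::euclidean_space) chart set \<Rightarrow>
    'a set \<Rightarrow> ('a \<Rightarrow> 'v \<Rightarrow> 'v \<Rightarrow> real) \<Rightarrow> ('a \<Rightarrow> 'v \<Rightarrow> 'v \<Rightarrow> 'v) \<Rightarrow> real \<Rightarrow>
    (real \<Rightarrow> 'a \<Rightarrow> 'v \<Rightarrow> 'v \<Rightarrow> 'v) \<Rightarrow> bool" where
  "statistical_variation A \<Omega> g T e Tt \<longleftrightarrow> e > 0 \<and> Tt 0 = T \<and>
     (\<forall>t\<in>{-e<..<e}. statistical A g (Tt t)) \<and>
     (\<forall>c\<in>A. \<forall>v w. smooth_on ({-e<..<e} \<times> snd c ` chart_dom c)
        (\<lambda>(t, y). coords12 A c (Tt t) y v w)) \<and>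
     (\<forall>t\<in>{-e<..<e}.
        closure {x. \<exists>v w. vector_derivative (\<lambda>s. Tt s x v w) (at t) \<noteq> 0} \<subseteq> \<Omega>)"

definition critical :: "('a::topological_space, real^'m) chart set \<Rightarrow> ('a \<Rightarrow> (real^'m) set) \<Rightarrow>
    ('a \<Rightarrow> real^'m \<Rightarrow> real^'m \<Rightarrow> real) \<Rightarrow> ('a \<Rightarrow> real^'m \<Rightarrow> real^'m \<Rightarrow> real^'m) \<Rightarrow> bool" where
  "critical A W g T \<longleftrightarrow>
     (\<forall>\<Omega>. open \<Omega> \<and> connected \<Omega> \<and> compact (closure \<Omega>) \<longrightarrow>
        (\<forall>e gt. metric_variation A \<Omega> g e gt \<longrightarrow>
           ((\<lambda>t. action A W \<Omega> (gt t) T) has_real_derivative 0) (at 0)) \<and>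
        (\<forall>e Tt. statistical_variation A \<Omega> g T e Tt \<longrightarrow>
           ((\<lambda>t. action A W \<Omega> g (Tt t)) has_real_derivative 0) (at 0)))"

end

theory Submission
  imports Defs
begin

text \<open>
  For a statistical contorsion tensor the cubic form \<open>\<langle>T\<^sub>X Y, Z\<rangle>\<close> is totally symmetric, and the mixed
  scalar is the quadratic expression
  \<open>2 (\<langle>\<tau>, \<tau>'\<rangle> - \<Sum> \<epsilon>\<^sub>a \<epsilon>\<^sub>i \<langle>T\<^sub>a E\<^sub>i, T\<^sub>a E\<^sub>i\<rangle>)\<close> in \<open>T\<close>, where \<open>\<tau>\<close> and \<open>\<tau>'\<close> are the traces of
  \<open>T\<close> over the distribution and over its orthogonal complement. No derivatives of the
  fields occur, so the Euler-Lagrange equations are algebraic and the heart of the proof is linear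
  algebra in one tangent space.

  Suppose that the pair is critical. The directions \<open>K(u, v) = \<langle>X, u\<rangle> \<langle>X, v\<rangle> X\<close> are statistical,
  and for \<open>X = A + B\<close> split along the decomposition the first variation of the mixed scalar is
  \<open>|A|\<^sup>2 \<langle>\<tau>', X\<rangle> + |B|\<^sup>2 \<langle>\<tau>, X\<rangle> - 2 \<langle>T\<^sub>A B, X\<rangle>\<close> up to a factor of 2 (\<open>mixed_polar_cube\<close>). Its
  parts of bidegree (3,0) and (0,3) show that \<open>\<tau>'\<close> and \<open>\<tau>\<close> have no component along the
  distribution and its complement, respectively; the other two express the mixed components of the
  cubic form by the traces, and a contraction then kills the traces and the mixed components
  (\<open>stationary_imp_critical_at\<close>). To see that the first variation vanishes at every point, \<open>X\<close> is
  extended to a vector field that is constant in a chart and cut off by a bump function. The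
  derivative of the action is the integral of a continuous density, and a second cut-off gives this
  density a constant sign (\<open>critical_imp_stationary\<close>).

  Conversely, let \<open>T\<close> satisfy the stated equations. Then both traces and all mixed products
  vanish. Along a variation \<open>T\<^sub>t\<close> of the tensor the terms of order zero and one of the quadratic
  expression are zero, so the mixed scalar of \<open>T\<^sub>t\<close> is that of \<open>T\<^sub>t - T = O(t)\<close>
  (\<open>statistical_variation_local_bound\<close>). Along a variation \<open>g\<^sub>t\<close> of the metric the distribution stays
  fixed and only its complement moves. Since \<open>T\<close> preserves the two original summands and
  annihilates mixed pairs, the mixed scalar depends quadratically on the components of the new
  complement along the distribution, which are again \<open>O(t)\<close> (\<open>mixed_scalar_adapted\<close>,
  \<open>metric_variation_local_bound\<close>). In both cases the integrand is supported in a fixed compact set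
  and is \<open>O(t\<^sup>2)\<close> uniformly, whence the derivative of the action is zero.

  Two constructions support these arguments. Orthonormal frames need not vary continuously or stay
  bounded with the metric in indefinite signature; traces over frames are therefore rewritten as
  sums over the standard basis by means of the map \<open>sharp\<close>, which solves a linear system and depends
  continuously on the metric and, in coordinates in which the distribution is constant, on the point.
  The volume is characterized by its values in charts, and its existence rests on the change of
  variables formula and a countable subatlas (\<open>exists_volume\<close>).
\<close>


section \<open>Calculus of smooth maps between Euclidean spaces\<close>

lemma frechet_derivative_eqI: "(f has_derivative f') (at x) \<Longrightarrow> frechet_derivative f (at x) = f'"
  using frechet_derivative_at by metis

lemma has_frechet_derivative:
  "f differentiable (at x) \<Longrightarrow> (f has_derivative frechet_derivative f (at x)) (at x)"
  using frechet_derivative_works by blast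

lemma Ck_on_cong:
  assumes "open S" "\<And>x. x \<in> S \<Longrightarrow> f x = g x" "Ck_on k S f"
  shows "Ck_on k S g"
  using assms(2,3)
proof (induction k arbitrary: f g)
  case 0
  then show ?case using continuous_on_cong[of S S f g] by simp
next
  case (Suc k)
  have d: "f differentiable (at x)" if "x \<in> S" for x
    using Suc.prems that by simp
  have e: "(g has_derivative frechet_derivative f (at x)) (at x)" if "x \<in> S" for x
    using has_derivative_transform_within_open[OF has_frechet_derivative[OF d[OF that]] assms(1) that]
      Suc.prems(1) by auto
  have "frechet_derivative g (at x) = frechet_derivative f (at x)" if "x \<in> S" for x
    using frechet_derivative_eqI[OF e[OF that]] .
  moreover have "Ck_on k S (\<lambda>x. frechet_derivative f (at x) v)" for v
    using Suc.prems by simp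
  ultimately have "Ck_on k S (\<lambda>x. frechet_derivative g (at x) v)" for v
    using Suc.IH[of "\<lambda>x. frechet_derivative f (at x) v"] by simp
  then show ?case
    using Derivative.differentiableI[OF e] by simp
qed

lemma Ck_on_subset: "Ck_on k S f \<Longrightarrow> S' \<subseteq> S \<Longrightarrow> Ck_on k S' f"
proof (induction k arbitrary: f)
  case 0
  then show ?case by (auto intro: continuous_on_subset)
next
  case (Suc k)
  then show ?case by auto
qed

lemma Ck_on_Suc_imp: "Ck_on (Suc k) S f \<Longrightarrow> Ck_on k S f"
proof (induction k arbitrary: f)
  case 0
  then show ?case
    by (metis Ck_on.simps continuous_at_imp_continuous_on differentiable_imp_continuous_within)
next
  case (Suc k)
  then show ?case
    by (metis Ck_on.simps(2))
qed

lemma Ck_on_imp_continuous_on: "Ck_on k S f \<Longrightarrow> continuous_on S f"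
proof (induction k)
  case (Suc k)
  then show ?case using Ck_on_Suc_imp by blast
qed simp

lemma Ck_on_SucI:
  assumes "open S" "\<And>x. x \<in> S \<Longrightarrow> (f has_derivative f' x) (at x)"
    and "\<And>v. Ck_on k S (\<lambda>x. f' x v)"
  shows "Ck_on (Suc k) S f"
proof -
  have "Ck_on k S (\<lambda>x. frechet_derivative f (at x) v)" for v
    by (rule Ck_on_cong[OF assms(1) _ assms(3)[of v]])
       (use assms(2) frechet_derivative_eqI in metis)
  then show ?thesis using assms(2) by (auto simp: differentiable_def)
qed

lemma Ck_on_const: "open S \<Longrightarrow> Ck_on k S (\<lambda>x. c)"
  by (induction k arbitrary: c) auto

lemma Ck_on_linear: "open S \<Longrightarrow> bounded_linear f \<Longrightarrow> Ck_on k S f"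
proof (cases k)
  case 0
  then show "bounded_linear f \<Longrightarrow> ?thesis"
    by (simp add: linear_continuous_on)
next
  case (Suc n)
  assume "open S" "bounded_linear f"
  then show ?thesis
    unfolding Suc by (intro Ck_on_SucI[where f' = "\<lambda>x. f"] Ck_on_const)
       (auto intro: bounded_linear_imp_has_derivative)
qed

lemma Ck_on_add:
  assumes "open S" "Ck_on k S f" "Ck_on k S g"
  shows "Ck_on k S (\<lambda>x. f x + g x)"
  using assms(2,3)
proof (induction k arbitrary: f g)
  case 0
  then show ?case by (auto intro: continuous_intros)
next
  case (Suc k)
  show ?case
    by (rule Ck_on_SucI[OF assms(1),
          where f' = "\<lambda>x v. frechet_derivative f (at x) v + frechet_derivative g (at x) v"])
       (use Suc in \<open>auto intro!: has_derivative_add has_frechet_derivative\<close>)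
qed

lemma Ck_on_bilinear:
  assumes p: "bounded_bilinear p" and "open S" "Ck_on k S f" "Ck_on k S g"
  shows "Ck_on k S (\<lambda>x. p (f x) (g x))"
  using assms(3,4)
proof (induction k arbitrary: f g)
  case 0
  then show ?case by (auto intro: bounded_bilinear.continuous_on[OF p])
next
  case (Suc k)
  show ?case
  proof (rule Ck_on_SucI[OF assms(2)])
    fix x assume "x \<in> S"
    then show "((\<lambda>x. p (f x) (g x)) has_derivative
        (\<lambda>v. p (f x) (frechet_derivative g (at x) v) + p (frechet_derivative f (at x) v) (g x))) (at x)"
      using Suc.prems by (intro bounded_bilinear.FDERIV[OF p]) (auto intro!: has_frechet_derivative)
  next
    fix v
    have "Ck_on k S f" "Ck_on k S g"
      using Suc.prems Ck_on_Suc_imp by auto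
    then show "Ck_on k S (\<lambda>x. p (f x) (frechet_derivative g (at x) v)
        + p (frechet_derivative f (at x) v) (g x))"
      using Suc by (intro Ck_on_add assms(2)) auto
  qed
qed

lemma Ck_on_sum:
  assumes "open S" "\<And>i. i \<in> I \<Longrightarrow> Ck_on k S (f i)"
  shows "Ck_on k S (\<lambda>x. \<Sum>i\<in>I. f i x)"
  using assms(2) by (induction I rule: infinite_finite_induct) (auto intro: Ck_on_const Ck_on_add assms(1))

lemma linear_euclidean_sum:
  fixes f :: "'v::euclidean_space \<Rightarrow> 'w::real_vector"
  assumes "linear f"
  shows "f v = (\<Sum>e\<in>Basis. (v \<bullet> e) *\<^sub>R f e)"
proof -
  have "f v = f (\<Sum>e\<in>Basis. (v \<bullet> e) *\<^sub>R e)" by (simp add: euclidean_representation)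
  then show ?thesis by (simp add: linear_sum[OF assms] linear_scale[OF assms])
qed

lemma Ck_on_compose:
  fixes f :: "'v::euclidean_space \<Rightarrow> 'w::real_normed_vector"
    and h :: "'u::euclidean_space \<Rightarrow> 'v"
  assumes "open S" "open U" "h ` S \<subseteq> U" "Ck_on k U f" "Ck_on k S h"
  shows "Ck_on k S (\<lambda>x. f (h x))"
  using assms(4,5)
proof (induction k arbitrary: f)
  case 0
  then show ?case using assms(3) by (auto intro: continuous_on_compose2)
next
  case (Suc k)
  show ?case
  proof (rule Ck_on_SucI[OF assms(1)])
    fix x assume x: "x \<in> S"
    have "(f has_derivative frechet_derivative f (at (h x))) (at (h x))"
      using Suc.prems assms(3) x by (intro has_frechet_derivative) auto
    moreover have "(h has_derivative frechet_derivative h (at x)) (at x)"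
      using Suc.prems x by (intro has_frechet_derivative) auto
    ultimately have d: "((\<lambda>x. f (h x)) has_derivative
        (\<lambda>v. frechet_derivative f (at (h x)) (frechet_derivative h (at x) v))) (at x)"
      by (rule has_derivative_compose[rotated])
    have "linear (frechet_derivative f (at (h x)))"
      using Suc.prems assms(3) x by (intro linear_frechet_derivative) auto
    then have "frechet_derivative f (at (h x)) (frechet_derivative h (at x) v) =
        (\<Sum>e\<in>Basis. (frechet_derivative h (at x) v \<bullet> e) *\<^sub>R frechet_derivative f (at (h x)) e)" for v
      by (rule linear_euclidean_sum)
    then have "(\<lambda>v. frechet_derivative f (at (h x)) (frechet_derivative h (at x) v)) =
        (\<lambda>v. \<Sum>e\<in>Basis. (frechet_derivative h (at x) v \<bullet> e) *\<^sub>R frechet_derivative f (at (h x)) e)"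
      by (rule ext)
    with d show "((\<lambda>x. f (h x)) has_derivative (\<lambda>v. \<Sum>e\<in>Basis. (frechet_derivative h (at x) v \<bullet> e) *\<^sub>R
          frechet_derivative f (at (h x)) e)) (at x)"
      by simp
  next
    fix v
    have 1: "Ck_on k S (\<lambda>x. frechet_derivative f (at (h x)) e)" for e
      using Suc.IH[of "\<lambda>y. frechet_derivative f (at y) e"] Suc.prems Ck_on_Suc_imp by auto
    have 2: "Ck_on k S (\<lambda>x. frechet_derivative h (at x) v \<bullet> e)" for e
      by (rule Ck_on_bilinear[OF bounded_bilinear_inner assms(1) _ Ck_on_const[OF assms(1)]])
         (use Suc.prems in auto)
    show "Ck_on k S (\<lambda>x. \<Sum>e\<in>Basis. (frechet_derivative h (at x) v \<bullet> e) *\<^sub>R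
          frechet_derivative f (at (h x)) e)"
      by (intro Ck_on_sum assms(1) Ck_on_bilinear[OF bounded_bilinear_scaleR assms(1) 2 1])
  qed
qed

lemma Ck_on_local:
  assumes "\<And>x. x \<in> S \<Longrightarrow> \<exists>U. open U \<and> x \<in> U \<and> Ck_on k U f"
  shows "Ck_on k S f"
  using assms
proof (induction k arbitrary: f)
  case 0
  have "\<forall>x\<in>S. isCont f x"
    using 0 by (force simp: continuous_on_eq_continuous_at)
  then show ?case by (simp add: continuous_at_imp_continuous_on)
next
  case (Suc k)
  have "f differentiable (at x)" if "x \<in> S" for x
    using Suc.prems[OF that] by auto
  moreover have "Ck_on k S (\<lambda>x. frechet_derivative f (at x) v)" for v
    by (rule Suc.IH) (use Suc.prems in force)
  ultimately show ?case by simp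
qed

lemma smooth_on_cong: "open S \<Longrightarrow> (\<And>x. x \<in> S \<Longrightarrow> f x = g x) \<Longrightarrow> smooth_on S f \<Longrightarrow> smooth_on S g"
  unfolding smooth_on_def using Ck_on_cong by blast

lemma smooth_on_subset: "smooth_on S f \<Longrightarrow> S' \<subseteq> S \<Longrightarrow> smooth_on S' f"
  unfolding smooth_on_def using Ck_on_subset by blast

lemma smooth_on_const: "open S \<Longrightarrow> smooth_on S (\<lambda>x. c)"
  unfolding smooth_on_def using Ck_on_const by blast

lemma smooth_on_linear: "open S \<Longrightarrow> bounded_linear f \<Longrightarrow> smooth_on S f"
  unfolding smooth_on_def using Ck_on_linear by blast

lemma smooth_on_add:
  "open S \<Longrightarrow> smooth_on S f \<Longrightarrow> smooth_on S g \<Longrightarrow> smooth_on S (\<lambda>x. f x + g x)"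
  unfolding smooth_on_def using Ck_on_add by blast

lemma smooth_on_bilinear:
  "bounded_bilinear p \<Longrightarrow> open S \<Longrightarrow> smooth_on S f \<Longrightarrow> smooth_on S g \<Longrightarrow> smooth_on S (\<lambda>x. p (f x) (g x))"
  unfolding smooth_on_def using Ck_on_bilinear by blast

lemmas smooth_on_scaleR = smooth_on_bilinear[OF bounded_bilinear_scaleR]
lemmas smooth_on_mult = smooth_on_bilinear[OF bounded_bilinear_mult]
lemmas smooth_on_inner = smooth_on_bilinear[OF bounded_bilinear_inner]

lemma smooth_on_sum:
  "open S \<Longrightarrow> (\<And>i. i \<in> I \<Longrightarrow> smooth_on S (f i)) \<Longrightarrow> smooth_on S (\<lambda>x. \<Sum>i\<in>I. f i x)"
  unfolding smooth_on_def using Ck_on_sum[of S I _ f] by blast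

lemma smooth_on_compose:
  "open S \<Longrightarrow> open U \<Longrightarrow> h ` S \<subseteq> U \<Longrightarrow> smooth_on U f \<Longrightarrow> smooth_on S h \<Longrightarrow> smooth_on S (\<lambda>x. f (h x))"
  unfolding smooth_on_def using Ck_on_compose by blast

lemma smooth_on_local:
  "(\<And>x. x \<in> S \<Longrightarrow> \<exists>U. open U \<and> x \<in> U \<and> smooth_on U f) \<Longrightarrow> smooth_on S f"
  unfolding smooth_on_def using Ck_on_local[of S _ f] by meson

lemma smooth_on_imp_continuous_on: "smooth_on S f \<Longrightarrow> continuous_on S f"
  unfolding smooth_on_def using Ck_on_imp_continuous_on by blast

lemma smooth_on_imp_differentiable: "smooth_on S f \<Longrightarrow> x \<in> S \<Longrightarrow> f differentiable (at x)"
  unfolding smooth_on_def by (metis Ck_on.simps(2))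

lemma smooth_on_frechet_derivative:
  "smooth_on S f \<Longrightarrow> smooth_on S (\<lambda>x. frechet_derivative f (at x) v)"
  unfolding smooth_on_def by (metis Ck_on.simps(2))


section \<open>A smooth bump function\<close>

text \<open>The functions \<open>P(1/s) exp(-1/s)\<close>, continued by zero to \<open>s \<le> 0\<close>, form a family that is
  stable under differentiation, since \<open>(P(1/s) exp(-1/s))' = Q(1/s) exp(-1/s)\<close> with
  \<open>Q(r) = r\<^sup>2 (P(r) - P'(r))\<close>. This is what makes an induction on the order of
  differentiability work.\<close>

definition flat_exp :: "real poly \<Rightarrow> real \<Rightarrow> real" where
  "flat_exp P s = (if s \<le> 0 then 0 else poly P (1 / s) * exp (- (1 / s)))"

lemma poly_times_exp_minus_tendsto_0: "((\<lambda>r::real. poly P r * exp (- r)) \<longlongrightarrow> 0) at_top"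
proof -
  have "((\<lambda>r::real. \<Sum>i\<le>degree P. coeff P i * (r ^ i / exp r)) \<longlongrightarrow> (\<Sum>i\<le>degree P. coeff P i * 0)) at_top"
    by (intro tendsto_intros tendsto_power_div_exp_0)
  then show ?thesis
    by (simp add: poly_altdef sum_distrib_right exp_minus divide_inverse mult.assoc)
qed

lemma flat_exp_tendsto_0: "((\<lambda>s. flat_exp P s) \<longlongrightarrow> 0) (at 0)"
proof -
  have "((\<lambda>s. poly P (1 / s) * exp (- (1 / s))) \<longlongrightarrow> 0) (at_right (0::real))"
    using filterlim_compose[OF poly_times_exp_minus_tendsto_0[of P] filterlim_inverse_at_top_right]
    by (simp add: divide_inverse)
  moreover have "\<forall>\<^sub>F s in at_right (0::real). poly P (1 / s) * exp (- (1 / s)) = flat_exp P s"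
    unfolding eventually_at_right_field flat_exp_def by (auto intro!: exI[of _ 1])
  ultimately have r: "((\<lambda>s. flat_exp P s) \<longlongrightarrow> 0) (at_right 0)"
    using Lim_transform_eventually by blast
  have "\<forall>\<^sub>F s in at_left (0::real). 0 = flat_exp P s"
    unfolding eventually_at_left_field flat_exp_def by (auto intro!: exI[of _ "-1"])
  then have l: "((\<lambda>s. flat_exp P s) \<longlongrightarrow> 0) (at_left 0)"
    using Lim_transform_eventually[OF tendsto_const] by blast
  show ?thesis
    using filterlim_split_at[OF l r] .
qed

lemma flat_exp_has_derivative:
  "(flat_exp P has_real_derivative flat_exp (monom 1 2 * (P - pderiv P)) s) (at s)"
proof (cases s "0::real" rule: linorder_cases)
  case less
  have "((\<lambda>s. 0) has_real_derivative 0) (at s)" by simp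
  then have "(flat_exp P has_real_derivative 0) (at s)"
    by (rule has_field_derivative_transform_within_open[of _ _ _ "{..<0}"])
       (use less in \<open>auto simp: flat_exp_def\<close>)
  then show ?thesis using less by (simp add: flat_exp_def)
next
  case greater
  have "((\<lambda>s. poly P (1 / s) * exp (- (1 / s))) has_real_derivative
      poly (monom 1 2 * (P - pderiv P)) (1 / s) * exp (- (1 / s))) (at s)"
    using greater
    by (auto intro!: derivative_eq_intros DERIV_chain2[OF poly_DERIV]
        simp: poly_monom power2_eq_square field_simps)
  then have "(flat_exp P has_real_derivative
      poly (monom 1 2 * (P - pderiv P)) (1 / s) * exp (- (1 / s))) (at s)"
    by (rule has_field_derivative_transform_within_open[of _ _ _ "{0<..}"])
       (use greater in \<open>auto simp: flat_exp_def\<close>)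
  then show ?thesis using greater by (simp add: flat_exp_def)
next
  case equal
  \<comment> \<open>At \<open>0\<close> the difference quotient of \<open>flat_exp P\<close> is itself of the form \<open>flat_exp Q\<close>.\<close>
  have "(flat_exp P h - flat_exp P 0) / (h - 0) = flat_exp (monom 1 1 * P) h" for h
    by (simp add: flat_exp_def poly_monom field_simps)
  then show ?thesis
    using flat_exp_tendsto_0[of "monom 1 1 * P"] unfolding equal
    by (simp add: has_field_derivative_iff flat_exp_def)
qed

lemma smooth_on_flat_exp: "smooth_on UNIV (flat_exp P)"
proof -
  have "Ck_on k UNIV (flat_exp P)" for k
  proof (induction k arbitrary: P)
    case 0
    then show ?case
      by (auto intro!: DERIV_isCont flat_exp_has_derivative simp: continuous_on_eq_continuous_at)
  next
    case (Suc k)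
    have "Ck_on k UNIV (\<lambda>s. flat_exp (monom 1 2 * (P - pderiv P)) s * v)" for v
      by (rule Ck_on_bilinear[OF bounded_bilinear_mult]) (auto intro: Suc Ck_on_const)
    then show ?case
      by (intro Ck_on_SucI[where f' = "\<lambda>s v. flat_exp (monom 1 2 * (P - pderiv P)) s * v"])
         (use flat_exp_has_derivative in \<open>auto simp: has_field_derivative_def\<close>)
  qed
  then show ?thesis by (simp add: smooth_on_def)
qed

lemma exists_bump:
  fixes y0 :: "'v::euclidean_space"
  assumes "r > 0"
  obtains \<phi> :: "'v \<Rightarrow> real" where "smooth_on UNIV \<phi>" "\<And>y. \<phi> y \<ge> 0" "\<phi> y0 > 0"
    "\<And>y. y \<notin> cball y0 r \<Longrightarrow> \<phi> y = 0"
proof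
  define q where "q y = r\<^sup>2 - (y - y0) \<bullet> (y - y0)" for y :: 'v
  let ?\<phi> = "\<lambda>y. flat_exp 1 (q y)"
  have "smooth_on UNIV (\<lambda>y::'v. y - y0)"
    using smooth_on_add[OF _ smooth_on_linear[OF _ bounded_linear_ident] smooth_on_const[of _ "- y0"]]
    by simp
  then have "smooth_on UNIV (\<lambda>y. (-1) * ((y - y0) \<bullet> (y - y0)))"
    by (intro smooth_on_mult smooth_on_const smooth_on_inner) auto
  then have "smooth_on UNIV (\<lambda>y. r\<^sup>2 + (-1) * ((y - y0) \<bullet> (y - y0)))"
    by (intro smooth_on_add smooth_on_const) auto
  then have "smooth_on UNIV q"
    by (simp add: q_def[abs_def])
  then show "smooth_on UNIV ?\<phi>"
    by (intro smooth_on_compose[OF _ open_UNIV _ smooth_on_flat_exp]) auto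
  show "?\<phi> y \<ge> 0" for y
    by (simp add: flat_exp_def)
  show "?\<phi> y0 > 0"
    using assms by (simp add: flat_exp_def q_def)
  show "?\<phi> y = 0" if "y \<notin> cball y0 r" for y
  proof -
    have "r \<le> norm (y - y0)"
      using that by (simp add: dist_norm norm_minus_commute)
    then have "r\<^sup>2 \<le> (norm (y - y0))\<^sup>2"
      using assms by (intro power_mono) auto
    then show ?thesis by (simp add: flat_exp_def q_def dot_square_norm)
  qed
qed

section \<open>Contraction over a subspace with respect to a symmetric form\<close>

text \<open>The vector of \<open>U\<close> that \<open>b\<close> pairs with \<open>U\<close> in the way in which the Euclidean inner product
  pairs \<open>v\<close> with \<open>U\<close>. Traces over an orthonormal frame of \<open>U\<close> become sums over the standard basis
  in which one argument is replaced by its image under this map. Such a sum neither depends on a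
  frame nor requires a frame that varies continuously with \<open>b\<close>.\<close>

definition sharp :: "('v::euclidean_space \<Rightarrow> 'v \<Rightarrow> real) \<Rightarrow> 'v set \<Rightarrow> 'v \<Rightarrow> 'v" where
  "sharp b U v = (THE z. z \<in> U \<and> (\<forall>w\<in>U. b z w = v \<bullet> w))"

locale symmetric_form =
  fixes b :: "'v::euclidean_space \<Rightarrow> 'v \<Rightarrow> real"
  assumes bil: "bilinear b" and sym: "b v w = b w v"
begin

lemma form_simps:
  "b (u + v) w = b u w + b v w" "b u (v + w) = b u v + b u w"
  "b (u - v) w = b u w - b v w" "b u (v - w) = b u v - b u w"
  "b (c *\<^sub>R u) w = c * b u w" "b u (c *\<^sub>R w) = c * b u w"
  "b 0 w = 0" "b u 0 = 0" "b (- u) w = - b u w" "b u (- w) = - b u w"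
  using bil by (simp_all add: bilinear_ladd bilinear_radd bilinear_lsub bilinear_rsub bilinear_lmul
      bilinear_rmul bilinear_lzero bilinear_rzero bilinear_lneg bilinear_rneg)

lemma form_sum:
  "b (\<Sum>i\<in>I. f i) w = (\<Sum>i\<in>I. b (f i) w)" "b u (\<Sum>i\<in>I. f i) = (\<Sum>i\<in>I. b u (f i))"
  using linear_sum[of "\<lambda>x. b x w" f I] linear_sum[of "b u" f I] bil by (auto simp: bilinear_def)

lemma subspace_orth: "subspace (orth b U)"
  by (auto simp: subspace_def orth_def form_simps)

lemma exists_nonnull:
  assumes "subspace U" "nondegenerate_on b U" "u \<in> U" "u \<noteq> 0"
  shows "\<exists>v\<in>U. b v v \<noteq> 0"
proof (rule ccontr)
  assume null: "\<not> ?thesis"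
  obtain w where w: "w \<in> U" "b u w \<noteq> 0"
    using assms by (auto simp: nondegenerate_on_def)
  then have "b (u + w) (u + w) = 0"
    using null assms(1,3) subspace_add by blast
  moreover have "b (u + w) (u + w) = 2 * b u w"
    using null w assms(3) sym[of w u] by (simp add: form_simps)
  ultimately show False using w by simp
qed

text \<open>Gram-Schmidt in indefinite signature: a vector that is not null exists by polarization, and
  its orthogonal complement within the subspace is again non-degenerate.\<close>

lemma exists_orthonormal_frame:
  assumes "subspace U" "nondegenerate_on b U"
  shows "\<exists>E. orthonormal_frame b U E"
  using assms
proof (induction "dim U" arbitrary: U)
  case 0
  then have "orthonormal_frame b U E" for E
    unfolding orthonormal_frame_def 0(1)[symmetric] by blast
  then show ?case by blast
next
  case (Suc m)
  then have "U \<noteq> {0}" by auto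
  then obtain u where "u \<in> U" "u \<noteq> 0"
    using subspace_0[OF Suc.prems(1)] by blast
  then obtain v where v: "v \<in> U" "b v v \<noteq> 0"
    using exists_nonnull Suc.prems by blast
  define e where "e = (1 / sqrt \<bar>b v v\<bar>) *\<^sub>R v"
  have e: "e \<in> U" using v Suc.prems by (simp add: e_def subspace_scale)
  have "b e e = b v v / \<bar>b v v\<bar>"
    using v by (simp add: e_def form_simps real_sqrt_mult_self flip: real_sqrt_mult)
  then have ee: "b e e \<in> {-1, 1}" using v by (simp add: abs_if)
  define U' where "U' = {w \<in> U. b e w = 0}"
  have sub: "subspace U'"
    using Suc.prems(1) by (auto simp: U'_def subspace_def form_simps)
  have split: "w - (b e e * b e w) *\<^sub>R e \<in> U'" if "w \<in> U" for w
    using that e ee Suc.prems(1)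
    by (auto simp: U'_def form_simps intro!: subspace_diff subspace_add subspace_scale)
  have nd: "nondegenerate_on b U'"
    unfolding nondegenerate_on_def
  proof (intro ballI impI)
    fix u assume u: "u \<in> U'" and z: "\<forall>w\<in>U'. b u w = 0"
    have "b u w = 0" if "w \<in> U" for w
      using z split[OF that] u sym[of u e] by (auto simp: form_simps U'_def)
    then show "u = 0" using Suc.prems(2) u by (auto simp: nondegenerate_on_def U'_def)
  qed
  have "e \<notin> span U'"
    using sub ee by (auto simp: U'_def span_eq_iff[THEN iffD2])
  moreover have "U = span (insert e U')"
  proof (rule antisym)
    show "U \<subseteq> span (insert e U')"
    proof
      fix w assume "w \<in> U"
      from split[OF this] show "w \<in> span (insert e U')"
        unfolding span_insert by (auto intro: span_base)
    qed
    show "span (insert e U') \<subseteq> U"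
      using e Suc.prems(1) by (intro span_minimal) (auto simp: U'_def)
  qed
  ultimately have "dim U = Suc (dim U')"
    by (metis dim_insert dim_span Suc_eq_plus1)
  then have m: "m = dim U'" using Suc.hyps by simp
  obtain E where E: "orthonormal_frame b U' E"
    using Suc.hyps(1)[OF m sub nd] by blast
  have E': "\<forall>i<m. E i \<in> U' \<and> b (E i) (E i) \<in> {-1, 1} \<and> (\<forall>j<m. j \<noteq> i \<longrightarrow> b (E i) (E j) = 0)"
    using E unfolding orthonormal_frame_def m[symmetric] .
  have "E i \<in> U" "b e (E i) = 0" "b (E i) e = 0" if "i < m" for i
    using E' that sym[of "E i" e] by (auto simp: U'_def)
  then have "orthonormal_frame b U (\<lambda>i. if i < m then E i else e)"
    using E' e ee unfolding orthonormal_frame_def Suc.hyps(2)[symmetric] by (auto simp: less_Suc_eq)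
  then show ?case by blast
qed

lemma frame_orthonormal:
  "subspace U \<Longrightarrow> nondegenerate_on b U \<Longrightarrow> orthonormal_frame b U (frame b U)"
  unfolding frame_def using exists_orthonormal_frame by (rule someI_ex)

lemma orthonormal_expansion:
  assumes U: "subspace U" and E: "orthonormal_frame b U E" and u: "u \<in> U"
  shows "u = (\<Sum>i<dim U. (b (E i) (E i) * b u (E i)) *\<^sub>R E i)"
proof -
  have mem: "E i \<in> U" and nonnull: "b (E i) (E i) * b (E i) (E i) = 1"
    and ort: "j < dim U \<Longrightarrow> j \<noteq> i \<Longrightarrow> b (E i) (E j) = 0" if "i < dim U" for i j
    using E that by (auto simp: orthonormal_frame_def)
  have inj: "inj_on E {..<dim U}"
    by (rule inj_onI) (metis lessThan_iff mult_zero_left nonnull ort zero_neq_one)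
  have coeff: "b (\<Sum>i<dim U. c i *\<^sub>R E i) (E j) = c j * b (E j) (E j)" if j: "j < dim U" for c j
  proof -
    have "b (\<Sum>i<dim U. c i *\<^sub>R E i) (E j) = (\<Sum>i<dim U. if i = j then c j * b (E j) (E j) else 0)"
      unfolding form_sum by (rule sum.cong[OF refl]) (use ort j in \<open>auto simp: form_simps\<close>)
    then show ?thesis using j by simp
  qed
  have "independent (E ` {..<dim U})"
  proof (rule independent_if_scalars_zero)
    fix c v assume z: "(\<Sum>x\<in>E ` {..<dim U}. c x *\<^sub>R x) = 0" and "v \<in> E ` {..<dim U}"
    then obtain j where j: "j < dim U" "v = E j" by auto
    have "(\<Sum>i<dim U. c (E i) *\<^sub>R E i) = 0"
      using z by (simp add: sum.reindex[OF inj])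
    then have "c (E j) * b (E j) (E j) = 0"
      using coeff[OF j(1), of "\<lambda>i. c (E i)"] by (simp add: form_simps)
    then show "c v = 0" using nonnull[OF j(1)] j by auto
  qed simp
  moreover have "dim U \<le> card (E ` {..<dim U})"
    by (simp add: card_image[OF inj])
  ultimately have "U \<subseteq> span (E ` {..<dim U})"
    by (intro card_ge_dim_independent) (use mem in auto)
  then obtain c where "u = (\<Sum>x\<in>E ` {..<dim U}. c x *\<^sub>R x)"
    using u by (auto simp: span_finite)
  then have c: "u = (\<Sum>i<dim U. c (E i) *\<^sub>R E i)"
    by (simp add: sum.reindex[OF inj])
  have "b (E j) (E j) * b u (E j) = c (E j)" if "j < dim U" for j
    using coeff[OF that, of "\<lambda>i. c (E i)"] nonnull[OF that] unfolding c[symmetric] by simp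
  then show ?thesis by (subst c) (auto intro!: sum.cong)
qed

lemma sharp_eqI:
  assumes "subspace U" "nondegenerate_on b U" "z \<in> U" "\<And>w. w \<in> U \<Longrightarrow> b z w = v \<bullet> w"
  shows "sharp b U v = z"
  unfolding sharp_def
proof (rule the_equality)
  fix y assume y: "y \<in> U \<and> (\<forall>w\<in>U. b y w = v \<bullet> w)"
  then have "b (y - z) w = 0" if "w \<in> U" for w
    using assms(4) that by (simp add: form_simps)
  moreover have "y - z \<in> U"
    using assms(1,3) y subspace_diff by blast
  ultimately have "y - z = 0"
    using assms(2) unfolding nondegenerate_on_def by blast
  then show "y = z" by simp
qed (use assms in auto)

lemma sharp_frame:
  assumes U: "subspace U" "nondegenerate_on b U" and E: "orthonormal_frame b U E"
  shows "sharp b U v = (\<Sum>i<dim U. (b (E i) (E i) * (v \<bullet> E i)) *\<^sub>R E i)"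
proof (rule sharp_eqI[OF U])
  show "(\<Sum>i<dim U. (b (E i) (E i) * (v \<bullet> E i)) *\<^sub>R E i) \<in> U"
    using E by (intro subspace_sum U(1) subspace_scale) (auto simp: orthonormal_frame_def)
  fix w assume "w \<in> U"
  then have "v \<bullet> w = (\<Sum>i<dim U. b (E i) (E i) * b w (E i) * (v \<bullet> E i))"
    by (subst orthonormal_expansion[OF U(1) E]) (auto simp: inner_sum_right)
  then show "b (\<Sum>i<dim U. (b (E i) (E i) * (v \<bullet> E i)) *\<^sub>R E i) w = v \<bullet> w"
    by (simp add: form_sum form_simps sym[of w] algebra_simps)
qed

lemma
  assumes U: "subspace U" "nondegenerate_on b U"
  shows sharp_mem: "sharp b U v \<in> U"
    and sharp_form: "w \<in> U \<Longrightarrow> b (sharp b U v) w = v \<bullet> w"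
proof -
  obtain E where E: "orthonormal_frame b U E"
    using exists_orthonormal_frame[OF U] by blast
  show "sharp b U v \<in> U"
    unfolding sharp_frame[OF U E]
    using E by (intro subspace_sum U(1) subspace_scale) (auto simp: orthonormal_frame_def)
  fix w assume "w \<in> U"
  then have "v \<bullet> w = (\<Sum>i<dim U. b (E i) (E i) * b w (E i) * (v \<bullet> E i))"
    by (subst orthonormal_expansion[OF U(1) E]) (auto simp: inner_sum_right)
  then show "b (sharp b U v) w = v \<bullet> w"
    by (simp add: sharp_frame[OF U E] form_sum form_simps sym[of w] algebra_simps)
qed

lemma linear_sharp:
  assumes U: "subspace U" "nondegenerate_on b U"
  shows "linear (sharp b U)"
proof (rule linearI)
  show "sharp b U (v + w) = sharp b U v + sharp b U w" for v w
    by (rule sharp_eqI[OF U]) (use sharp_mem[OF U] sharp_form[OF U] U(1) in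
        \<open>auto simp: form_simps inner_add_left subspace_add\<close>)
  show "sharp b U (c *\<^sub>R v) = c *\<^sub>R sharp b U v" for c v
    by (rule sharp_eqI[OF U]) (use sharp_mem[OF U] sharp_form[OF U] U(1) in
        \<open>auto simp: form_simps subspace_scale\<close>)
qed

lemma frame_contraction:
  fixes f :: "'v \<Rightarrow> 'v \<Rightarrow> 'w::real_vector"
  assumes U: "subspace U" "nondegenerate_on b U" and E: "orthonormal_frame b U E" and f: "bilinear f"
  shows "(\<Sum>i<dim U. b (E i) (E i) *\<^sub>R f (E i) (E i)) = (\<Sum>e\<in>Basis. f e (sharp b U e))"
proof -
  have l: "linear (\<lambda>u. f u v)" "linear (f v)" for v
    using f by (auto simp: bilinear_def)
  have "(\<Sum>e\<in>Basis. f e (sharp b U e))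
      = (\<Sum>e\<in>Basis. \<Sum>i<dim U. b (E i) (E i) *\<^sub>R ((e \<bullet> E i) *\<^sub>R f e (E i)))"
    unfolding sharp_frame[OF U E] by (simp add: linear_sum[OF l(2)] linear_scale[OF l(2)])
  also have "\<dots> = (\<Sum>i<dim U. b (E i) (E i) *\<^sub>R (\<Sum>e\<in>Basis. (E i \<bullet> e) *\<^sub>R f e (E i)))"
    by (subst sum.swap) (simp add: scaleR_sum_right inner_commute)
  also have "\<dots> = (\<Sum>i<dim U. b (E i) (E i) *\<^sub>R f (E i) (E i))"
    by (simp flip: linear_euclidean_sum[OF l(1)])
  finally show ?thesis ..
qed

end

section \<open>The mixed scalar of a tensor at a point\<close>

lemma bilinearI:
  assumes "\<And>u u' v. f (u + u') v = f u v + f u' v" "\<And>c u v. f (c *\<^sub>R u) v = c *\<^sub>R f u v"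
    "\<And>u v v'. f u (v + v') = f u v + f u v'" "\<And>c u v. f u (c *\<^sub>R v) = c *\<^sub>R f u v"
  shows "bilinear f"
  using assms by (auto simp: bilinear_def intro!: linearI)

text \<open>Each frame vector occurs twice in a summand of the mixed scalar. Splitting the two
  occurrences makes the summand bilinear in \<open>(u, u')\<close> and in \<open>(v, v')\<close>, so that it can be
  contracted in any basis.\<close>

definition mixed_term ::
    "('v::euclidean_space \<Rightarrow> 'v \<Rightarrow> real) \<Rightarrow> ('v \<Rightarrow> 'v \<Rightarrow> 'v) \<Rightarrow> 'v \<Rightarrow> 'v \<Rightarrow> 'v \<Rightarrow> 'v \<Rightarrow> real" where
  "mixed_term b T u u' v v' =
     b (T v (T u u') - T u (T v u')) v' + b (T u (T v v') - T v (T u v')) u'"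

text \<open>The polarization of the quadratic dependence of \<open>mixed_term\<close> on the tensor.\<close>

definition polar_term ::
    "('v::euclidean_space \<Rightarrow> 'v \<Rightarrow> real) \<Rightarrow> ('v \<Rightarrow> 'v \<Rightarrow> 'v) \<Rightarrow> ('v \<Rightarrow> 'v \<Rightarrow> 'v) \<Rightarrow>
      'v \<Rightarrow> 'v \<Rightarrow> real" where
  "polar_term b T K u v =
     b (T v (K u u) + K v (T u u) - T u (K v u) - K u (T v u)) v
   + b (T u (K v v) + K u (T v v) - T v (K u v) - K v (T u v)) u"

definition mixed_polar ::
    "('v::euclidean_space \<Rightarrow> 'v \<Rightarrow> real) \<Rightarrow> 'v set \<Rightarrow> ('v \<Rightarrow> 'v \<Rightarrow> 'v) \<Rightarrow> ('v \<Rightarrow> 'v \<Rightarrow> 'v) \<Rightarrow> real" where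
  "mixed_polar b W T K = (let E = frame b W; F = frame b (orth b W) in
     \<Sum>a<dim W. \<Sum>i<dim (orth b W). b (E a) (E a) * b (F i) (F i) * polar_term b T K (E a) (F i))"

text \<open>Pointwise form of the conditions for a statistical contorsion tensor: the cubic form
  \<open>b (T u v) w\<close> is totally symmetric.\<close>

definition statistical_at ::
    "('v::euclidean_space \<Rightarrow> 'v \<Rightarrow> real) \<Rightarrow> ('v \<Rightarrow> 'v \<Rightarrow> 'v) \<Rightarrow> bool" where
  "statistical_at b T \<longleftrightarrow> bilinear T \<and> (\<forall>u v. T u v = T v u) \<and> (\<forall>u v w. b (T u v) w = b v (T u w))"

definition critical_at ::
    "('v::euclidean_space \<Rightarrow> 'v \<Rightarrow> real) \<Rightarrow> 'v set \<Rightarrow> ('v \<Rightarrow> 'v \<Rightarrow> 'v) \<Rightarrow> bool" where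
  "critical_at b W T \<longleftrightarrow>
     top_part b W (Tr_top b W T) = 0 \<and> perp_part b W (Tr_perp b W T) = 0 \<and>
     (\<forall>X\<in>W. \<forall>Y\<in>W. perp_part b W (T X Y) = 0) \<and>
     (\<forall>U\<in>orth b W. \<forall>V\<in>orth b W. top_part b W (T U V) = 0)"

locale split_form = symmetric_form +
  fixes W
  assumes W: "subspace W" "nondegenerate_on b W"
    and nondegenerate: "(\<And>w. b v w = 0) \<Longrightarrow> v = 0"
begin

lemma split_unique:
  assumes "u \<in> W" "u' \<in> W" "v - u \<in> orth b W" "v - u' \<in> orth b W"
  shows "u = u'"
proof -
  have "u - u' \<in> W" using assms W by (simp add: subspace_diff)
  moreover have "b (u - u') w = 0" if "w \<in> W" for w
    using assms(3,4) that by (simp add: orth_def form_simps)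
  ultimately have "u - u' = 0" using W(2) unfolding nondegenerate_on_def by blast
  then show ?thesis by simp
qed

lemma split_exists: "\<exists>u\<in>W. v - u \<in> orth b W"
proof
  \<comment> \<open>\<open>v\<^sub>b\<close> represents the functional \<open>b v\<close> by the Euclidean inner product.\<close>
  define v\<^sub>b where "v\<^sub>b = (\<Sum>e\<in>Basis. b v e *\<^sub>R e)"
  have "linear (b v)" using bil by (simp add: bilinear_def)
  then have "v\<^sub>b \<bullet> w = b v w" for w
    by (simp add: v\<^sub>b_def inner_sum_left linear_euclidean_sum[of "b v" w] inner_commute[of w] mult.commute)
  then show "v - sharp b W v\<^sub>b \<in> orth b W"
    using sharp_form[OF W, of _ v\<^sub>b] by (auto simp: orth_def form_simps)
  show "sharp b W v\<^sub>b \<in> W" by (rule sharp_mem[OF W])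
qed

lemma top_part_eqI: "u \<in> W \<Longrightarrow> v - u \<in> orth b W \<Longrightarrow> top_part b W v = u"
  unfolding top_part_def by (rule the_equality) (auto intro: split_unique)

lemma top_part_mem: "top_part b W v \<in> W" and diff_top_part: "v - top_part b W v \<in> orth b W"
  using split_exists[of v] top_part_eqI by auto

lemma perp_part_eq: "perp_part b W v = v - top_part b W v"
  unfolding perp_part_def
proof (rule the_equality)
  show "v - top_part b W v \<in> orth b W \<and> v - (v - top_part b W v) \<in> W"
    using top_part_mem diff_top_part by simp
  fix u assume u: "u \<in> orth b W \<and> v - u \<in> W"
  then have "top_part b W v = v - u" by (intro top_part_eqI) auto
  then show "u = v - top_part b W v" by simp
qed

lemma perp_part_mem: "perp_part b W v \<in> orth b W"
  using diff_top_part perp_part_eq by simp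

lemma top_plus_perp: "top_part b W v + perp_part b W v = v"
  by (simp add: perp_part_eq)

lemma top_part_of_mem: "v \<in> W \<Longrightarrow> top_part b W v = v"
  using subspace_0[OF subspace_orth] by (intro top_part_eqI) auto

lemma top_part_of_orth: "v \<in> orth b W \<Longrightarrow> top_part b W v = 0"
  using subspace_0[OF W(1)] by (intro top_part_eqI) auto

lemma top_part_eq_0_iff: "top_part b W v = 0 \<longleftrightarrow> v \<in> orth b W"
  using diff_top_part[of v] top_part_of_orth by auto

lemma perp_part_eq_0_iff: "perp_part b W v = 0 \<longleftrightarrow> v \<in> W"
  using top_part_mem[of v] top_part_of_mem by (auto simp: perp_part_eq)

lemma linear_top_part: "linear (top_part b W)"
proof (rule linearI)
  show "top_part b W (u + v) = top_part b W u + top_part b W v" for u v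
    using subspace_add[OF subspace_orth diff_top_part[of u] diff_top_part[of v]]
    by (intro top_part_eqI) (auto simp: algebra_simps intro!: subspace_add W(1) top_part_mem)
  show "top_part b W (c *\<^sub>R v) = c *\<^sub>R top_part b W v" for c v
    using subspace_scale[OF subspace_orth diff_top_part[of v], of c]
    by (intro top_part_eqI) (auto simp: algebra_simps intro!: subspace_scale W(1) top_part_mem)
qed

lemma orth_form: "w \<in> W \<Longrightarrow> v \<in> orth b W \<Longrightarrow> b v w = 0" "w \<in> W \<Longrightarrow> v \<in> orth b W \<Longrightarrow> b w v = 0"
  using sym by (auto simp: orth_def)

text \<open>Non-degeneracy on the whole space turns \<open>W\<close> into its own double orthogonal complement.\<close>

lemma orth_orth:
  assumes "\<And>u. u \<in> orth b W \<Longrightarrow> b v u = 0"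
  shows "v \<in> W"
proof -
  have "b (perp_part b W v) w = 0" for w
  proof -
    have "b (perp_part b W v) w = b (perp_part b W v) (perp_part b W w)"
      using form_simps(2)[of "perp_part b W v" "top_part b W w" "perp_part b W w"]
        orth_form(1)[OF top_part_mem perp_part_mem] by (simp add: top_plus_perp)
    also have "\<dots> = b v (perp_part b W w)"
      using form_simps(1)[of "top_part b W v" "perp_part b W v" "perp_part b W w"]
        orth_form(2)[OF top_part_mem perp_part_mem] by (simp add: top_plus_perp)
    finally show ?thesis using assms perp_part_mem by simp
  qed
  then have "perp_part b W v = 0" by (rule nondegenerate)
  then show ?thesis by (simp add: perp_part_eq_0_iff)
qed

lemma orth_nondegenerate: "nondegenerate_on b (orth b W)"
  unfolding nondegenerate_on_def
proof (intro ballI impI)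
  fix v assume v: "v \<in> orth b W" and z: "\<forall>w\<in>orth b W. b v w = 0"
  then have "v \<in> W" using orth_orth by blast
  then show "v = 0" using v W(2) sym by (auto simp: nondegenerate_on_def orth_def)
qed

lemmas O = subspace_orth[of W] orth_nondegenerate

text \<open>The inverse of the form on the whole space is the sum of the inverses on the two summands.
  This gives access to the moving complement through two subspaces that do not move.\<close>

lemma sharp_orth_eqI:
  assumes "\<And>w. b z w = v \<bullet> w"
  shows "sharp b (orth b W) v = z - sharp b W v"
proof (rule sharp_eqI[OF O])
  show "z - sharp b W v \<in> orth b W"
    using assms sharp_form[OF W, of _ v] by (auto simp: orth_def form_simps)
  show "b (z - sharp b W v) w = v \<bullet> w" if "w \<in> orth b W" for w
    using assms orth_form(2)[OF sharp_mem[OF W] that] by (simp add: form_simps)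
qed

lemma bilinear_mixed_term:
  assumes "bilinear T"
  shows "bilinear (\<lambda>u u'. mixed_term b T u u' v v')" "bilinear (\<lambda>v v'. mixed_term b T u u' v v')"
  by (rule bilinearI; simp add: mixed_term_def bilinear_ladd[OF assms] bilinear_radd[OF assms]
      bilinear_lmul[OF assms] bilinear_rmul[OF assms] form_simps algebra_simps)+

lemma mixed_scalar_eq_frame_sum:
  "mixed_scalar b W T = (\<Sum>a<dim W. \<Sum>i<dim (orth b W).
     b (frame b W a) (frame b W a) * b (frame b (orth b W) i) (frame b (orth b W) i) *
     mixed_term b T (frame b W a) (frame b W a) (frame b (orth b W) i) (frame b (orth b W) i))"
  by (simp add: mixed_scalar_def mixed_term_def Let_def)

lemma double_frame_contraction:
  fixes f :: "'a \<Rightarrow> 'a \<Rightarrow> 'a \<Rightarrow> 'a \<Rightarrow> real"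
  assumes f: "\<And>v v'. bilinear (\<lambda>u u'. f u u' v v')" "\<And>u u'. bilinear (f u u')"
    and E: "orthonormal_frame b W E" and F: "orthonormal_frame b (orth b W) F"
  shows "(\<Sum>a<dim W. \<Sum>i<dim (orth b W). b (E a) (E a) * b (F i) (F i) * f (E a) (E a) (F i) (F i))
     = (\<Sum>k\<in>Basis. \<Sum>l\<in>Basis. f k (sharp b W k) l (sharp b (orth b W) l))"
proof -
  have "(\<Sum>a<dim W. \<Sum>i<dim (orth b W). b (E a) (E a) * b (F i) (F i) * f (E a) (E a) (F i) (F i))
     = (\<Sum>a<dim W. b (E a) (E a) *\<^sub>R (\<Sum>i<dim (orth b W). b (F i) (F i) *\<^sub>R
       f (E a) (E a) (F i) (F i)))"
    by (simp add: sum_distrib_left mult.assoc)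
  also have "\<dots> = (\<Sum>a<dim W. b (E a) (E a) *\<^sub>R (\<Sum>l\<in>Basis. f (E a) (E a) l (sharp b (orth b W) l)))"
    by (simp only: frame_contraction[OF O F f(2)])
  also have "\<dots> = (\<Sum>l\<in>Basis. \<Sum>a<dim W. b (E a) (E a) *\<^sub>R f (E a) (E a) l (sharp b (orth b W) l))"
    by (subst sum.swap) (simp add: sum_distrib_left)
  also have "\<dots> = (\<Sum>l\<in>Basis. \<Sum>k\<in>Basis. f k (sharp b W k) l (sharp b (orth b W) l))"
    by (simp only: frame_contraction[OF W E f(1)])
  finally show ?thesis by (subst (asm) (2) sum.swap)
qed

lemma mixed_scalar_contraction:
  "bilinear T \<Longrightarrow> mixed_scalar b W T =
     (\<Sum>k\<in>Basis. \<Sum>l\<in>Basis. mixed_term b T k (sharp b W k) l (sharp b (orth b W) l))"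
  unfolding mixed_scalar_eq_frame_sum
  by (intro double_frame_contraction bilinear_mixed_term frame_orthonormal W O)

lemma mixed_scalar_frames:
  assumes "bilinear T" "orthonormal_frame b W E" "orthonormal_frame b (orth b W) F"
  shows "mixed_scalar b W T = (\<Sum>a<dim W. \<Sum>i<dim (orth b W). b (E a) (E a) * b (F i) (F i) *
       mixed_term b T (E a) (E a) (F i) (F i))"
  unfolding mixed_scalar_contraction[OF assms(1)]
  by (intro double_frame_contraction[symmetric] bilinear_mixed_term assms)

lemma mixed_scalar_quadratic:
  assumes "bilinear T" "bilinear K"
  shows "mixed_scalar b W (\<lambda>u v. T u v + s *\<^sub>R K u v) =
    mixed_scalar b W T + s * mixed_polar b W T K + s\<^sup>2 * mixed_scalar b W K"
proof -
  have "mixed_term b (\<lambda>u v. T u v + s *\<^sub>R K u v) u u v v =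
      mixed_term b T u u v v + s * polar_term b T K u v + s\<^sup>2 * mixed_term b K u u v v" for u v
    using assms
    by (simp add: mixed_term_def polar_term_def bilinear_ladd bilinear_radd bilinear_lmul
        bilinear_rmul form_simps algebra_simps power2_eq_square)
  then show ?thesis
    unfolding mixed_scalar_eq_frame_sum mixed_polar_def Let_def
    by (simp add: distrib_left sum.distrib sum_distrib_left mult.left_commute)
qed

lemma split_form_pullback:
  fixes L :: "'a \<Rightarrow> 'a"
  assumes L: "linear L" "linear L'" "\<And>v. L (L' v) = v" "\<And>v. L' (L v) = v"
    and V: "W = L ` V" "subspace V"
  shows "split_form (\<lambda>u v. b (L u) (L v)) V"
proof -
  let ?b = "\<lambda>u v. b (L u) (L v)"
  have bil': "bilinear ?b"
    unfolding bilinear_def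
  proof (intro conjI allI)
    fix u
    have l: "linear (b u)" "linear (\<lambda>x. b x u)" for u using bil by (auto simp: bilinear_def)
    show "linear (\<lambda>v. b (L u) (L v))" "linear (\<lambda>v. b (L v) (L u))"
      using linear_compose[OF L(1) l(1)] linear_compose[OF L(1) l(2)] by (simp_all add: comp_def)
  qed
  show "split_form ?b V"
  proof unfold_locales
    show "nondegenerate_on ?b V"
      unfolding nondegenerate_on_def
    proof (intro ballI impI)
      fix v assume v: "v \<in> V" "\<forall>w\<in>V. ?b v w = 0"
      then have "L v = 0" using W(2) V(1) by (auto simp: nondegenerate_on_def)
      then show "v = 0" using L(4)[of v] by (simp add: linear_0[OF L(2)])
    qed
    show "v = 0" if "\<And>w. ?b v w = 0" for v
    proof -
      have "b (L v) w = 0" for w using that[of "L' w"] by (simp add: L(3))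
      then have "L v = 0" by (rule nondegenerate)
      then show ?thesis using L(4)[of v] by (simp add: linear_0[OF L(2)])
    qed
  qed (use V bil' sym in \<open>blast+\<close>)
qed

text \<open>Change of basis: the mixed scalar is invariant because \<open>L\<close> maps orthonormal frames of the
  pulled-back form to orthonormal frames of \<open>b\<close>, and the choice of frame is irrelevant.\<close>

lemma mixed_scalar_pullback:
  fixes L :: "'a \<Rightarrow> 'a"
  assumes L: "linear L" "linear L'" "\<And>v. L (L' v) = v" "\<And>v. L' (L v) = v"
    and V: "W = L ` V" "subspace V" and T: "bilinear T"
  shows "mixed_scalar b W T =
    mixed_scalar (\<lambda>u v. b (L u) (L v)) V (\<lambda>u v. L' (T (L u) (L v)))"
proof -
  let ?b = "\<lambda>u v. b (L u) (L v)" and ?T = "\<lambda>u v. L' (T (L u) (L v))"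
  have inj: "inj L" by (metis L(4) injI)
  interpret p: split_form ?b V
    by (rule split_form_pullback[OF L V])
  have orth: "orth b W = L ` orth ?b V"
  proof
    show "orth b W \<subseteq> L ` orth ?b V"
    proof
      fix v assume "v \<in> orth b W"
      then have "L' v \<in> orth ?b V" using L(3) V(1) by (auto simp: orth_def)
      then show "v \<in> L ` orth ?b V" using L(3) by (metis image_eqI)
    qed
  qed (use V(1) in \<open>auto simp: orth_def\<close>)
  have dims: "dim W = dim V" "dim (orth b W) = dim (orth ?b V)"
    unfolding V(1) orth[unfolded V(1)] using inj L(1)
    by (auto intro!: dim_image_eq intro: inj_on_subset)
  let ?E = "frame ?b V" and ?F = "frame ?b (orth ?b V)"
  have E: "orthonormal_frame ?b V ?E" and F: "orthonormal_frame ?b (orth ?b V) ?F"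
    by (auto intro: p.frame_orthonormal p.W p.O)
  have "orthonormal_frame b W (\<lambda>i. L (?E i))" "orthonormal_frame b (orth b W) (\<lambda>i. L (?F i))"
    using E F unfolding orthonormal_frame_def dims unfolding V(1) orth[unfolded V(1)] by auto
  from mixed_scalar_frames[OF T this] mixed_scalar_eq_frame_sum
  show "mixed_scalar b W T = mixed_scalar ?b V ?T"
    unfolding p.mixed_scalar_eq_frame_sum dims by (simp add: mixed_term_def L(3) linear_diff[OF L(2)] linear_diff[OF L(1)])
qed

end

section \<open>Critical tensors at a point\<close>

text \<open>The tensor whose cubic form is the cube of the covector dual to \<open>X\<close>. By polarization these
  cubes span all symmetric cubic forms, so they suffice as directions of variation.\<close>

definition cube :: "('v::euclidean_space \<Rightarrow> 'v \<Rightarrow> real) \<Rightarrow> 'v \<Rightarrow> 'v \<Rightarrow> 'v \<Rightarrow> 'v" where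
  "cube b X u v = (b X u * b X v) *\<^sub>R X"

context split_form
begin

lemma statistical_at_cube: "statistical_at b (cube b X)"
  unfolding statistical_at_def
proof (intro conjI allI)
  show "bilinear (cube b X)"
    by (rule bilinearI) (auto simp: cube_def form_simps algebra_simps)
qed (auto simp: cube_def form_simps sym)

lemma critical_at_iff:
  "critical_at b W T \<longleftrightarrow> Tr_top b W T \<in> orth b W \<and> Tr_perp b W T \<in> W \<and>
     (\<forall>X\<in>W. \<forall>Y\<in>W. T X Y \<in> W) \<and> (\<forall>U\<in>orth b W. \<forall>V\<in>orth b W. T U V \<in> orth b W)"
  by (simp add: critical_at_def top_part_eq_0_iff perp_part_eq_0_iff)

lemma mem_both_0: "v \<in> W \<Longrightarrow> v \<in> orth b W \<Longrightarrow> v = 0"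
  using top_part_of_mem top_part_of_orth by metis

abbreviation "E \<equiv> frame b W"
abbreviation "F \<equiv> frame b (orth b W)"

lemma frames: "orthonormal_frame b W E" "orthonormal_frame b (orth b W) F"
  by (auto intro: frame_orthonormal W O)

lemma frames_mem: "a < dim W \<Longrightarrow> E a \<in> W" "i < dim (orth b W) \<Longrightarrow> F i \<in> orth b W"
  using frames by (auto simp: orthonormal_frame_def)

lemma frames_norm:
  "a < dim W \<Longrightarrow> b (E a) (E a) * b (E a) (E a) = 1"
  "i < dim (orth b W) \<Longrightarrow> b (F i) (F i) * b (F i) (F i) = 1"
  using frames by (auto simp: orthonormal_frame_def)

lemma trace_frames:
  "Tr_top b W T = (\<Sum>a<dim W. b (E a) (E a) *\<^sub>R T (E a) (E a))"
  "Tr_perp b W T = (\<Sum>i<dim (orth b W). b (F i) (F i) *\<^sub>R T (F i) (F i))"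
  by (simp_all add: trace_on_def Let_def)

lemma trace_mem:
  "(\<And>X Y. X \<in> W \<Longrightarrow> Y \<in> W \<Longrightarrow> T X Y \<in> W) \<Longrightarrow> Tr_top b W T \<in> W"
  "(\<And>X Y. X \<in> orth b W \<Longrightarrow> Y \<in> orth b W \<Longrightarrow> T X Y \<in> orth b W) \<Longrightarrow> Tr_perp b W T \<in> orth b W"
  unfolding trace_frames
  by (intro subspace_sum subspace_scale W O; use frames_mem in auto)+

text \<open>Since \<open>b (T X U) w\<close> is totally symmetric, its vanishing for \<open>w\<close> in either summand is one of
  the two invariance conditions; hence mixed products vanish altogether.\<close>

lemma critical_at_consequences:
  assumes "statistical_at b T" "critical_at b W T"
  shows "Tr_top b W T = 0" "Tr_perp b W T = 0" "X \<in> W \<Longrightarrow> U \<in> orth b W \<Longrightarrow> T X U = 0"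
proof -
  show "Tr_top b W T = 0" "Tr_perp b W T = 0"
    using assms(2) trace_mem[of T] mem_both_0 by (auto simp: critical_at_iff)
  assume X: "X \<in> W" and U: "U \<in> orth b W"
  have "b (T X U) w = 0" for w
  proof -
    have "b (T X U) (top_part b W w) = b U (T X (top_part b W w))"
      using assms(1) unfolding statistical_at_def by blast
    also have "\<dots> = 0"
      using assms(2) X U top_part_mem by (intro orth_form(1)) (auto simp: critical_at_iff)
    finally have 1: "b (T X U) (top_part b W w) = 0" .
    have "b (T X U) (perp_part b W w) = b X (T U (perp_part b W w))"
      using assms(1) unfolding statistical_at_def by metis
    also have "\<dots> = 0"
      using assms(2) X U perp_part_mem by (intro orth_form(2)) (auto simp: critical_at_iff)
    finally show ?thesis
      using 1 form_simps(2)[of "T X U" "top_part b W w" "perp_part b W w"] by (simp add: top_plus_perp)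
  qed
  then show "T X U = 0" by (rule nondegenerate)
qed

lemma form_traces:
  "b (Tr_top b W S) (Tr_perp b W T) = (\<Sum>a<dim W. \<Sum>i<dim (orth b W). b (E a) (E a) * b (F i) (F i) *
     b (S (E a) (E a)) (T (F i) (F i)))"
  unfolding trace_frames form_sum form_simps by (subst sum.swap) (simp add: sum_distrib_left mult_ac)

lemma mixed_polar_statistical:
  assumes "statistical_at b T" "statistical_at b K"
  shows "mixed_polar b W T K =
    2 * (b (Tr_top b W K) (Tr_perp b W T) + b (Tr_top b W T) (Tr_perp b W K)
      - 2 * (\<Sum>a<dim W. \<Sum>i<dim (orth b W). b (E a) (E a) * b (F i) (F i) *
          b (T (E a) (F i)) (K (E a) (F i))))"
proof -
  have p: "polar_term b T K u v = 2 * (b (K u u) (T v v) + b (T u u) (K v v) - 2 * b (T u v) (K u v))"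
    for u v
  proof -
    have s: "T v u = T u v" "K v u = K u v" using assms by (auto simp: statistical_at_def)
    have a: "b (T u x) y = b x (T u y)" "b (T v x) y = b x (T v y)"
      "b (K u x) y = b x (K u y)" "b (K v x) y = b x (K v y)" for x y
      using assms by (auto simp: statistical_at_def)
    have "polar_term b T K u v = b (K u u) (T v v) + b (T u u) (K v v) - b (K u v) (T u v)
        - b (T u v) (K u v) + (b (K v v) (T u u) + b (T v v) (K u u) - b (K u v) (T u v)
        - b (T u v) (K u v))"
      by (simp only: polar_term_def form_simps a s)
    then show ?thesis
      using sym[of "K u v" "T u v"] sym[of "K v v" "T u u"] sym[of "T v v" "K u u"] by simp
  qed
  show ?thesis
    unfolding mixed_polar_def Let_def p form_traces
    by (simp add: distrib_left right_diff_distrib sum.distrib sum_subtractf sum_distrib_left mult_ac)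
qed

lemma mixed_scalar_statistical:
  assumes "statistical_at b T"
  shows "mixed_scalar b W T = 2 * (b (Tr_top b W T) (Tr_perp b W T)
      - (\<Sum>a<dim W. \<Sum>i<dim (orth b W). b (E a) (E a) * b (F i) (F i) *
          b (T (E a) (F i)) (T (E a) (F i))))"
proof -
  have p: "mixed_term b T u u v v = 2 * (b (T u u) (T v v) - b (T u v) (T u v))" for u v
  proof -
    have s: "T v u = T u v" using assms by (auto simp: statistical_at_def)
    have a: "b (T u x) y = b x (T u y)" "b (T v x) y = b x (T v y)" for x y
      using assms by (auto simp: statistical_at_def)
    have "mixed_term b T u u v v = b (T u u) (T v v) - b (T u v) (T u v)
        + (b (T v v) (T u u) - b (T u v) (T u v))"
      by (simp only: mixed_term_def form_simps a s)
    then show ?thesis using sym[of "T v v" "T u u"] by simp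
  qed
  show ?thesis
    unfolding mixed_scalar_eq_frame_sum p form_traces
    by (simp add: right_diff_distrib sum_subtractf sum_distrib_left mult_ac)
qed

text \<open>Every summand of the two preceding formulas contains one of the traces of \<open>T\<close> or a mixed
  product of \<open>T\<close>, all of which vanish at a critical tensor.\<close>

lemma critical_at_imp_stationary:
  assumes "statistical_at b T" "critical_at b W T"
  shows "mixed_scalar b W T = 0" "statistical_at b K \<Longrightarrow> mixed_polar b W T K = 0"
  using critical_at_consequences[OF assms] frames_mem
  by (simp_all add: mixed_scalar_statistical[OF assms(1)] mixed_polar_statistical[OF assms(1)] form_simps)

lemma mixed_polar_cube:
  assumes "statistical_at b T"
  defines "\<tau> \<equiv> Tr_top b W T" and "\<tau>' \<equiv> Tr_perp b W T"
  assumes A: "A \<in> W" and B: "B \<in> orth b W"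
  shows "mixed_polar b W T (cube b (A + B)) =
    2 * (b A A * (b A \<tau>' + b B \<tau>') + b B B * (b A \<tau> + b B \<tau>) - 2 * (b (T A B) A + b (T A B) B))"
proof -
  let ?n = "dim W" and ?p = "dim (orth b W)"
  have T: "bilinear T" using assms(1) by (simp add: statistical_at_def)
  have exA: "A = (\<Sum>a<?n. (b (E a) (E a) * b A (E a)) *\<^sub>R E a)"
    by (rule orthonormal_expansion[OF W(1) frames(1) A])
  have exB: "B = (\<Sum>i<?p. (b (F i) (F i) * b B (F i)) *\<^sub>R F i)"
    by (rule orthonormal_expansion[OF O(1) frames(2) B])
  have XE: "b (A + B) (E a) = b A (E a)" if "a < ?n" for a
    using orth_form(1)[OF frames_mem(1)[OF that] B] by (simp add: form_simps)
  have XF: "b (A + B) (F i) = b B (F i)" if "i < ?p" for i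
    using orth_form(2)[OF A frames_mem(2)[OF that]] by (simp add: form_simps)
  have AA: "b A A = (\<Sum>a<?n. b (E a) (E a) * (b A (E a) * b A (E a)))"
    by (subst (2) exA) (simp add: form_sum form_simps mult_ac)
  have BB: "b B B = (\<Sum>i<?p. b (F i) (F i) * (b B (F i) * b B (F i)))"
    by (subst (2) exB) (simp add: form_sum form_simps mult_ac)
  have t: "Tr_top b W (cube b (A + B)) = b A A *\<^sub>R (A + B)"
    unfolding AA trace_frames cube_def scaleR_sum_left by (rule sum.cong) (auto simp: XE)
  have p: "Tr_perp b W (cube b (A + B)) = b B B *\<^sub>R (A + B)"
    unfolding BB trace_frames cube_def scaleR_sum_left by (rule sum.cong) (auto simp: XF)
  have lin: "linear (\<lambda>x. T x B)" "linear (T u)" for u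
    using T by (auto simp: bilinear_def)
  have "T A B = (\<Sum>a<?n. (b (E a) (E a) * b A (E a)) *\<^sub>R T (E a) B)"
    by (subst exA) (simp add: linear_sum[OF lin(1)] linear_scale[OF lin(1)])
  also have "\<dots> = (\<Sum>a<?n. (b (E a) (E a) * b A (E a)) *\<^sub>R
      (\<Sum>i<?p. (b (F i) (F i) * b B (F i)) *\<^sub>R T (E a) (F i)))"
    by (subst exB) (simp add: linear_sum[OF lin(2)] linear_scale[OF lin(2)])
  finally have "b (T A B) (A + B) = (\<Sum>a<?n. \<Sum>i<?p. b (E a) (E a) * b (F i) (F i) *
      ((b A (E a) * b B (F i)) * b (T (E a) (F i)) (A + B)))"
    by (simp add: form_sum form_simps(5) sum_distrib_left mult_ac)
  also have "\<dots> = (\<Sum>a<?n. \<Sum>i<?p. b (E a) (E a) * b (F i) (F i) *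
      b (T (E a) (F i)) (cube b (A + B) (E a) (F i)))"
    by (intro sum.cong refl) (auto simp: cube_def XE XF form_simps(6))
  finally show ?thesis
    unfolding mixed_polar_statistical[OF assms(1) statistical_at_cube] t p \<tau>_def \<tau>'_def
    by (simp add: form_simps sym[of A "Tr_top b W T"] sym[of B "Tr_top b W T"] algebra_simps)
qed

text \<open>Splitting \<open>X = A + B\<close>, the polarization in the direction \<open>X\<^sup>3\<close> has parts of each bidegree in
  \<open>(A, B)\<close>. Those of degree (3,0) and (0,3) make the trace over the complement orthogonal to
  \<open>W\<close> and the trace over \<open>W\<close> orthogonal to the complement; those of degree (2,1) and (1,2) express the mixed components of the cubic form by the traces. Tracing the latter
  identities forces the remaining parts of the traces to vanish, and with them the mixed
  components.\<close>

lemma stationary_imp_critical_at: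
  assumes T: "statistical_at b T" and stat: "\<And>X. mixed_polar b W T (cube b X) = 0"
    and pos: "dim W \<ge> 1" "dim (orth b W) \<ge> 1"
  shows "critical_at b W T"
proof -
  define \<tau> where "\<tau> = Tr_top b W T"
  define \<tau>' where "\<tau>' = Tr_perp b W T"
  have bilT: "bilinear T" and symT: "\<And>u v. T u v = T v u" and adjT: "\<And>u v w. b (T u v) w = b v (T u w)"
    using T by (auto simp: statistical_at_def)
  note T_simps = bilinear_lzero[OF bilT] bilinear_rzero[OF bilT] bilinear_lneg[OF bilT]
    bilinear_rneg[OF bilT] bilinear_ladd[OF bilT] bilinear_radd[OF bilT]
  have eq: "b A A * (b A \<tau>' + b B \<tau>') + b B B * (b A \<tau> + b B \<tau>) - 2 * (b (T A B) A + b (T A B) B) = 0"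
    if "A \<in> W" "B \<in> orth b W" for A B
    using mixed_polar_cube[OF T that] stat[of "A + B"] by (simp add: \<tau>_def \<tau>'_def)
  have deg30: "b A A * b A \<tau>' = 0" if "A \<in> W" for A
    using eq[OF that subspace_0[OF O(1)]] by (simp add: form_simps T_simps)
  have deg03: "b B B * b B \<tau> = 0" if "B \<in> orth b W" for B
    using eq[OF subspace_0[OF W(1)] that] by (simp add: form_simps T_simps)
  have deg21: "2 * b (T A B) A = b A A * b B \<tau>'" and deg12: "2 * b (T A B) B = b B B * b A \<tau>"
    if "A \<in> W" "B \<in> orth b W" for A B
    using eq[OF that] eq[OF that(1) subspace_neg[OF O(1) that(2)]] deg30[OF that(1)] deg03[OF that(2)]
    by (auto simp: form_simps T_simps algebra_simps)
  have nonnull: "b (E a) (E a) \<noteq> 0" if "a < dim W" for a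
    using frames_norm(1)[OF that] by auto
  have nonnull': "b (F i) (F i) \<noteq> 0" if "i < dim (orth b W)" for i
    using frames_norm(2)[OF that] by auto
  have A\<tau>': "b A \<tau>' = 0" if "A \<in> W" for A
  proof -
    have "b (E a) \<tau>' = 0" if "a < dim W" for a
      using deg30[OF frames_mem(1)[OF that]] nonnull[OF that] by simp
    then show ?thesis
      by (subst orthonormal_expansion[OF W(1) frames(1) that]) (simp add: form_sum form_simps)
  qed
  have B\<tau>: "b B \<tau> = 0" if "B \<in> orth b W" for B
  proof -
    have "b (F i) \<tau> = 0" if "i < dim (orth b W)" for i
      using deg03[OF frames_mem(2)[OF that]] nonnull'[OF that] by simp
    then show ?thesis
      by (subst orthonormal_expansion[OF O(1) frames(2) that]) (simp add: form_sum form_simps)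
  qed
  have B\<tau>': "b B \<tau>' = 0" if B: "B \<in> orth b W" for B
  proof -
    have "b (T (E a) (E a)) B = b (T (E a) B) (E a)" for a
      by (metis adjT sym)
    then have "2 * b B \<tau> = (\<Sum>a<dim W. b (E a) (E a) * (2 * b (T (E a) B) (E a)))"
      unfolding \<tau>_def trace_frames sym[of B] by (simp add: form_sum form_simps sum_distrib_left mult_ac)
    also have "\<dots> = (\<Sum>a<dim W. b (E a) (E a) * (b (E a) (E a) * b B \<tau>'))"
      by (intro sum.cong refl) (simp add: deg21 frames_mem B)
    also have "\<dots> = dim W * b B \<tau>'"
      by (simp add: frames_norm flip: mult.assoc)
    finally have "real (dim W) * b B \<tau>' = 0" using B\<tau>[OF B] by linarith
    moreover have "real (dim W) \<noteq> 0" using pos(1) by linarith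
    ultimately show ?thesis by (metis mult_eq_0_iff)
  qed
  have A\<tau>: "b A \<tau> = 0" if A: "A \<in> W" for A
  proof -
    have "b (T (F i) (F i)) A = b (T A (F i)) (F i)" for i
      by (metis adjT symT sym)
    then have "2 * b A \<tau>' = (\<Sum>i<dim (orth b W). b (F i) (F i) * (2 * b (T A (F i)) (F i)))"
      unfolding \<tau>'_def trace_frames sym[of A] by (simp add: form_sum form_simps sum_distrib_left mult_ac)
    also have "\<dots> = (\<Sum>i<dim (orth b W). b (F i) (F i) * (b (F i) (F i) * b A \<tau>))"
      by (intro sum.cong refl) (simp add: deg12 frames_mem A)
    also have "\<dots> = dim (orth b W) * b A \<tau>"
      by (simp add: frames_norm flip: mult.assoc)
    finally have "real (dim (orth b W)) * b A \<tau> = 0" using A\<tau>'[OF A] by linarith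
    moreover have "real (dim (orth b W)) \<noteq> 0" using pos(2) by linarith
    ultimately show ?thesis by (metis mult_eq_0_iff)
  qed
  have AAB: "b (T A B) A' = 0" if "A \<in> W" "A' \<in> W" "B \<in> orth b W" for A A' B
  proof -
    have "b (T (A + A') B) (A + A') = 0" "b (T A B) A = 0" "b (T A' B) A' = 0"
      using deg21[of "A + A'" B] deg21[of A B] deg21[of A' B] that B\<tau>'[OF that(3)] subspace_add[OF W(1)]
      by auto
    then have "b (T A B) A' + b (T A' B) A = 0"
      by (simp add: form_simps T_simps)
    moreover have "b (T A B) A' = b (T A' B) A"
      by (metis adjT symT sym)
    ultimately show ?thesis by simp
  qed
  have ABB: "b (T A B) B' = 0" if "A \<in> W" "B \<in> orth b W" "B' \<in> orth b W" for A B B'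
  proof -
    have "b (T A (B + B')) (B + B') = 0" "b (T A B) B = 0" "b (T A B') B' = 0"
      using deg12[of A "B + B'"] deg12[of A B] deg12[of A B'] that A\<tau>[OF that(1)] subspace_add[OF O(1)]
      by auto
    then have "b (T A B) B' + b (T A B') B = 0"
      by (simp add: form_simps T_simps)
    moreover have "b (T A B) B' = b (T A B') B"
      by (metis adjT sym)
    ultimately show ?thesis by simp
  qed
  show ?thesis
    unfolding critical_at_iff
  proof (intro conjI ballI)
    show "Tr_top b W T \<in> orth b W" "Tr_perp b W T \<in> W"
      using A\<tau> B\<tau>' by (auto simp: \<tau>_def \<tau>'_def orth_def sym intro!: orth_orth)
    show "T X Y \<in> W" if "X \<in> W" "Y \<in> W" for X Y
      by (rule orth_orth) (metis AAB adjT sym that)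
    show "T U V \<in> orth b W" if "U \<in> orth b W" "V \<in> orth b W" for U V
      using ABB[OF _ that(1,2)] that unfolding orth_def by (smt (verit) mem_Collect_eq adjT symT sym)
  qed
qed

end

section \<open>Varying the metric at a critical tensor\<close>

text \<open>Let \<open>T\<close> be adapted to the splitting of another form \<open>b\<^sub>0\<close>. A vector of the new complement
  \<open>orth b W\<close> is the sum of its \<open>b\<^sub>0\<close>-components, and \<open>T\<close> does not mix these; since \<open>b\<close> annihilates
  the products that lie in \<open>W\<close>, only the \<open>W\<close>-component of the new frame vectors contributes, and it
  contributes quadratically. The difference of the two projections measures this component.\<close>

lemma (in split_form) mixed_scalar_adapted:
  assumes b\<^sub>0: "split_form b\<^sub>0 W" and T: "bilinear T" "\<And>u v. T u v = T v u"
    and TW: "\<And>X Y. X \<in> W \<Longrightarrow> Y \<in> W \<Longrightarrow> T X Y \<in> W"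
    and TX: "\<And>X U. X \<in> W \<Longrightarrow> U \<in> orth b\<^sub>0 W \<Longrightarrow> T X U = 0"
    and TO: "\<And>U V. U \<in> orth b\<^sub>0 W \<Longrightarrow> V \<in> orth b\<^sub>0 W \<Longrightarrow> T U V \<in> orth b\<^sub>0 W"
  defines "N \<equiv> \<lambda>v. top_part b\<^sub>0 W v - top_part b W v"
  shows "mixed_scalar b W T = (\<Sum>k\<in>Basis. \<Sum>l\<in>Basis.
    b (T k (T (N l) (N (sharp b (orth b W) l))) - T (N l) (T k (N (sharp b (orth b W) l)))) (sharp b W k))"
proof -
  interpret b\<^sub>0: split_form b\<^sub>0 W by (rule b\<^sub>0)
  define f where "f u u' v v' = b (T u (T (N v) (N v')) - T (N v) (T u (N v'))) u'" for u u' v v'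
  have N: "linear N"
    unfolding N_def by (intro linear_compose_sub linear_top_part b\<^sub>0.linear_top_part)
  have f: "bilinear (\<lambda>u u'. f u u' v v')" "bilinear (f u u')" for u u' v v'
    by (rule bilinearI; simp add: f_def bilinear_ladd[OF T(1)] bilinear_radd[OF T(1)] bilinear_lmul[OF T(1)]
      bilinear_rmul[OF T(1)] form_simps linear_add[OF N] linear_scale[OF N] algebra_simps)+
  have "mixed_term b T e e h h = f e e h h" if e: "e \<in> W" and h: "h \<in> orth b W" for e h
  proof -
    define w where "w = top_part b\<^sub>0 W h"
    define h' where "h' = perp_part b\<^sub>0 W h"
    have w: "w \<in> W" and h': "h' \<in> orth b\<^sub>0 W" and hs: "h = w + h'"
      by (auto simp: w_def h'_def b\<^sub>0.top_part_mem b\<^sub>0.perp_part_mem b\<^sub>0.top_plus_perp)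
    have Nh: "N h = w"
      by (simp add: N_def w_def top_part_of_orth[OF h])
    have Th: "T h x = T w x" if "x \<in> W" for x
      using TX[OF that h'] T(2)[of h' x] by (simp add: hs bilinear_ladd[OF T(1)])
    have "T h h = T w w + T h' h'"
      using TX[OF w h'] T(2)[of h' w] by (simp add: hs bilinear_ladd[OF T(1)] bilinear_radd[OF T(1)])
    then have Thh: "T e (T h h) = T e (T w w)"
      using TX[OF e TO[OF h' h']] by (simp add: bilinear_radd[OF T(1)])
    have Teh: "T e h = T e w" and The: "T h e = T e w"
      using Th[OF e] T(2)[of h e] T(2)[of w e] by auto
    have "T w (T e e) - T e (T e w) \<in> W"
      using e w by (intro subspace_diff W TW)
    then have "b (T h (T e e) - T e (T h e)) h = 0"
      using Th[OF TW[OF e e]] orth_form(2)[OF _ h] by (simp add: The)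
    then show ?thesis
      by (simp add: mixed_term_def f_def Nh Thh Teh Th[OF TW[OF e w]])
  qed
  then have "mixed_scalar b W T = (\<Sum>a<dim W. \<Sum>i<dim (orth b W).
      b (frame b W a) (frame b W a) * b (frame b (orth b W) i) (frame b (orth b W) i) *
      f (frame b W a) (frame b W a) (frame b (orth b W) i) (frame b (orth b W) i))"
    unfolding mixed_scalar_eq_frame_sum by (intro sum.cong refl) (simp add: frames_mem)
  also have "\<dots> = (\<Sum>k\<in>Basis. \<Sum>l\<in>Basis. f k (sharp b W k) l (sharp b (orth b W) l))"
    by (intro double_frame_contraction f frames)
  finally show ?thesis by (simp add: f_def)
qed


section \<open>Pointwise estimates\<close>

lemma abs_double_basis_sum_le:
  fixes f :: "'v::euclidean_space \<Rightarrow> 'v \<Rightarrow> real" and C :: real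
  assumes "\<And>k l. k \<in> Basis \<Longrightarrow> l \<in> Basis \<Longrightarrow> \<bar>f k l\<bar> \<le> C"
  shows "\<bar>\<Sum>k\<in>Basis. \<Sum>l\<in>Basis. f k l\<bar> \<le> (real DIM('v))\<^sup>2 * C"
proof -
  have "\<bar>\<Sum>k\<in>Basis. \<Sum>l\<in>Basis. f k l\<bar> \<le> (\<Sum>k\<in>(Basis::'v set). \<Sum>l\<in>(Basis::'v set). \<bar>f k l\<bar>)"
    by (intro order_trans[OF sum_abs] sum_mono) auto
  also have "\<dots> \<le> (\<Sum>k\<in>(Basis::'v set). \<Sum>l\<in>(Basis::'v set). C)"
    by (intro sum_mono assms)
  finally show ?thesis by (simp add: power2_eq_square mult.assoc)
qed

lemma form_nest_le:
  fixes \<beta> \<tau> c1 c2 c3 c4 :: real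
  assumes b: "\<And>u v. \<bar>b u v\<bar> \<le> \<beta> * norm u * norm v" "0 \<le> \<beta>"
    and T: "\<And>u v. norm (T u v) \<le> \<tau> * norm u * norm v" "0 \<le> \<tau>"
    and "norm u \<le> c1" "norm v \<le> c2" "norm w \<le> c3" "norm z \<le> c4"
  shows "\<bar>b (T u (T v w)) z\<bar> \<le> \<beta> * \<tau>\<^sup>2 * (c1 * c2 * c3 * c4)"
proof -
  have c: "0 \<le> c1" "0 \<le> c2" "0 \<le> c3" "0 \<le> c4"
    using assms(5-8) norm_ge_zero order_trans by blast+
  have "norm (T v w) \<le> \<tau> * c2 * c3"
    by (rule order_trans[OF T(1)]) (use assms c in \<open>auto intro!: mult_mono\<close>)
  then have "norm (T u (T v w)) \<le> \<tau> * c1 * (\<tau> * c2 * c3)"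
    by (intro order_trans[OF T(1)] mult_mono) (use assms c in auto)
  then have "\<bar>b (T u (T v w)) z\<bar> \<le> \<beta> * (\<tau> * c1 * (\<tau> * c2 * c3)) * c4"
    by (intro order_trans[OF b(1)] mult_mono) (use assms c in auto)
  then show ?thesis by (simp add: power2_eq_square mult_ac)
qed

context split_form
begin

lemma abs_mixed_scalar_le:
  fixes \<beta> \<tau> \<sigma> :: real
  assumes b: "\<And>u v. \<bar>b u v\<bar> \<le> \<beta> * norm u * norm v" "0 \<le> \<beta>"
    and T: "bilinear T" "\<And>u v. norm (T u v) \<le> \<tau> * norm u * norm v" "0 \<le> \<tau>"
    and \<sigma>: "\<And>e. e \<in> Basis \<Longrightarrow> norm (sharp b W e) \<le> \<sigma>"
      "\<And>e. e \<in> Basis \<Longrightarrow> norm (sharp b (orth b W) e) \<le> \<sigma>"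
  shows "\<bar>mixed_scalar b W T\<bar> \<le> (real DIM('a))\<^sup>2 * (4 * (\<beta> * \<tau>\<^sup>2 * \<sigma>\<^sup>2))"
  unfolding mixed_scalar_contraction[OF T(1)]
proof (rule abs_double_basis_sum_le)
  fix k l :: 'a assume kl: "k \<in> Basis" "l \<in> Basis"
  let ?k = "sharp b W k" and ?l = "sharp b (orth b W) l"
  have n: "norm k \<le> 1" "norm l \<le> 1" "norm ?k \<le> \<sigma>" "norm ?l \<le> \<sigma>"
    using kl \<sigma> by auto
  have "\<bar>b (T l (T k ?k)) ?l\<bar> \<le> \<beta> * \<tau>\<^sup>2 * (1 * 1 * \<sigma> * \<sigma>)"
       "\<bar>b (T k (T l ?k)) ?l\<bar> \<le> \<beta> * \<tau>\<^sup>2 * (1 * 1 * \<sigma> * \<sigma>)"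
       "\<bar>b (T k (T l ?l)) ?k\<bar> \<le> \<beta> * \<tau>\<^sup>2 * (1 * 1 * \<sigma> * \<sigma>)"
       "\<bar>b (T l (T k ?l)) ?k\<bar> \<le> \<beta> * \<tau>\<^sup>2 * (1 * 1 * \<sigma> * \<sigma>)"
    by (intro form_nest_le[OF b T(2,3)] n)+
  then show "\<bar>mixed_term b T k ?k l ?l\<bar> \<le> 4 * (\<beta> * \<tau>\<^sup>2 * \<sigma>\<^sup>2)"
    by (simp add: mixed_term_def form_simps power2_eq_square)
qed

lemma abs_mixed_scalar_adapted_le:
  fixes \<beta> \<tau> \<sigma> \<nu> :: real
  assumes b: "\<And>u v. \<bar>b u v\<bar> \<le> \<beta> * norm u * norm v" "0 \<le> \<beta>"
    and T: "bilinear T" "\<And>u v. norm (T u v) \<le> \<tau> * norm u * norm v" "0 \<le> \<tau>" "\<And>u v. T u v = T v u"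
    and \<sigma>: "\<And>e. e \<in> Basis \<Longrightarrow> norm (sharp b W e) \<le> \<sigma>"
      "\<And>e. e \<in> Basis \<Longrightarrow> norm (sharp b (orth b W) e) \<le> \<sigma>"
    and b\<^sub>0: "split_form b\<^sub>0 W"
    and TW: "\<And>X Y. X \<in> W \<Longrightarrow> Y \<in> W \<Longrightarrow> T X Y \<in> W"
    and TX: "\<And>X U. X \<in> W \<Longrightarrow> U \<in> orth b\<^sub>0 W \<Longrightarrow> T X U = 0"
    and TO: "\<And>U V. U \<in> orth b\<^sub>0 W \<Longrightarrow> V \<in> orth b\<^sub>0 W \<Longrightarrow> T U V \<in> orth b\<^sub>0 W"
    and \<nu>: "\<And>v. norm (top_part b\<^sub>0 W v - top_part b W v) \<le> \<nu> * norm v" "0 \<le> \<nu>"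
  shows "\<bar>mixed_scalar b W T\<bar> \<le> (real DIM('a))\<^sup>2 * (2 * (\<beta> * \<tau>\<^sup>2 * \<nu>\<^sup>2 * \<sigma>\<^sup>2))"
  unfolding mixed_scalar_adapted[OF b\<^sub>0 T(1,4) TW TX TO, simplified]
proof (rule abs_double_basis_sum_le)
  fix k l :: 'a assume kl: "k \<in> Basis" "l \<in> Basis"
  define N where "N v = top_part b\<^sub>0 W v - top_part b W v" for v
  let ?k = "sharp b W k" and ?l = "sharp b (orth b W) l"
  have n: "norm k \<le> 1" "norm (N l) \<le> \<nu>" "norm ?k \<le> \<sigma>" "norm (N ?l) \<le> \<nu> * \<sigma>"
    using kl \<sigma> \<nu>(1)[of l] order_trans[OF \<nu>(1)[of ?l] mult_left_mono[OF \<sigma>(2)[OF kl(2)] \<nu>(2)]]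
    by (auto simp: N_def)
  have "\<bar>b (T k (T (N l) (N ?l))) ?k\<bar> \<le> \<beta> * \<tau>\<^sup>2 * (1 * \<nu> * (\<nu> * \<sigma>) * \<sigma>)"
    "\<bar>b (T (N l) (T k (N ?l))) ?k\<bar> \<le> \<beta> * \<tau>\<^sup>2 * (\<nu> * 1 * (\<nu> * \<sigma>) * \<sigma>)"
    by (intro form_nest_le[OF b T(2,3)] n)+
  then show "\<bar>b (T k (T (top_part b\<^sub>0 W l - top_part b W l) (top_part b\<^sub>0 W ?l - top_part b W ?l)) -
      T (top_part b\<^sub>0 W l - top_part b W l) (T k (top_part b\<^sub>0 W ?l - top_part b W ?l))) ?k\<bar>
    \<le> 2 * (\<beta> * \<tau>\<^sup>2 * \<nu>\<^sup>2 * \<sigma>\<^sup>2)"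
    unfolding N_def[symmetric] by (simp add: form_simps power2_eq_square mult_ac)
qed

lemma norm_sharp_le:
  fixes \<sigma> :: real
  assumes U: "subspace U" "nondegenerate_on b U" and \<sigma>: "\<And>e. e \<in> Basis \<Longrightarrow> norm (sharp b U e) \<le> \<sigma>"
  shows "norm (sharp b U v) \<le> DIM('a) * \<sigma> * norm v"
proof -
  have "norm (sharp b U v) \<le> (\<Sum>e\<in>Basis. norm ((v \<bullet> e) *\<^sub>R sharp b U e))"
    by (subst linear_euclidean_sum[OF linear_sharp[OF U]]) (rule norm_sum)
  also have "\<dots> \<le> (\<Sum>e\<in>(Basis::'a set). norm v * \<sigma>)"
    by (intro sum_mono) (use \<sigma> Basis_le_norm[of _ v] in \<open>auto intro!: mult_mono\<close>)
  finally show ?thesis by (simp add: mult_ac)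
qed

text \<open>With \<open>u = top_part b\<^sub>0 W v - v\<close>, which is \<open>b\<^sub>0\<close>-orthogonal to \<open>W\<close>, the difference of the two
  projections of \<open>v\<close> is the image under \<open>sharp\<close> of the functional \<open>b u - b\<^sub>0 u\<close>.\<close>

lemma norm_top_part_diff_le:
  fixes \<sigma> \<delta> \<pi> :: real
  assumes b\<^sub>0: "split_form b\<^sub>0 W" and \<sigma>: "\<And>e. e \<in> Basis \<Longrightarrow> norm (sharp b W e) \<le> \<sigma>"
    and \<delta>: "\<And>u v. \<bar>b u v - b\<^sub>0 u v\<bar> \<le> \<delta> * norm u * norm v"
    and \<pi>: "\<And>v. norm (top_part b\<^sub>0 W v - v) \<le> \<pi> * norm v"
  shows "norm (top_part b\<^sub>0 W v - top_part b W v) \<le> DIM('a) * \<sigma> * (DIM('a) * (\<delta> * \<pi>)) * norm v"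
proof -
  interpret b\<^sub>0: split_form b\<^sub>0 W by (rule b\<^sub>0)
  define u where "u = top_part b\<^sub>0 W v - v"
  define c where "c = (\<Sum>e\<in>Basis. (b u e - b\<^sub>0 u e) *\<^sub>R e)"
  have nonneg: "0 \<le> \<sigma>" "0 \<le> \<delta>"
  proof -
    obtain e :: 'a where e: "e \<in> Basis" using nonempty_Basis by blast
    show "0 \<le> \<sigma>" using \<sigma>[OF e] norm_ge_zero order_trans by blast
    show "0 \<le> \<delta>" using \<delta>[of e e] e by simp
  qed
  have lin: "linear (\<lambda>w. b u w - b\<^sub>0 u w)"
    using bil b\<^sub>0.bil by (auto simp: bilinear_def intro: linear_compose_sub)
  have c: "c \<bullet> w = b u w - b\<^sub>0 u w" for w
    unfolding c_def inner_sum_left linear_euclidean_sum[OF lin, of w]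
    by (simp add: inner_commute[of w] mult.commute)
  have "norm c \<le> (\<Sum>e\<in>(Basis::'a set). \<delta> * norm u)"
    unfolding c_def
  proof (rule order_trans[OF norm_sum], rule sum_mono)
    show "norm ((b u e - b\<^sub>0 u e) *\<^sub>R e) \<le> \<delta> * norm u" if "e \<in> Basis" for e
      using \<delta>[of u e] that by simp
  qed
  also have "\<dots> \<le> DIM('a) * (\<delta> * (\<pi> * norm v))"
    using \<pi>[of v] nonneg by (simp add: u_def mult_left_mono)
  finally have nc: "norm c \<le> DIM('a) * (\<delta> * (\<pi> * norm v))" .
  have "sharp b W c = top_part b\<^sub>0 W v - top_part b W v"
  proof (rule sharp_eqI[OF W])
    show "top_part b\<^sub>0 W v - top_part b W v \<in> W"
      by (intro subspace_diff W top_part_mem b\<^sub>0.top_part_mem)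
    fix w assume w: "w \<in> W"
    have "b v w = b (top_part b W v) w"
      using form_simps(3)[of v "top_part b W v" w] orth_form(1)[OF w diff_top_part] by simp
    moreover have "b\<^sub>0 u w = 0"
      using b\<^sub>0.form_simps(9)[of "v - top_part b\<^sub>0 W v" w] b\<^sub>0.orth_form(1)[OF w b\<^sub>0.diff_top_part[of v]]
      by (simp add: u_def)
    ultimately show "b (top_part b\<^sub>0 W v - top_part b W v) w = c \<bullet> w"
      by (simp add: c u_def form_simps)
  qed
  then have "norm (top_part b\<^sub>0 W v - top_part b W v) \<le> DIM('a) * \<sigma> * norm c"
    using norm_sharp_le[OF W \<sigma>, of c] by simp
  also have "\<dots> \<le> DIM('a) * \<sigma> * (DIM('a) * (\<delta> * (\<pi> * norm v)))"
    using nc nonneg by (intro mult_left_mono) auto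
  finally show ?thesis by (simp add: mult_ac)
qed

end

section \<open>Changes of coordinates\<close>

definition jac :: "('a, 'v::euclidean_space) chart \<Rightarrow> ('a, 'v) chart \<Rightarrow> 'a \<Rightarrow> 'v \<Rightarrow> 'v" where
  "jac c d x = frechet_derivative (transition c d) (at (snd c x))"

locale atlas =
  fixes A :: "('a::topological_space, 'v::euclidean_space) chart set"
  assumes atlas: "smooth_atlas A"
begin

lemma chart_homeo:
  assumes "c \<in> A"
  shows "open (chart_dom c)" "open (snd c ` chart_dom c)" "inj_on (snd c) (chart_dom c)"
    "continuous_on (chart_dom c) (snd c)" "continuous_on (snd c ` chart_dom c) (chart_inv c)"
proof -
  obtain h where o: "open (chart_dom c)" "open (snd c ` chart_dom c)"
    and h: "homeomorphism (chart_dom c) (snd c ` chart_dom c) (snd c) h"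
    using assms atlas by (auto simp: smooth_atlas_def is_chart_def)
  show inj: "inj_on (snd c) (chart_dom c)"
    using h by (metis homeomorphism_def inj_on_inverseI)
  have "chart_inv c y = h y" if "y \<in> snd c ` chart_dom c" for y
    using that h inj by (auto simp: homeomorphism_def)
  moreover have "continuous_on (snd c ` chart_dom c) h"
    using h by (simp add: homeomorphism_def)
  ultimately show "continuous_on (snd c ` chart_dom c) (chart_inv c)"
    by (subst continuous_on_cong[OF refl]) auto
  show "open (chart_dom c)" "open (snd c ` chart_dom c)" "continuous_on (chart_dom c) (snd c)"
    using o h by (auto simp: homeomorphism_def)
qed

lemma chart_inv_chart [simp]: "c \<in> A \<Longrightarrow> x \<in> chart_dom c \<Longrightarrow> chart_inv c (snd c x) = x"
  using chart_homeo(3) by (simp add: inv_into_f_f)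

lemma chart_inv_mem: "y \<in> snd c ` chart_dom c \<Longrightarrow> chart_inv c y \<in> chart_dom c"
  by (rule inv_into_into)

lemma chart_chart_inv: "y \<in> snd c ` chart_dom c \<Longrightarrow> snd c (chart_inv c y) = y"
  by (rule f_inv_into_f)

lemma open_chart_image:
  assumes "c \<in> A" "open V"
  shows "open (snd c ` (chart_dom c \<inter> V))"
proof -
  have "snd c ` (chart_dom c \<inter> V) = snd c ` chart_dom c \<inter> chart_inv c -` V"
    using assms by auto
  then show ?thesis
    using chart_homeo[OF assms(1)] assms(2) by (metis continuous_on_open_vimage Int_commute)
qed

lemma open_chart_preimage:
  assumes "c \<in> A" "open V"
  shows "open (chart_dom c \<inter> snd c -` V)"
  using chart_homeo[OF assms(1)] assms(2) by (metis continuous_on_open_vimage Int_commute)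

lemma open_chart_inv_ball:
  assumes "c \<in> A" "ball y r \<subseteq> snd c ` chart_dom c"
  shows "open (chart_inv c ` ball y r)"
proof -
  have "chart_inv c ` ball y r = chart_dom c \<inter> snd c -` ball y r"
  proof
    show "chart_inv c ` ball y r \<subseteq> chart_dom c \<inter> snd c -` ball y r"
      using assms(2) chart_inv_mem[of _ c] chart_chart_inv[of _ c] by auto
    show "chart_dom c \<inter> snd c -` ball y r \<subseteq> chart_inv c ` ball y r"
    proof
      fix x assume "x \<in> chart_dom c \<inter> snd c -` ball y r"
      then show "x \<in> chart_inv c ` ball y r" using assms(1) by (intro image_eqI[of x _ "snd c x"]) auto
    qed
  qed
  then show ?thesis using open_chart_preimage[OF assms(1) open_ball, of y r] by simp
qed

lemma chart_at: "chart_at A x \<in> A" "x \<in> chart_dom (chart_at A x)"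
proof -
  have "x \<in> (\<Union>c\<in>A. chart_dom c)"
    using atlas unfolding smooth_atlas_def by simp
  then have "\<exists>c. c \<in> A \<and> x \<in> chart_dom c" by blast
  then have "chart_at A x \<in> A \<and> x \<in> chart_dom (chart_at A x)"
    unfolding chart_at_def by (rule someI_ex)
  then show "chart_at A x \<in> A" "x \<in> chart_dom (chart_at A x)" by auto
qed

lemma transition_smooth:
  "c \<in> A \<Longrightarrow> d \<in> A \<Longrightarrow> smooth_on (snd c ` (chart_dom c \<inter> chart_dom d)) (transition c d)"
  using atlas by (auto simp: smooth_atlas_def)

lemma transition_chart [simp]: "c \<in> A \<Longrightarrow> x \<in> chart_dom c \<Longrightarrow> transition c d (snd c x) = snd d x"
  by (simp add: transition_def)

lemma open_overlap: "c \<in> A \<Longrightarrow> d \<in> A \<Longrightarrow> open (snd c ` (chart_dom c \<inter> chart_dom d))"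
  by (intro open_chart_image chart_homeo)

lemma jac_has_derivative:
  "c \<in> A \<Longrightarrow> d \<in> A \<Longrightarrow> x \<in> chart_dom c \<Longrightarrow> x \<in> chart_dom d \<Longrightarrow>
    (transition c d has_derivative jac c d x) (at (snd c x))"
  unfolding jac_def
  by (intro has_frechet_derivative smooth_on_imp_differentiable[OF transition_smooth]) auto

lemma linear_jac:
  "c \<in> A \<Longrightarrow> d \<in> A \<Longrightarrow> x \<in> chart_dom c \<Longrightarrow> x \<in> chart_dom d \<Longrightarrow> linear (jac c d x)"
  using jac_has_derivative has_derivative_linear by blast

lemma jac_compose:
  assumes "c \<in> A" "d \<in> A" "e \<in> A" and x: "x \<in> chart_dom c" "x \<in> chart_dom d" "x \<in> chart_dom e"
  shows "jac d e x (jac c d x v) = jac c e x v"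
proof -
  have "((\<lambda>y. transition d e (transition c d y)) has_derivative (\<lambda>v. jac d e x (jac c d x v))) (at (snd c x))"
    using assms by (intro has_derivative_compose[OF jac_has_derivative]) (auto intro: jac_has_derivative)
  then have "(transition c e has_derivative (\<lambda>v. jac d e x (jac c d x v))) (at (snd c x))"
    by (rule has_derivative_transform_within_open[OF _ open_overlap[of c d]]) (use assms in auto)
  from frechet_derivative_eqI[OF this] show ?thesis
    unfolding jac_def by metis
qed

lemma jac_self: "c \<in> A \<Longrightarrow> x \<in> chart_dom c \<Longrightarrow> jac c c x v = v"
proof -
  assume c: "c \<in> A" "x \<in> chart_dom c"
  have "((\<lambda>y. y) has_derivative (\<lambda>v. v)) (at (snd c x))" by simp
  then have "(transition c c has_derivative (\<lambda>v. v)) (at (snd c x))"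
    by (rule has_derivative_transform_within_open[OF _ chart_homeo(2)]) (use c in auto)
  from frechet_derivative_eqI[OF this] show ?thesis
    unfolding jac_def by metis
qed

lemma from_coords_jac: "from_coords A c x = jac c (chart_at A x) x"
  and to_coords_jac: "to_coords A c x = jac (chart_at A x) c x"
  by (simp_all add: from_coords_def to_coords_def jac_def)

lemma
  assumes "c \<in> A" "x \<in> chart_dom c"
  shows linear_from_coords: "linear (from_coords A c x)"
    and linear_to_coords: "linear (to_coords A c x)"
    and from_to_coords: "from_coords A c x (to_coords A c x v) = v"
    and to_from_coords: "to_coords A c x (from_coords A c x v) = v"
  unfolding from_coords_jac to_coords_jac
  using assms chart_at by (auto intro: linear_jac simp: jac_compose jac_self)

lemma
  assumes "c \<in> A" "d \<in> A" "x \<in> chart_dom c" "x \<in> chart_dom d"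
  shows from_coords_change: "from_coords A c x v = from_coords A d x (jac c d x v)"
    and to_coords_change: "to_coords A d x v = jac c d x (to_coords A c x v)"
  unfolding from_coords_jac to_coords_jac
  using assms chart_at by (auto simp: jac_compose)

lemma coords02_chart:
  "c \<in> A \<Longrightarrow> x \<in> chart_dom c \<Longrightarrow>
    coords02 A c g (snd c x) v w = g x (from_coords A c x v) (from_coords A c x w)"
  by (simp add: coords02_def)

lemma coords12_chart:
  "c \<in> A \<Longrightarrow> x \<in> chart_dom c \<Longrightarrow>
    coords12 A c T (snd c x) v w = to_coords A c x (T x (from_coords A c x v) (from_coords A c x w))"
  by (simp add: coords12_def)

lemma coords02_change:
  assumes "c \<in> A" "d \<in> A" "x \<in> chart_dom c" "x \<in> chart_dom d"
  shows "coords02 A c g (snd c x) v w = coords02 A d g (snd d x) (jac c d x v) (jac c d x w)"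
  using assms by (simp add: coords02_chart from_coords_change[OF assms])

lemma bilinear_coords02:
  assumes "bilinear (g x)" "c \<in> A" "x \<in> chart_dom c"
  shows "bilinear (coords02 A c g (snd c x))"
  using assms linear_from_coords[OF assms(2,3)]
  by (intro bilinearI) (auto simp: coords02_chart linear_add linear_scale bilinear_ladd bilinear_radd
      bilinear_lmul bilinear_rmul)

lemma bilinear_coords12:
  assumes "bilinear (T x)" "c \<in> A" "x \<in> chart_dom c"
  shows "bilinear (coords12 A c T (snd c x))"
  using assms linear_from_coords[OF assms(2,3)] linear_to_coords[OF assms(2,3)]
  by (intro bilinearI) (auto simp: coords12_chart linear_add linear_scale bilinear_ladd bilinear_radd
      bilinear_lmul bilinear_rmul)

end


section \<open>Pointwise form of the statistical condition\<close>

locale metric_atlas = atlas A for A :: "('a::topological_space, 'v::euclidean_space) chart set" +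
  fixes g :: "'a \<Rightarrow> 'v \<Rightarrow> 'v \<Rightarrow> real"
  assumes metric: "pseudo_riemannian A g"
begin

lemma metric_at: "bilinear (g x)" "g x v w = g x w v" "(\<And>w. g x v w = 0) \<Longrightarrow> v = 0"
  using metric unfolding pseudo_riemannian_def by blast+

lemma symmetric_form_metric: "symmetric_form (g x)"
  by unfold_locales (rule metric_at)+

lemma metric_smooth: "c \<in> A \<Longrightarrow> smooth_on (snd c ` chart_dom c) (\<lambda>y. coords02 A c g y v w)"
  using metric by (auto simp: pseudo_riemannian_def)

lemma
  assumes c: "c \<in> A" and y: "y \<in> snd c ` chart_dom c"
  shows symmetric_form_coords02: "symmetric_form (coords02 A c g y)"
    and nondegenerate_coords02: "nondegenerate_on (coords02 A c g y) UNIV"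
proof -
  obtain x where x: "x \<in> chart_dom c" "y = snd c x" using y by auto
  show "symmetric_form (coords02 A c g y)"
    unfolding x(2)
    by unfold_locales
       (auto intro: bilinear_coords02 metric_at c x simp: coords02_chart[OF c x(1)] metric_at(2))
  show "nondegenerate_on (coords02 A c g y) UNIV"
    unfolding nondegenerate_on_def x(2)
  proof (intro ballI impI)
    fix v assume v: "\<forall>w\<in>UNIV. coords02 A c g (snd c x) v w = 0"
    have "g x (from_coords A c x v) w = 0" for w
      using v[THEN bspec, of "to_coords A c x w"] c x by (simp add: coords02_chart from_to_coords)
    then have "from_coords A c x v = 0" by (rule metric_at(3))
    then show "v = 0"
      using to_from_coords[OF c x(1), of v] linear_0[OF linear_to_coords[OF c x(1)]] by simp
  qed
qed

lemma dmetric_has_derivative: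
  "c \<in> A \<Longrightarrow> y \<in> snd c ` chart_dom c \<Longrightarrow>
    ((\<lambda>z. coords02 A c g z v w) has_derivative (\<lambda>u. dmetric A c g y u v w)) (at y)"
  unfolding dmetric_def
  by (intro has_frechet_derivative smooth_on_imp_differentiable[OF metric_smooth]) auto

lemma dmetric_sym:
  assumes "c \<in> A" "y \<in> snd c ` chart_dom c"
  shows "dmetric A c g y u v w = dmetric A c g y u w v"
proof -
  have "(\<lambda>z. coords02 A c g z v w) = (\<lambda>z. coords02 A c g z w v)"
    by (rule ext) (simp add: coords02_def Let_def metric_at(2))
  then show ?thesis by (simp add: dmetric_def)
qed

lemma linear_dmetric:
  assumes c: "c \<in> A" and y: "y \<in> snd c ` chart_dom c"
  shows "linear (\<lambda>u. dmetric A c g y u v w)" "linear (\<lambda>w. dmetric A c g y u v w)"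
    "linear (\<lambda>v. dmetric A c g y u v w)"
proof -
  show "linear (\<lambda>u. dmetric A c g y u v w)"
    using dmetric_has_derivative[OF c y] has_derivative_linear by blast
  have 2: "linear (\<lambda>w. dmetric A c g y u v w)" for v
  proof (rule linearI)
    fix w w' and r :: real
    have "((\<lambda>z. coords02 A c g z v (w + w')) has_derivative
        (\<lambda>u. dmetric A c g y u v w + dmetric A c g y u v w')) (at y)"
      by (rule has_derivative_transform_within_open[OF
            has_derivative_add[OF dmetric_has_derivative[OF c y] dmetric_has_derivative[OF c y]]
            chart_homeo(2)[OF c] y])
         (use symmetric_form.form_simps(2)[OF symmetric_form_coords02[OF c]] in auto)
    from frechet_derivative_eqI[OF this]
    show "dmetric A c g y u v (w + w') = dmetric A c g y u v w + dmetric A c g y u v w'"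
      by (simp add: dmetric_def)
    have "((\<lambda>z. coords02 A c g z v (r *\<^sub>R w)) has_derivative (\<lambda>u. r *\<^sub>R dmetric A c g y u v w)) (at y)"
      by (rule has_derivative_transform_within_open[OF
            has_derivative_scaleR_right[OF dmetric_has_derivative[OF c y]] chart_homeo(2)[OF c] y])
         (use symmetric_form.form_simps(6)[OF symmetric_form_coords02[OF c]] in auto)
    from frechet_derivative_eqI[OF this]
    show "dmetric A c g y u v (r *\<^sub>R w) = r *\<^sub>R dmetric A c g y u v w"
      by (simp add: dmetric_def)
  qed
  show "linear (\<lambda>w. dmetric A c g y u v w)" by (rule 2)
  show "linear (\<lambda>v. dmetric A c g y u v w)"
    unfolding dmetric_sym[OF c y, of u _ w] by (rule 2)
qed

text \<open>The defining equation of the Christoffel symbols has exactly one solution because its right-hand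
  side is linear in \<open>u\<close> and the metric is non-degenerate.\<close>

lemma christoffel_form:
  assumes c: "c \<in> A" and y: "y \<in> snd c ` chart_dom c"
  shows "coords02 A c g y (christoffel A c g y v w) u =
     (dmetric A c g y v w u + dmetric A c g y w v u - dmetric A c g y u v w) / 2"
proof -
  interpret symmetric_form "coords02 A c g y" by (rule symmetric_form_coords02[OF c y])
  note nd = nondegenerate_coords02[OF c y]
  let ?r = "\<lambda>u. (dmetric A c g y v w u + dmetric A c g y w v u - dmetric A c g y u v w) / 2"
  define z where "z = sharp (coords02 A c g y) UNIV (\<Sum>e\<in>Basis. ?r e *\<^sub>R e)"
  have lin: "linear ?r"
    using linear_dmetric[OF c y] by (simp add: linear_iff field_simps)
  have "coords02 A c g y z u = (\<Sum>e\<in>Basis. ?r e *\<^sub>R e) \<bullet> u" for u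
    unfolding z_def by (rule sharp_form[OF subspace_UNIV nd]) simp
  also have "(\<Sum>e\<in>Basis. ?r e *\<^sub>R e) \<bullet> u = ?r u" for u
    unfolding linear_euclidean_sum[OF lin, of u]
    by (simp add: inner_sum_left inner_commute[of u] mult.commute)
  finally have z: "coords02 A c g y z u = ?r u" for u .
  have "christoffel A c g y v w = z"
    unfolding christoffel_def
  proof (rule the_equality)
    fix z' assume "\<forall>u. coords02 A c g y z' u = ?r u"
    then have "coords02 A c g y z' u = coords02 A c g y z u" for u
      by (simp only: z)
    then have "coords02 A c g y (z' - z) u = 0" for u
      by (simp add: form_simps)
    then have "z' - z = 0" using nd unfolding nondegenerate_on_def by blast
    then show "z' = z" by simp
  qed (use z in simp)
  then show ?thesis using z by simp
qed

text \<open>The Levi-Civita part of the connection is symmetric and metric, so torsion and nonmetricity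
  only see the contorsion tensor.\<close>

lemma statistical_iff: "statistical A g T \<longleftrightarrow> tensor12 A T \<and> (\<forall>x. statistical_at (g x) (T x))"
proof -
  have "(\<forall>u v w. conn_coeff A c g T y v w = conn_coeff A c g T y w v \<and>
        nonmetricity A c g T y u v w = nonmetricity A c g T y u w v \<and>
        nonmetricity A c g T y u v w = nonmetricity A c g T y v u w)
     \<longleftrightarrow> statistical_at (g x) (T x)"
    if T: "bilinear (T x)" and c: "c \<in> A" and x: "x \<in> chart_dom c" "y = snd c x" for c x y
  proof -
    have y: "y \<in> snd c ` chart_dom c" using x by auto
    interpret symmetric_form "coords02 A c g y" by (rule symmetric_form_coords02[OF c y])
    define B where "B = coords02 A c g y"
    define C where "C = coords12 A c T y"
    have ch: "christoffel A c g y v w = christoffel A c g y w v" for v w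
      by (simp add: christoffel_def dmetric_sym[OF c y, of _ v w] add.commute)
    have conn: "conn_coeff A c g T y v w = conn_coeff A c g T y w v \<longleftrightarrow> C v w = C w v" for v w
      by (simp add: conn_coeff_def ch[of v w] C_def)
    have "coords02 A c g y (christoffel A c g y u v) w + coords02 A c g y v (christoffel A c g y u w)
        = dmetric A c g y u v w" for u v w
      unfolding sym[of v "christoffel A c g y u w"] christoffel_form[OF c y]
      using dmetric_sym[OF c y, of u v w] by (simp add: field_simps)
    then have nm: "nonmetricity A c g T y u v w = - B (C u v) w - B v (C u w)" for u v w
      unfolding nonmetricity_def conn_coeff_def form_simps B_def C_def by (simp add: algebra_simps)
    have symB: "B u v = B v u" for u v unfolding B_def by (rule sym)
    have "(\<forall>u v w. C v w = C w v \<and> - B (C u v) w - B v (C u w) = - B (C u w) v - B w (C u v)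
        \<and> - B (C u v) w - B v (C u w) = - B (C v u) w - B u (C v w)) \<longleftrightarrow>
      (\<forall>v w. C v w = C w v) \<and> (\<forall>u v w. B (C u v) w = B v (C u w))"  (is "?l \<longleftrightarrow> ?r")
    proof
      assume l: ?l
      then have s: "C v w = C w v" and t: "B v (C u w) = B u (C v w)" for u v w
        by (blast, smt (verit))
      have "B (C u v) w = B v (C u w)" for u v w
        using s t symB by metis
      then show ?r using s by blast
    next
      assume r: ?r
      then have "B (C u v) w = B v (C u w)" "C v w = C w v" for u v w by auto
      then show ?l using symB by (smt (verit))
    qed
    also have "(\<forall>v w. C v w = C w v) \<longleftrightarrow> (\<forall>v w. T x v w = T x w v)"
      unfolding C_def x(2) coords12_chart[OF c x(1)]
      using from_to_coords[OF c x(1)] by metis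
    also have "(\<forall>u v w. B (C u v) w = B v (C u w)) \<longleftrightarrow> (\<forall>u v w. g x (T x u v) w = g x v (T x u w))"
      unfolding B_def C_def x(2) coords12_chart[OF c x(1)] coords02_chart[OF c x(1)] from_to_coords[OF c x(1)]
      using from_to_coords[OF c x(1)] by metis
    finally show ?thesis
      unfolding conn nm statistical_at_def using T by simp
  qed
  note eq = this
  show ?thesis
  proof
    assume s: "statistical A g T"
    then have t: "tensor12 A T" and b: "\<And>x. bilinear (T x)" by (auto simp: statistical_def tensor12_def)
    have "statistical_at (g x) (T x)" for x
      by (subst eq[OF b chart_at refl, symmetric]) (use s chart_at[of x] in \<open>auto simp: statistical_def\<close>)
    with t show "tensor12 A T \<and> (\<forall>x. statistical_at (g x) (T x))" by blast
  next
    assume s: "tensor12 A T \<and> (\<forall>x. statistical_at (g x) (T x))"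
    then have b: "\<And>x. bilinear (T x)" by (auto simp: tensor12_def)
    show "statistical A g T"
      unfolding statistical_def
    proof (intro conjI ballI)
      fix c y assume c: "c \<in> A" and "y \<in> snd c ` chart_dom c"
      then obtain x where x: "x \<in> chart_dom c" "y = snd c x" by auto
      show "\<forall>u v w. conn_coeff A c g T y v w = conn_coeff A c g T y w v \<and>
        nonmetricity A c g T y u v w = nonmetricity A c g T y u w v \<and>
        nonmetricity A c g T y u v w = nonmetricity A c g T y v u w"
        using eq[OF b c x] s by blast
    qed (use s in blast)
  qed
qed

end

section \<open>Change of variables\<close>

text \<open>The change of variables theorem concerns index types with a well-ordering. Any finite
  type has a copy that carries one, and the passage to the copy preserves determinants and
  Lebesgue measure.\<close>

typedef 'n ordered_copy = "UNIV :: 'n set" by auto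

instantiation ordered_copy :: (finite) wellorder
begin

definition less_eq_ordered_copy :: "'a ordered_copy \<Rightarrow> 'a ordered_copy \<Rightarrow> bool" where
  "x \<le> y \<longleftrightarrow> to_nat (Rep_ordered_copy x) \<le> to_nat (Rep_ordered_copy y)"

definition less_ordered_copy :: "'a ordered_copy \<Rightarrow> 'a ordered_copy \<Rightarrow> bool" where
  "x < y \<longleftrightarrow> to_nat (Rep_ordered_copy x) < to_nat (Rep_ordered_copy y)"

instance
proof
  fix P :: "'a ordered_copy \<Rightarrow> bool" and a :: "'a ordered_copy"
  assume step: "\<And>x. (\<And>y. y < x \<Longrightarrow> P y) \<Longrightarrow> P x"
  show "P a"
  proof (induction a rule: measure_induct_rule[where f = "\<lambda>x. to_nat (Rep_ordered_copy x)"])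
    case (less x)
    show ?case by (rule step) (rule less, simp only: less_ordered_copy_def)
  qed
qed (auto simp: less_eq_ordered_copy_def less_ordered_copy_def Rep_ordered_copy_inject)

end

lemma bij_Rep_ordered_copy: "bij Rep_ordered_copy"
  by (metis Abs_ordered_copy_inverse UNIV_I bij_betw_def inj_def Rep_ordered_copy_inject surj_def)

instance ordered_copy :: (finite) finite
proof
  show "finite (UNIV :: 'a ordered_copy set)"
    using bij_betw_finite[OF bij_Rep_ordered_copy] finite[of "UNIV :: 'a set"] by blast
qed

definition copy :: "real^'m \<Rightarrow> real^('m ordered_copy)" where
  "copy x = (\<chi> i. x $ Rep_ordered_copy i)"

definition uncopy :: "real^('m ordered_copy) \<Rightarrow> real^'m" where
  "uncopy x = (\<chi> i. x $ Abs_ordered_copy i)"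

lemma uncopy_copy [simp]: "uncopy (copy x) = x" and copy_uncopy [simp]: "copy (uncopy y) = y"
  by (simp_all add: copy_def uncopy_def Abs_ordered_copy_inverse Rep_ordered_copy_inverse vec_eq_iff)

lemma linear_copy: "linear (copy :: real^'m::finite \<Rightarrow> _)" and linear_uncopy: "linear (uncopy :: _ \<Rightarrow> real^'m::finite)"
  by (auto simp: copy_def uncopy_def vec_eq_iff intro!: linearI)

lemma bounded_linear_copy: "bounded_linear (copy :: real^'m::finite \<Rightarrow> _)"
  and bounded_linear_uncopy: "bounded_linear (uncopy :: _ \<Rightarrow> real^'m::finite)"
  by (simp_all add: linear_copy linear_uncopy linear_linear)

lemma measurable_copy [measurable]: "copy \<in> borel_measurable borel"
  and measurable_uncopy [measurable]: "uncopy \<in> borel_measurable borel"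
  by (auto intro!: borel_measurable_continuous_onI linear_continuous_on bounded_linear_copy bounded_linear_uncopy)

lemma prod_Basis_vec: "(\<Prod>b\<in>Basis. f b) = (\<Prod>i\<in>UNIV. f (axis i (1::real)))"
proof -
  have "bij_betw (\<lambda>i. axis i (1::real)) UNIV Basis"
    by (auto simp: bij_betw_def inj_def axis_eq_axis Basis_vec_def)
  from prod.reindex_bij_betw[OF this, of f] show ?thesis ..
qed

lemma distr_copy: "distr lborel borel (copy :: real^'m::finite \<Rightarrow> _) = lborel"
proof (rule lborel_eqI[symmetric])
  fix l u :: "real^('m ordered_copy)"
  assume le: "\<And>b. b \<in> Basis \<Longrightarrow> l \<bullet> b \<le> u \<bullet> b"
  have le': "uncopy l \<bullet> b \<le> uncopy u \<bullet> b" if b: "b \<in> Basis" for b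
  proof -
    obtain i where "b = axis i 1" using b by (auto simp: Basis_vec_def)
    then show ?thesis using le[of "axis (Abs_ordered_copy i) 1"] by (simp add: inner_axis uncopy_def)
  qed
  have "copy -` box l u = box (uncopy l) (uncopy u)"
    unfolding set_eq_iff vimage_def mem_box_cart mem_Collect_eq
    by (simp add: copy_def uncopy_def) (metis Abs_ordered_copy_inverse Rep_ordered_copy_inverse UNIV_I)
  then have "emeasure (distr lborel borel copy) (box l u) = (\<Prod>b\<in>Basis. (uncopy u - uncopy l) \<bullet> b)"
    using le' by (simp add: emeasure_distr)
  also have "(\<Prod>b\<in>Basis. (uncopy u - uncopy l) \<bullet> b) = (\<Prod>i\<in>UNIV. (u - l) $ Abs_ordered_copy i)"
    by (simp add: prod_Basis_vec inner_axis uncopy_def)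
  also have "\<dots> = (\<Prod>i\<in>UNIV. (u - l) $ i)"
    by (rule prod.reindex_bij_witness[of _ Rep_ordered_copy Abs_ordered_copy])
       (auto simp: Abs_ordered_copy_inverse Rep_ordered_copy_inverse)
  also have "\<dots> = (\<Prod>b\<in>Basis. (u - l) \<bullet> b)"
    by (simp add: prod_Basis_vec inner_axis)
  finally show "emeasure (distr lborel borel copy) (box l u) = ennreal (\<Prod>b\<in>Basis. (u - l) \<bullet> b)" .
qed simp

lemma copy_image_eq: "copy ` B = uncopy -` B"
  by (auto simp: image_iff) (metis copy_uncopy)

lemma copy_image_borel: "B \<in> sets borel \<Longrightarrow> copy ` B \<in> sets borel"
  unfolding copy_image_eq using measurable_sets[OF measurable_uncopy, of B] by simp

lemma emeasure_copy_image:
  fixes B :: "(real^'m::finite) set"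
  assumes "B \<in> sets borel"
  shows "emeasure lborel (copy ` B) = emeasure lborel B"
proof -
  have "emeasure lborel (copy ` B) = emeasure (distr lborel borel (copy :: real^'m \<Rightarrow> _)) (copy ` B)"
    by (simp add: distr_copy)
  also have "\<dots> = emeasure lborel (copy -` copy ` B)"
    using copy_image_borel[OF assms] by (simp add: emeasure_distr)
  also have "copy -` copy ` B = B" by (auto simp: copy_image_eq)
  finally show ?thesis .
qed

lemma nn_integral_copy:
  assumes "f \<in> borel_measurable borel"
  shows "(\<integral>\<^sup>+x. f (copy (x::real^'m::finite)) \<partial>lborel) = (\<integral>\<^sup>+y. f y \<partial>lborel)"
  by (subst distr_copy[symmetric]) (use assms in \<open>simp add: nn_integral_distr\<close>)

text \<open>The permutations of the two index types correspond to each other under the bijection, with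
  equal signs.\<close>

lemma det_copy:
  fixes L :: "real^'m::finite \<Rightarrow> real^'m"
  shows "det (matrix (\<lambda>v. copy (L (uncopy v)))) = det (matrix L)"
proof -
  let ?A = "Abs_ordered_copy :: 'm \<Rightarrow> 'm ordered_copy" and ?R = "Rep_ordered_copy :: 'm ordered_copy \<Rightarrow> 'm"
  have bR: "bij_betw ?R UNIV UNIV" by (rule bij_Rep_ordered_copy)
  have bA: "bij_betw ?A UNIV UNIV"
    by (rule bij_betwI[where g = ?R]) (auto simp: Abs_ordered_copy_inverse Rep_ordered_copy_inverse)
  have inj: "inj ?R" "inj ?A" using bR bA by (auto simp: bij_betw_def)
  have ax: "uncopy (axis i 1) = axis (?R i) 1" for i
    by (auto simp: uncopy_def axis_def vec_eq_iff Abs_ordered_copy_inverse Rep_ordered_copy_inverse)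
  have M: "matrix (\<lambda>v. copy (L (uncopy v))) $ i $ j = matrix L $ ?R i $ ?R j" for i j
    by (simp add: matrix_def copy_def ax)
  show ?thesis
    unfolding det_def
  proof (rule sum.reindex_bij_witness[where i = "map_permutation UNIV ?A" and j = "map_permutation UNIV ?R"])
    fix p :: "'m ordered_copy \<Rightarrow> 'm ordered_copy"
    assume "p \<in> {p. p permutes UNIV}"
    then have p: "p permutes UNIV" by simp
    show "map_permutation UNIV ?A (map_permutation UNIV ?R p) = p"
      by (rule map_permutation_compose_inv[OF bR p]) (simp add: Rep_ordered_copy_inverse)
    show "map_permutation UNIV ?R p \<in> {p. p permutes UNIV}"
      using map_permutation_permutes[OF bR p] by simp
    have "sign (map_permutation UNIV ?R p) = sign p"
      using sign_map_permutation[OF inj(1) p finite] by simp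
    moreover have "(\<Prod>i\<in>UNIV. matrix L $ i $ map_permutation UNIV ?R p i)
        = (\<Prod>i\<in>UNIV. matrix (\<lambda>v. copy (L (uncopy v))) $ i $ p i)"
      by (subst prod.reindex_bij_betw[OF bR, symmetric])
         (simp add: M map_permutation_apply[OF inj(1)])
    ultimately show "of_int (sign (map_permutation UNIV ?R p)) *
        (\<Prod>i\<in>UNIV. matrix L $ i $ map_permutation UNIV ?R p i)
      = of_int (sign p) * (\<Prod>i\<in>UNIV. matrix (\<lambda>v. copy (L (uncopy v))) $ i $ p i)"
      by simp
  next
    fix p :: "'m \<Rightarrow> 'm"
    assume "p \<in> {p. p permutes UNIV}"
    then have p: "p permutes UNIV" by simp
    show "map_permutation UNIV ?R (map_permutation UNIV ?A p) = p"
      by (rule map_permutation_compose_inv[OF bA p]) (simp add: Abs_ordered_copy_inverse)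
    show "map_permutation UNIV ?A p \<in> {p. p permutes UNIV}"
      using map_permutation_permutes[OF bA p] by simp
  qed
qed

text \<open>The equality of finite measures extends to infinite ones because each side is finite as soon as
  the other is.\<close>

lemma emeasure_image_wellorder:
  fixes f :: "real^'n::{finite,wellorder} \<Rightarrow> real^'n::_"
  assumes S: "S \<in> sets borel" and fS: "f ` S \<in> sets borel"
    and der: "\<And>x. x \<in> S \<Longrightarrow> (f has_derivative f' x) (at x)" and inj: "inj_on f S"
    and meas: "(\<lambda>x. indicator S x * \<bar>det (matrix (f' x))\<bar>) \<in> borel_measurable borel"
  shows "emeasure lborel (f ` S) = (\<integral>\<^sup>+x. ennreal (indicator S x * \<bar>det (matrix (f' x))\<bar>) \<partial>lborel)"
proof -
  let ?h = "\<lambda>x. indicator S x * \<bar>det (matrix (f' x))\<bar>"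
  have iff: "f ` S \<in> lmeasurable \<and> measure lebesgue (f ` S) = m \<longleftrightarrow> (?h has_integral m) UNIV" for m
  proof -
    have "f ` S \<in> lmeasurable \<and> measure lebesgue (f ` S) = m \<longleftrightarrow>
        ((\<lambda>x. \<bar>det (matrix (f' x))\<bar>) has_integral m) S"
      by (rule has_measure_differentiable_image)
         (use S der inj in \<open>auto intro: has_derivative_at_withinI\<close>)
    also have "\<dots> \<longleftrightarrow> ((\<lambda>x. if x \<in> S then \<bar>det (matrix (f' x))\<bar> else 0) has_integral m) UNIV"
      by (simp add: has_integral_restrict_UNIV)
    also have "(\<lambda>x. if x \<in> S then \<bar>det (matrix (f' x))\<bar> else 0) = ?h"
      by (auto simp: indicator_def)
    finally show ?thesis .
  qed
  have fS': "emeasure lebesgue (f ` S) = emeasure lborel (f ` S)"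
    using fS by simp
  show ?thesis
  proof (cases "(\<integral>\<^sup>+x. ennreal (?h x) \<partial>lborel)")
    case (real r)
    then have "(?h has_integral r) UNIV"
      by (intro nn_integral_has_integral meas) auto
    then have "f ` S \<in> lmeasurable" "measure lebesgue (f ` S) = r" using iff by auto
    then have "emeasure lebesgue (f ` S) = ennreal r"
      using emeasure_eq_measure2 by blast
    then show ?thesis using real fS' by simp
  next
    case top
    have "\<not> f ` S \<in> lmeasurable"
    proof
      assume "f ` S \<in> lmeasurable"
      then have "(?h has_integral measure lebesgue (f ` S)) UNIV" using iff by blast
      then have "(\<integral>\<^sup>+x. ennreal (?h x) \<partial>lborel) = measure lebesgue (f ` S)"
        by (intro nn_integral_has_integral_lborel meas) auto
      then show False using top by simp
    qed
    then have "emeasure lborel (f ` S) = \<infinity>"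
      using fS fS' by (auto simp: fmeasurable_def less_top[symmetric])
    then show ?thesis using top by simp
  qed
qed

lemma emeasure_image:
  fixes f :: "real^'m::finite \<Rightarrow> real^'m"
  assumes S: "S \<in> sets borel" and fS: "f ` S \<in> sets borel"
    and der: "\<And>x. x \<in> S \<Longrightarrow> (f has_derivative f' x) (at x)" and inj: "inj_on f S"
    and meas: "(\<lambda>x. indicator S x * \<bar>det (matrix (f' x))\<bar>) \<in> borel_measurable borel"
  shows "emeasure lborel (f ` S) = (\<integral>\<^sup>+x. ennreal (indicator S x * \<bar>det (matrix (f' x))\<bar>) \<partial>lborel)"
proof -
  let ?f = "\<lambda>y. copy (f (uncopy y))" and ?f' = "\<lambda>y v. copy (f' (uncopy y) (uncopy v))"
  let ?h = "\<lambda>y. indicator (copy ` S) y * \<bar>det (matrix (?f' y))\<bar>"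
  have im: "?f ` copy ` S = copy ` f ` S" by (auto simp: image_image)
  have h: "?h y = indicator S (uncopy y) * \<bar>det (matrix (f' (uncopy y)))\<bar>" for y
    by (auto simp: det_copy copy_image_eq indicator_def)
  have m: "?h \<in> borel_measurable borel"
    unfolding h using measurable_compose[OF measurable_uncopy meas] .
  have "emeasure lborel (?f ` copy ` S) = (\<integral>\<^sup>+y. ennreal (?h y) \<partial>lborel)"
  proof (rule emeasure_image_wellorder)
    show "(?f has_derivative ?f' y) (at y)" if "y \<in> copy ` S" for y
    proof -
      have d: "(f has_derivative f' (uncopy y)) (at (uncopy y))"
        using that der by auto
      have "((\<lambda>y. f (uncopy y)) has_derivative (\<lambda>v. f' (uncopy y) (uncopy v))) (at y)"
        using has_derivative_compose[OF bounded_linear_imp_has_derivative[OF bounded_linear_uncopy] d] .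
      from bounded_linear.has_derivative[OF bounded_linear_copy this] show ?thesis .
    qed
    show "inj_on ?f (copy ` S)"
      using inj by (auto simp: inj_on_def) (metis uncopy_copy)
    show "?f ` copy ` S \<in> sets borel" unfolding im by (intro copy_image_borel fS)
  qed (use m copy_image_borel[OF S] in auto)
  also have "\<dots> = (\<integral>\<^sup>+x. ennreal (?h (copy x)) \<partial>lborel)"
    by (subst nn_integral_copy) (use m in auto)
  also have "(\<lambda>x. ?h (copy x)) = (\<lambda>x. indicator S x * \<bar>det (matrix (f' x))\<bar>)"
    unfolding h by simp
  finally show ?thesis unfolding im by (simp add: emeasure_copy_image fS)
qed

text \<open>The image measure of \<open>\<bar>det f'\<bar>\<close> times Lebesgue measure is the restriction of Lebesgue
  measure to the image, so the formula for sets extends to nonnegative functions.\<close>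

lemma nn_integral_change_of_variables:
  fixes f :: "real^'m::finite \<Rightarrow> real^'m" and h :: "real^'m \<Rightarrow> ennreal"
  assumes S: "S \<in> sets borel" and im: "\<And>C. C \<in> sets borel \<Longrightarrow> f ` (S \<inter> f -` C) \<in> sets borel"
    and der: "\<And>x. x \<in> S \<Longrightarrow> (f has_derivative f' x) (at x)" and inj: "inj_on f S"
    and meas: "(\<lambda>x. indicator S x * \<bar>det (matrix (f' x))\<bar>) \<in> borel_measurable borel"
    and h: "h \<in> borel_measurable borel"
  shows "(\<integral>\<^sup>+y\<in>f ` S. h y \<partial>lborel) = (\<integral>\<^sup>+x\<in>S. ennreal \<bar>det (matrix (f' x))\<bar> * h (f x) \<partial>lborel)"
proof -
  have "continuous_on S f"
    using der by (meson continuous_at_imp_continuous_on has_derivative_continuous)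
  then have F: "(\<lambda>x. if x \<in> S then f x else 0) \<in> borel_measurable borel" (is "?F \<in> _")
    by (intro borel_measurable_continuous_on_if S) auto
  let ?d = "\<lambda>x. ennreal (indicator S x * \<bar>det (matrix (f' x))\<bar>)"
  have fS: "f ` S \<in> sets borel" using im[of UNIV] by simp
  have "distr (density lborel ?d) borel ?F = density lborel (indicator (f ` S))"
  proof (rule measure_eqI)
    fix C assume "C \<in> sets (distr (density lborel ?d) borel ?F)"
    then have C: "C \<in> sets borel" by simp
    have SC: "S \<inter> f -` C \<in> sets borel"
    proof -
      have "S \<inter> f -` C = S \<inter> ?F -` C" by auto
      then show ?thesis using S measurable_sets[OF F C] by simp
    qed
    have "emeasure (distr (density lborel ?d) borel ?F) C = (\<integral>\<^sup>+x. ?d x * indicator (?F -` C) x \<partial>lborel)"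
      using C F meas measurable_sets[OF F C] by (simp add: emeasure_distr emeasure_density)
    also have "\<dots> = (\<integral>\<^sup>+x. ennreal (indicator (S \<inter> f -` C) x * \<bar>det (matrix (f' x))\<bar>) \<partial>lborel)"
      by (intro nn_integral_cong) (auto simp: indicator_def)
    also have "\<dots> = emeasure lborel (f ` (S \<inter> f -` C))"
    proof (rule emeasure_image[symmetric])
      have "(\<lambda>x. indicator (S \<inter> f -` C) x * (indicator S x * \<bar>det (matrix (f' x))\<bar>)) \<in> borel_measurable borel"
        by (intro borel_measurable_times[OF borel_measurable_indicator meas]) (use SC in simp)
      moreover have "(\<lambda>x. indicator (S \<inter> f -` C) x * (indicator S x * \<bar>det (matrix (f' x))\<bar>))
          = (\<lambda>x. indicator (S \<inter> f -` C) x * \<bar>det (matrix (f' x))\<bar>)"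
        by (auto simp: indicator_def)
      ultimately show "(\<lambda>x. indicator (S \<inter> f -` C) x * \<bar>det (matrix (f' x))\<bar>) \<in> borel_measurable borel"
        by simp
      show "inj_on f (S \<inter> f -` C)" using inj by (rule inj_on_subset) auto
    qed (use SC im[OF C] der in auto)
    also have "f ` (S \<inter> f -` C) = f ` S \<inter> C" by auto
    also have "emeasure lborel (f ` S \<inter> C) = emeasure (density lborel (indicator (f ` S))) C"
      using fS C by (simp add: emeasure_density flip: indicator_inter_arith)
    finally show "emeasure (distr (density lborel ?d) borel ?F) C = emeasure (density lborel (indicator (f ` S))) C" .
  qed simp
  then have "(\<integral>\<^sup>+y. h y \<partial>density lborel (indicator (f ` S))) = (\<integral>\<^sup>+y. h y \<partial>distr (density lborel ?d) borel ?F)"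
    by (simp only:)
  also have "\<dots> = (\<integral>\<^sup>+x. ?d x * h (?F x) \<partial>lborel)"
    by (subst nn_integral_distr) (use F h meas in \<open>auto simp: nn_integral_density\<close>)
  also have "\<dots> = (\<integral>\<^sup>+x\<in>S. ennreal \<bar>det (matrix (f' x))\<bar> * h (f x) \<partial>lborel)"
    by (intro nn_integral_cong) (auto simp: indicator_def)
  finally show ?thesis
    using fS h by (simp add: nn_integral_density mult.commute)
qed

section \<open>The volume measure of a pseudo-Riemannian metric\<close>

locale volume_atlas = metric_atlas A g
  for A :: "('a::second_countable_topology, real^'m) chart set" and g
begin

lemma continuous_vol_density:
  assumes "c \<in> A"
  shows "continuous_on (snd c ` chart_dom c) (vol_density A c g)"
  unfolding vol_density_def det_def
  by (intro continuous_intros) (simp add: smooth_on_imp_continuous_on[OF metric_smooth[OF assms]])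

lemma vol_density_pos:
  assumes c: "c \<in> A" and y: "y \<in> snd c ` chart_dom c"
  shows "vol_density A c g y > 0"
proof -
  interpret symmetric_form "coords02 A c g y" by (rule symmetric_form_coords02[OF c y])
  let ?M = "\<chi> i j. coords02 A c g y (axis i 1) (axis j 1)"
  have "v = 0" if "?M *v v = 0" for v
  proof -
    have exp: "w = (\<Sum>i\<in>UNIV. w $ i *\<^sub>R axis i 1)" for w :: "real^'m"
      using basis_expansion[of w] by (simp add: scalar_mult_eq_scaleR)
    have "coords02 A c g y (axis i 1) v = 0" for i
    proof -
      have "coords02 A c g y (axis i 1) v = (\<Sum>j\<in>UNIV. v $ j * coords02 A c g y (axis i 1) (axis j 1))"
        by (subst exp) (simp add: form_sum form_simps)
      also have "\<dots> = (?M *v v) $ i"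
        by (simp add: matrix_vector_mult_def mult.commute)
      finally show ?thesis using that by simp
    qed
    then have "coords02 A c g y w v = 0" for w
      by (subst exp) (simp add: form_sum form_simps)
    then show "v = 0"
      using nondegenerate_coords02[OF c y] sym[of v] unfolding nondegenerate_on_def by auto
  qed
  then have "det ?M \<noteq> 0"
    by (metis invertible_det_nz matrix_left_invertible_ker invertible_left_inverse)
  then show ?thesis by (simp add: vol_density_def)
qed

lemma vol_density_change:
  assumes cd: "c \<in> A" "d \<in> A" and x: "x \<in> chart_dom c" "x \<in> chart_dom d"
  shows "vol_density A c g (snd c x) = \<bar>det (matrix (jac c d x))\<bar> * vol_density A d g (snd d x)"
proof -
  let ?J = "matrix (jac c d x)"
  let ?M = "\<lambda>c. \<chi> i j. coords02 A c g (snd c x) (axis i 1) (axis j 1)"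
  have y: "snd d x \<in> snd d ` chart_dom d" using x by auto
  interpret symmetric_form "coords02 A d g (snd d x)" by (rule symmetric_form_coords02[OF cd(2) y])
  have exp: "jac c d x (axis i 1) = (\<Sum>k\<in>UNIV. ?J $ k $ i *\<^sub>R axis k 1)" for i
    using basis_expansion[of "jac c d x (axis i 1)"] by (simp add: matrix_def scalar_mult_eq_scaleR)
  have "?M c = transpose ?J ** ?M d ** ?J"
    unfolding coords02_change[OF cd x] exp
    by (simp add: vec_eq_iff matrix_matrix_mult_def transpose_def form_sum form_simps
        sum_distrib_left sum_distrib_right mult_ac)
  then have "det (?M c) = (det ?J)\<^sup>2 * det (?M d)"
    by (simp add: det_mul power2_eq_square)
  then show ?thesis
    by (simp add: vol_density_def abs_mult real_sqrt_mult)
qed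

lemma measurable_chart_inv [measurable]:
  assumes "c \<in> A"
  shows "chart_inv c \<in> borel_measurable borel"
proof -
  \<comment> \<open>Outside the image of the chart, \<open>chart_inv\<close> is constant by definition of the inverse.\<close>
  have "(\<lambda>y. if y \<in> snd c ` chart_dom c then chart_inv c y else (SOME x. False)) \<in> borel_measurable borel"
    using chart_homeo(2,5)[OF assms] by (intro borel_measurable_continuous_on_if) auto
  moreover have "(\<lambda>y. if y \<in> snd c ` chart_dom c then chart_inv c y else (SOME x. False)) = chart_inv c"
    by (auto simp: inv_into_def fun_eq_iff intro!: arg_cong[where f = Eps])
  ultimately show ?thesis by simp
qed

lemma chart_image_borel:
  assumes "c \<in> A" "B \<in> sets borel"
  shows "snd c ` (chart_dom c \<inter> B) \<in> sets borel"
proof -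
  have "snd c ` (chart_dom c \<inter> B) = snd c ` chart_dom c \<inter> chart_inv c -` B"
    using assms by auto
  then show ?thesis
    using measurable_sets[OF measurable_chart_inv[OF assms(1)] assms(2)] chart_homeo(2)[OF assms(1)] by simp
qed

lemma chart_dom_borel: "c \<in> A \<Longrightarrow> chart_dom c \<in> sets borel"
  using chart_homeo(1) by simp

definition chart_measure :: "('a, real^'m) chart \<Rightarrow> 'a measure" where
  "chart_measure c = distr (density lborel (\<lambda>y. ennreal (indicator (snd c ` chart_dom c) y *
     vol_density A c g y))) borel (chart_inv c)"

lemma measurable_density:
  assumes "c \<in> A" "V \<in> sets borel" "V \<subseteq> snd c ` chart_dom c"
  shows "(\<lambda>y. indicator V y * vol_density A c g y) \<in> borel_measurable borel"
  using borel_measurable_continuous_on_indicator[OF assms(2)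
      continuous_on_subset[OF continuous_vol_density[OF assms(1)] assms(3)]] by simp

lemma emeasure_chart_measure:
  assumes c: "c \<in> A" and B: "B \<in> sets borel" "B \<subseteq> chart_dom c"
  shows "emeasure (chart_measure c) B = (\<integral>\<^sup>+y\<in>snd c ` B. ennreal (vol_density A c g y) \<partial>lborel)"
proof -
  have "emeasure (chart_measure c) B = (\<integral>\<^sup>+y. ennreal (indicator (snd c ` chart_dom c) y *
      vol_density A c g y) * indicator (chart_inv c -` B) y \<partial>lborel)"
    unfolding chart_measure_def
    using measurable_chart_inv[OF c] measurable_density[OF c _ order.refl] chart_homeo(2)[OF c] B
      measurable_sets[OF measurable_chart_inv[OF c] B(1)]
    by (simp add: emeasure_distr emeasure_density)
  also have "\<dots> = (\<integral>\<^sup>+y\<in>snd c ` B. ennreal (vol_density A c g y) \<partial>lborel)"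
  proof (intro nn_integral_cong)
    fix y
    have "y \<in> snd c ` B \<longleftrightarrow> y \<in> snd c ` chart_dom c \<and> chart_inv c y \<in> B"
      using B(2) c by (auto simp: subset_iff)
    then show "ennreal (indicator (snd c ` chart_dom c) y * vol_density A c g y) * indicator (chart_inv c -` B) y
        = ennreal (vol_density A c g y) * indicator (snd c ` B) y"
      by (auto simp: indicator_def)
  qed
  finally show ?thesis .
qed

text \<open>Two charts give the same measure on their overlap: the determinant of the metric changes by
  the square of the Jacobian determinant.\<close>

lemma chart_measure_overlap:
  assumes c: "c \<in> A" and d: "d \<in> A" and B: "B \<in> sets borel" "B \<subseteq> chart_dom c" "B \<subseteq> chart_dom d"
  shows "emeasure (chart_measure c) B = emeasure (chart_measure d) B"
proof -
  let ?S = "snd c ` B" and ?f = "transition c d"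
  let ?f' = "\<lambda>y. jac c d (chart_inv c y)"
  let ?h = "\<lambda>y. ennreal (indicator (snd d ` chart_dom d) y * vol_density A d g y)"
  have cB: "snd c ` B \<in> sets borel"
    using chart_image_borel[OF c B(1)] B(2) by (simp add: Int_absorb1)
  have fS: "?f ` snd c ` B' = snd d ` B'" if "B' \<subseteq> B" for B'
    using that B(2) c by (force simp: image_image)
  have dens: "\<bar>det (matrix (?f' y))\<bar> = vol_density A c g y / vol_density A d g (?f y)" if y: "y \<in> ?S" for y
  proof -
    obtain x where x: "x \<in> B" "y = snd c x" using y by auto
    then show ?thesis
      using vol_density_change[OF c d, of x] vol_density_pos[OF d, of "snd d x"] B c by (auto simp: subset_iff)
  qed
  have cont_f: "continuous_on ?S ?f"
    by (rule continuous_on_subset[OF smooth_on_imp_continuous_on[OF transition_smooth[OF c d]]])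
       (use B in auto)
  have "continuous_on ?S (\<lambda>y. vol_density A c g y / vol_density A d g (?f y))"
  proof (intro continuous_on_divide)
    show "continuous_on ?S (vol_density A c g)"
      using continuous_on_subset[OF continuous_vol_density[OF c]] B by blast
    have "?f ` ?S \<subseteq> snd d ` chart_dom d" using fS[of B] B(3) by auto
    then show "continuous_on ?S (\<lambda>y. vol_density A d g (?f y))"
      by (rule continuous_on_compose2[OF continuous_vol_density[OF d] cont_f])
    show "\<forall>y\<in>?S. vol_density A d g (?f y) \<noteq> 0"
      using vol_density_pos[OF d] \<open>?f ` ?S \<subseteq> _\<close> by (metis image_subset_iff less_irrefl)
  qed
  then have "(\<lambda>y. indicator ?S y *\<^sub>R (vol_density A c g y / vol_density A d g (?f y))) \<in> borel_measurable borel"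
    using borel_measurable_continuous_on_indicator[OF cB] by blast
  moreover have "(\<lambda>y. indicator ?S y *\<^sub>R (vol_density A c g y / vol_density A d g (?f y)))
      = (\<lambda>y. indicator ?S y * \<bar>det (matrix (?f' y))\<bar>)"
    using dens by (auto simp: indicator_def fun_eq_iff)
  ultimately have meas: "(\<lambda>y. indicator ?S y * \<bar>det (matrix (?f' y))\<bar>) \<in> borel_measurable borel"
    by simp
  have "emeasure (chart_measure d) B = (\<integral>\<^sup>+y\<in>?f ` ?S. ?h y \<partial>lborel)"
    unfolding emeasure_chart_measure[OF d B(1,3)] fS[OF order.refl]
    by (intro nn_integral_cong) (use B(3) in \<open>auto simp: indicator_def\<close>)
  also have "\<dots> = (\<integral>\<^sup>+y\<in>?S. ennreal \<bar>det (matrix (?f' y))\<bar> * ?h (?f y) \<partial>lborel)"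
  proof (rule nn_integral_change_of_variables[OF cB])
    fix C :: "(real^'m) set" assume C: "C \<in> sets borel"
    have "?f ` (?S \<inter> ?f -` C) = snd d ` (chart_dom d \<inter> B) \<inter> C"
    proof -
      have "?f ` (?S \<inter> ?f -` C) = ?f ` ?S \<inter> C" by auto
      also have "?f ` ?S = snd d ` (chart_dom d \<inter> B)"
        using fS[OF order.refl] B(3) by (simp add: Int_absorb1)
      finally show ?thesis .
    qed
    then show "?f ` (?S \<inter> ?f -` C) \<in> sets borel"
      using chart_image_borel[OF d B(1)] C by simp
  next
    show "(?f has_derivative ?f' y) (at y)" if "y \<in> ?S" for y
      using that jac_has_derivative[OF c d] B c by (auto simp: subset_iff)
    show "inj_on ?f ?S"
    proof (rule inj_onI)
      fix y z assume "y \<in> ?S" "z \<in> ?S" and e: "?f y = ?f z"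
      then obtain x x' where "x \<in> B" "x' \<in> B" "y = snd c x" "z = snd c x'" by auto
      with e show "y = z"
        using chart_homeo(3)[OF d] B c by (auto simp: inj_on_def subset_iff)
    qed
    have "snd d ` chart_dom d \<in> sets borel" using chart_homeo(2)[OF d] by simp
    from measurable_density[OF d this order.refl] show "?h \<in> borel_measurable borel" by simp
  qed (rule meas)
  also have "\<dots> = (\<integral>\<^sup>+y\<in>?S. ennreal (vol_density A c g y) \<partial>lborel)"
  proof (intro nn_integral_cong)
    fix y
    show "ennreal \<bar>det (matrix (?f' y))\<bar> * ?h (?f y) * indicator ?S y = ennreal (vol_density A c g y) * indicator ?S y"
    proof (cases "y \<in> ?S")
      case True
      then have m: "?f y \<in> snd d ` chart_dom d" using fS[of B] B(3) by auto
      then have "vol_density A d g (?f y) > 0" by (rule vol_density_pos[OF d])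
      then show ?thesis
        using True m by (simp add: dens ennreal_mult[symmetric] vol_density_def)
    qed simp
  qed
  finally show ?thesis by (simp add: emeasure_chart_measure[OF c B(1,2)])
qed

lemma exists_countable_atlas:
  obtains c :: "nat \<Rightarrow> ('a, real^'m) chart" where "\<And>i. c i \<in> A" "(\<Union>i. chart_dom (c i)) = UNIV"
proof -
  obtain \<F> where F: "\<F> \<subseteq> fst ` A" "countable \<F>" "\<Union>\<F> = \<Union>(fst ` A)"
  proof (rule Lindelof)
    show "open S" if "S \<in> fst ` A" for S using that chart_homeo(1) by auto
  qed
  have un: "\<Union>(fst ` A) = UNIV" using chart_at by blast
  then have "\<F> \<noteq> {}" using F(3) by auto
  then have r: "range (from_nat_into \<F>) = \<F>" using F(2) by (rule range_from_nat_into)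
  define c where "c i = (SOME c. c \<in> A \<and> chart_dom c = from_nat_into \<F> i)" for i
  have c: "c i \<in> A \<and> chart_dom (c i) = from_nat_into \<F> i" for i
  proof -
    have "from_nat_into \<F> i \<in> fst ` A"
      using rangeI[of "from_nat_into \<F>" i] F(1) unfolding r by (rule subsetD[rotated])
    then have "\<exists>c. c \<in> A \<and> chart_dom c = from_nat_into \<F> i" by auto
    then show ?thesis unfolding c_def by (rule someI_ex)
  qed
  show ?thesis
  proof
    show "(\<Union>i. chart_dom (c i)) = UNIV"
      using c r F(3) un by auto
  qed (use c in auto)
qed

text \<open>The measure is patched together from countably many charts along disjoint pieces of their
  domains. It is determined by its values on chart domains for the same reason.\<close>

lemma exists_volume:
  "\<exists>!\<mu>. sets \<mu> = sets borel \<and> (\<forall>c\<in>A. \<forall>B\<in>sets borel. B \<subseteq> chart_dom c \<longrightarrow>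
     emeasure \<mu> B = (\<integral>\<^sup>+y\<in>snd c ` B. ennreal (vol_density A c g y) \<partial>lborel))"
proof -
  obtain c :: "nat \<Rightarrow> ('a, real^'m) chart" where c: "\<And>i. c i \<in> A" and cover: "(\<Union>i. chart_dom (c i)) = UNIV"
    using exists_countable_atlas by blast
  define D where "D = disjointed (\<lambda>i. chart_dom (c i))"
  have D_sub: "D i \<subseteq> chart_dom (c i)" for i
    unfolding D_def by (rule disjointed_subset)
  have "range D \<subseteq> sets borel"
    unfolding D_def using chart_dom_borel[OF c] by (intro sets.range_disjointed_sets) auto
  then have D: "D i \<in> sets borel" for i by auto
  have disj: "disjoint_family D" unfolding D_def by (rule disjoint_family_disjointed)
  have UD: "(\<Union>i. D i) = UNIV" unfolding D_def UN_disjointed_eq by (rule cover)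
  have sum_pieces: "emeasure \<nu> B = (\<Sum>i. emeasure \<nu> (B \<inter> D i))" if "sets \<nu> = sets borel" "B \<in> sets borel" for \<nu> B
  proof -
    have "disjoint_family (\<lambda>i. B \<inter> D i)"
      using disj unfolding disjoint_family_on_def by blast
    then have "(\<Sum>i. emeasure \<nu> (B \<inter> D i)) = emeasure \<nu> (\<Union>i. B \<inter> D i)"
      by (intro suminf_emeasure) (use that D in auto)
    also have "(\<Union>i. B \<inter> D i) = B" using UD by auto
    finally show ?thesis ..
  qed
  define m where "m B = (\<Sum>i. emeasure (chart_measure (c i)) (B \<inter> D i))" for B
  define \<mu> where "\<mu> = measure_of UNIV (sets borel) m"
  have sets: "sets \<mu> = sets borel"
    unfolding \<mu>_def using sets.sigma_sets_eq[of "borel :: 'a measure"] by simp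
  have em: "emeasure \<mu> B = m B" if "B \<in> sets borel" for B
    unfolding \<mu>_def
  proof (rule emeasure_measure_of_sigma)
    show "sigma_algebra UNIV (sets (borel :: 'a measure))"
      using sets.sigma_algebra_axioms[of "borel :: 'a measure"] by simp
    show "positive (sets borel) m" by (simp add: positive_def m_def)
    show "countably_additive (sets borel) m"
    proof (rule countably_additiveI)
      fix B :: "nat \<Rightarrow> 'a set"
      assume B: "range B \<subseteq> sets borel" "disjoint_family B"
      have "m (\<Union>n. B n) = (\<Sum>i. \<Sum>n. emeasure (chart_measure (c i)) (B n \<inter> D i))"
        unfolding m_def
      proof (intro suminf_cong)
        fix i
        have "(\<Sum>n. emeasure (chart_measure (c i)) (B n \<inter> D i)) = emeasure (chart_measure (c i)) (\<Union>n. B n \<inter> D i)"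
          by (rule suminf_emeasure) (use B D in \<open>auto simp: chart_measure_def disjoint_family_on_def\<close>)
        then show "emeasure (chart_measure (c i)) ((\<Union>n. B n) \<inter> D i) = (\<Sum>n. emeasure (chart_measure (c i)) (B n \<inter> D i))"
          by (simp add: Int_UN_distrib2)
      qed
      also have "\<dots> = (\<Sum>n. \<Sum>i. emeasure (chart_measure (c i)) (B n \<inter> D i))"
        unfolding nn_integral_count_space_nat[symmetric, of "\<lambda>i. \<Sum>n. emeasure (chart_measure (c i)) (B n \<inter> D i)"]
        by (subst nn_integral_suminf) (auto simp: nn_integral_count_space_nat)
      finally show "(\<Sum>n. m (B n)) = m (\<Union>n. B n)" by (simp add: m_def)
    qed
  qed (rule that)
  have spec: "emeasure \<mu> B = (\<integral>\<^sup>+y\<in>snd d ` B. ennreal (vol_density A d g y) \<partial>lborel)"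
    if d: "d \<in> A" and B: "B \<in> sets borel" "B \<subseteq> chart_dom d" for d B
  proof -
    have "emeasure \<mu> B = (\<Sum>i. emeasure (chart_measure d) (B \<inter> D i))"
      unfolding em[OF B(1)] m_def
      by (intro suminf_cong chart_measure_overlap c d) (use B D D_sub in auto)
    also have "\<dots> = emeasure (chart_measure d) B"
      by (rule sum_pieces[symmetric]) (use B in \<open>simp_all add: chart_measure_def\<close>)
    finally show ?thesis by (simp add: emeasure_chart_measure[OF d B])
  qed
  show ?thesis
  proof (rule ex1I[of _ \<mu>])
    fix \<nu> :: "'a measure"
    assume \<nu>: "sets \<nu> = sets borel \<and> (\<forall>c\<in>A. \<forall>B\<in>sets borel. B \<subseteq> chart_dom c \<longrightarrow>
      emeasure \<nu> B = (\<integral>\<^sup>+y\<in>snd c ` B. ennreal (vol_density A c g y) \<partial>lborel))"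
    show "\<nu> = \<mu>"
    proof (rule measure_eqI)
      fix B assume "B \<in> sets \<nu>"
      then have B: "B \<in> sets borel" using \<nu> by auto
      have "emeasure \<nu> (B \<inter> D i) = emeasure \<mu> (B \<inter> D i)" for i
      proof -
        have "B \<inter> D i \<in> sets borel" "B \<inter> D i \<subseteq> chart_dom (c i)"
          using B D[of i] D_sub[of i] by auto
        then show ?thesis using \<nu> c[of i] spec[OF c[of i]] by metis
      qed
      then show "emeasure \<nu> B = emeasure \<mu> B"
        using sum_pieces[OF sets B] sum_pieces[of \<nu> B] \<nu> B by simp
    qed (use \<nu> sets in auto)
  qed (use sets spec in auto)
qed

lemma sets_vol: "sets (vol A g) = sets borel"
  and emeasure_vol: "c \<in> A \<Longrightarrow> B \<in> sets borel \<Longrightarrow> B \<subseteq> chart_dom c \<Longrightarrow>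
    emeasure (vol A g) B = (\<integral>\<^sup>+y\<in>snd c ` B. ennreal (vol_density A c g y) \<partial>lborel)"
  using theI'[OF exists_volume] unfolding vol_def[symmetric] by auto

end

section \<open>Continuous families of linear maps and forms\<close>

lemma continuous_on_linear_eval:
  fixes f :: "'s::topological_space \<Rightarrow> 'v::euclidean_space \<Rightarrow> 'w::real_normed_vector"
  assumes "\<And>s. s \<in> S \<Longrightarrow> linear (f s)" "\<And>v. continuous_on S (\<lambda>s. f s v)" "continuous_on S h"
  shows "continuous_on S (\<lambda>s. f s (h s))"
proof -
  have "continuous_on S (\<lambda>s. \<Sum>e\<in>Basis. (h s \<bullet> e) *\<^sub>R f s e)"
    by (intro continuous_intros assms)
  then show ?thesis
    by (rule continuous_on_eq) (metis linear_euclidean_sum assms(1))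
qed

lemma continuous_on_bilinear_eval:
  fixes f :: "'s::topological_space \<Rightarrow> 'v::euclidean_space \<Rightarrow> 'u::euclidean_space \<Rightarrow> 'w::real_normed_vector"
  assumes "\<And>s. s \<in> S \<Longrightarrow> bilinear (f s)" "\<And>u v. continuous_on S (\<lambda>s. f s u v)"
    "continuous_on S h" "continuous_on S k"
  shows "continuous_on S (\<lambda>s. f s (h s) (k s))"
  by (rule continuous_on_linear_eval[where f = "\<lambda>s. f s (h s)"], simp add: assms(1) bilinear_def[THEN iffD1, OF assms(1)],
      rule continuous_on_linear_eval[where f = "\<lambda>s u. f s u _"])
     (use assms in \<open>auto simp: bilinear_def\<close>)

text \<open>A lower bound for an injective member of the family persists, with half the constant, nearby.
  This makes injectivity an open condition and solutions of linear systems continuous.\<close>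

lemma linear_family_near:
  fixes f :: "'s::topological_space \<Rightarrow> 'v::euclidean_space \<Rightarrow> 'w::euclidean_space"
  assumes lin: "\<And>s. s \<in> S \<Longrightarrow> linear (f s)" and cont: "\<And>v. continuous_on S (\<lambda>s. f s v)"
    and s0: "s0 \<in> S" and inj: "inj (f s0)"
  obtains m where "m > 0" "\<forall>\<^sub>F s in at s0 within S. \<forall>v. m * norm v \<le> norm (f s v)"
proof -
  obtain m where m: "m > 0" "\<And>v. m * norm v \<le> norm (f s0 v)"
    using linear_inj_bounded_below_pos[OF lin[OF s0] inj] by blast
  let ?\<delta> = "\<lambda>s. \<Sum>e\<in>Basis. norm (f s e - f s0 e)"
  have "((\<lambda>s. ?\<delta> s) \<longlongrightarrow> (\<Sum>e\<in>(Basis::'v set). norm (f s0 e - f s0 e))) (at s0 within S)"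
    using cont s0 by (intro tendsto_intros) (auto simp: continuous_on_def)
  then have "\<forall>\<^sub>F s in at s0 within S. ?\<delta> s < m / 2"
    using m(1) by (intro order_tendstoD(2)) auto
  moreover have "\<forall>\<^sub>F s in at s0 within S. s \<in> S"
    by (simp add: eventually_at_filter)
  ultimately have "\<forall>\<^sub>F s in at s0 within S. \<forall>v. m / 2 * norm v \<le> norm (f s v)"
  proof eventually_elim
    fix s assume d: "?\<delta> s < m / 2" and s: "s \<in> S"
    show "\<forall>v. m / 2 * norm v \<le> norm (f s v)"
    proof
      fix v
      have "linear (\<lambda>v. f s v - f s0 v)"
        using lin s s0 by (intro linear_compose_sub) auto
      from linear_euclidean_sum[OF this, of v]
      have "norm (f s v - f s0 v) \<le> (\<Sum>e\<in>(Basis::'v set). norm ((v \<bullet> e) *\<^sub>R (f s e - f s0 e)))"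
        by (simp only: norm_sum)
      also have "\<dots> \<le> (\<Sum>e\<in>(Basis::'v set). norm v * norm (f s e - f s0 e))"
        by (intro sum_mono) (auto intro!: mult_right_mono simp: Basis_le_norm)
      also have "\<dots> = norm v * ?\<delta> s"
        by (simp add: sum_distrib_left)
      also have "\<dots> \<le> norm v * (m / 2)"
        using d by (intro mult_left_mono) auto
      finally have "norm (f s0 v) - norm v * (m / 2) \<le> norm (f s v)"
        using norm_triangle_ineq2[of "f s0 v" "f s v"] norm_minus_commute[of "f s v"] by simp
      then show "m / 2 * norm v \<le> norm (f s v)"
        using m(2)[of v] by (simp add: field_simps)
    qed
  qed
  then show ?thesis using that[of "m / 2"] m(1) by simp
qed

lemma eventually_inj:
  fixes f :: "'s::topological_space \<Rightarrow> 'v::euclidean_space \<Rightarrow> 'w::euclidean_space"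
  assumes "\<And>s. s \<in> S \<Longrightarrow> linear (f s)" "\<And>v. continuous_on S (\<lambda>s. f s v)" "s0 \<in> S" "inj (f s0)"
  shows "\<forall>\<^sub>F s in at s0 within S. inj (f s)"
proof -
  obtain m where m: "m > 0" "\<forall>\<^sub>F s in at s0 within S. \<forall>v. m * norm v \<le> norm (f s v)"
    using linear_family_near[OF assms] by blast
  have "\<forall>\<^sub>F s in at s0 within S. s \<in> S"
    by (simp add: eventually_at_filter)
  with m(2) show ?thesis
  proof eventually_elim
    fix s assume b: "\<forall>v. m * norm v \<le> norm (f s v)" and s: "s \<in> S"
    have "v = 0" if "f s v = 0" for v
      using b[rule_format, of v] that m(1) by (simp add: mult_le_0_iff)
    then show "inj (f s)" using assms(1)[OF s] linear_injective_0 by blast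
  qed
qed

lemma continuous_on_linear_solution:
  fixes f :: "'s::topological_space \<Rightarrow> 'v::euclidean_space \<Rightarrow> 'w::euclidean_space"
  assumes lin: "\<And>s. s \<in> S \<Longrightarrow> linear (f s)" and cont: "\<And>v. continuous_on S (\<lambda>s. f s v)"
    and inj: "\<And>s. s \<in> S \<Longrightarrow> inj (f s)"
    and r: "continuous_on S r" and sol: "\<And>s. s \<in> S \<Longrightarrow> f s (z s) = r s"
  shows "continuous_on S z"
  unfolding continuous_on_def
proof
  fix s0 assume s0: "s0 \<in> S"
  obtain m where m: "m > 0" "\<forall>\<^sub>F s in at s0 within S. \<forall>v. m * norm v \<le> norm (f s v)"
    using linear_family_near[OF lin cont s0 inj[OF s0]] by blast
  have "((\<lambda>s. r s - f s (z s0)) \<longlongrightarrow> r s0 - f s0 (z s0)) (at s0 within S)"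
    using r cont s0 by (intro tendsto_intros) (auto simp: continuous_on_def)
  then have "((\<lambda>s. norm (r s - f s (z s0)) / m) \<longlongrightarrow> 0) (at s0 within S)"
    using tendsto_divide_zero[OF tendsto_norm_zero] by (simp add: sol[OF s0])
  moreover have "\<forall>\<^sub>F s in at s0 within S. norm (z s - z s0) \<le> norm (r s - f s (z s0)) / m"
  proof -
    have "\<forall>\<^sub>F s in at s0 within S. s \<in> S"
      by (simp add: eventually_at_filter)
    with m(2) show ?thesis
    proof eventually_elim
      fix s assume "\<forall>v. m * norm v \<le> norm (f s v)" and s: "s \<in> S"
      then have "m * norm (z s - z s0) \<le> norm (f s (z s - z s0))" by blast
      also have "f s (z s - z s0) = r s - f s (z s0)"
        by (simp add: linear_diff[OF lin[OF s]] sol[OF s])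
      finally show "norm (z s - z s0) \<le> norm (r s - f s (z s0)) / m"
        using m(1) by (simp add: field_simps)
    qed
  qed
  ultimately have "((\<lambda>s. z s - z s0) \<longlongrightarrow> 0) (at s0 within S)"
    by (rule Lim_null_comparison[rotated])
  then show "(z \<longlongrightarrow> z s0) (at s0 within S)"
    by (simp add: LIM_zero_iff)
qed

lemma linear_family_bounded:
  fixes f :: "'s \<Rightarrow> 'v::euclidean_space \<Rightarrow> 'w::real_normed_vector"
  assumes lin: "\<And>s. s \<in> Q \<Longrightarrow> linear (f s)" and bdd: "\<And>v. bounded ((\<lambda>s. f s v) ` Q)"
  obtains C where "C \<ge> 0" "\<And>s v. s \<in> Q \<Longrightarrow> norm (f s v) \<le> C * norm v"
proof -
  have "\<exists>c\<ge>0. \<forall>s\<in>Q. norm (f s e) \<le> c" for e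
  proof -
    obtain c where "\<forall>x\<in>(\<lambda>s. f s e) ` Q. norm x \<le> c"
      using bdd bounded_iff by blast
    then show ?thesis by (intro exI[of _ "max c 0"]) auto
  qed
  then obtain c where c: "\<And>e. c e \<ge> (0::real)" "\<And>e s. s \<in> Q \<Longrightarrow> norm (f s e) \<le> c e" by metis
  show ?thesis
  proof
    show "0 \<le> (\<Sum>e\<in>Basis. c e)" by (intro sum_nonneg c)
    fix s v assume s: "s \<in> Q"
    have "norm (f s v) \<le> (\<Sum>e\<in>Basis. norm ((v \<bullet> e) *\<^sub>R f s e))"
      by (subst linear_euclidean_sum[OF lin[OF s]]) (rule norm_sum)
    also have "\<dots> \<le> (\<Sum>e\<in>(Basis::'v set). norm v * c e)"
      by (intro sum_mono) (auto intro!: mult_mono c(2) s c(1) simp: Basis_le_norm)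
    finally show "norm (f s v) \<le> (\<Sum>e\<in>Basis. c e) * norm v"
      by (simp add: sum_distrib_left mult.commute)
  qed
qed

lemma bilinear_family_bounded:
  fixes f :: "'s \<Rightarrow> 'v::euclidean_space \<Rightarrow> 'u::euclidean_space \<Rightarrow> 'w::real_normed_vector"
  assumes bil: "\<And>s. s \<in> Q \<Longrightarrow> bilinear (f s)" and bdd: "\<And>u v. bounded ((\<lambda>s. f s u v) ` Q)"
  obtains C where "C \<ge> 0" "\<And>s u v. s \<in> Q \<Longrightarrow> norm (f s u v) \<le> C * norm u * norm v"
proof -
  have "\<exists>c\<ge>0. \<forall>s\<in>Q. \<forall>v. norm (f s e v) \<le> c * norm v" for e
    using linear_family_bounded[of Q "\<lambda>s. f s e"] bil bdd unfolding bilinear_def by metis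
  then obtain c where c: "\<And>e. c e \<ge> (0::real)" "\<And>e s v. s \<in> Q \<Longrightarrow> norm (f s e v) \<le> c e * norm v" by metis
  show ?thesis
  proof
    show "0 \<le> (\<Sum>e\<in>Basis. c e)" by (intro sum_nonneg c)
    fix s u v assume s: "s \<in> Q"
    have l: "linear (\<lambda>u. f s u v)" using bil[OF s] by (simp add: bilinear_def)
    have "norm (f s u v) \<le> (\<Sum>e\<in>Basis. norm ((u \<bullet> e) *\<^sub>R f s e v))"
      by (subst linear_euclidean_sum[OF l]) (rule norm_sum)
    also have "\<dots> \<le> (\<Sum>e\<in>(Basis::'v set). norm u * (c e * norm v))"
      by (intro sum_mono) (auto intro!: mult_mono c(2) s c(1) mult_nonneg_nonneg simp: Basis_le_norm)
    also have "\<dots> = (\<Sum>e\<in>(Basis::'v set). c e) * norm u * norm v"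
      by (simp add: sum_distrib_left sum_distrib_right mult_ac)
    finally show "norm (f s u v) \<le> (\<Sum>e\<in>Basis. c e) * norm u * norm v" .
  qed
qed

lemma bounded_continuous_image: "compact Q \<Longrightarrow> continuous_on Q f \<Longrightarrow> bounded (f ` Q)"
  by (intro compact_imp_bounded compact_continuous_image)

text \<open>In terms of the Euclidean projection \<open>\<pi>\<close> onto \<open>U\<close>, the form \<open>b\<close> restricted to \<open>U\<close> is
  represented by an endomorphism of the whole space that is the identity on the Euclidean
  complement of \<open>U\<close>. It is invertible if and only if \<open>b\<close> is non-degenerate on \<open>U\<close>, and \<open>sharp\<close> is
  its inverse.\<close>

definition compress :: "('v::euclidean_space \<Rightarrow> 'v \<Rightarrow> real) \<Rightarrow> 'v set \<Rightarrow> 'v \<Rightarrow> 'v" where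
  "compress b U z = (let \<pi> = sharp (\<bullet>) U in \<pi> (\<Sum>e\<in>Basis. b (\<pi> z) e *\<^sub>R e) + (z - \<pi> z))"

lemma symmetric_form_inner: "symmetric_form ((\<bullet>) :: 'v::euclidean_space \<Rightarrow> 'v \<Rightarrow> real)"
  by unfold_locales
     (auto simp: bilinear_conv_bounded_bilinear bounded_bilinear_inner inner_commute)

lemma nondegenerate_on_inner: "nondegenerate_on (\<bullet>) U"
  by (auto simp: nondegenerate_on_def)

context symmetric_form
begin

lemma
  assumes U: "subspace U"
  shows linear_compress: "linear (compress b U)"
    and compress_sharp: "nondegenerate_on b U \<Longrightarrow> compress b U (sharp b U v) = sharp (\<bullet>) U v"
    and inj_compress_iff: "inj (compress b U) \<longleftrightarrow> nondegenerate_on b U"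
proof -
  interpret i: symmetric_form "(\<bullet>) :: 'v \<Rightarrow> 'v \<Rightarrow> real" by (rule symmetric_form_inner)
  define \<pi> where "\<pi> = sharp (\<bullet>) U"
  define \<beta> where "\<beta> z = (\<Sum>e\<in>Basis. b z e *\<^sub>R e)" for z
  have comp: "compress b U z = \<pi> (\<beta> (\<pi> z)) + (z - \<pi> z)" for z
    by (simp add: compress_def Let_def \<pi>_def \<beta>_def)
  have \<pi>: "\<pi> v \<in> U" "w \<in> U \<Longrightarrow> \<pi> v \<bullet> w = v \<bullet> w" for v w
    unfolding \<pi>_def using i.sharp_mem[OF U nondegenerate_on_inner] i.sharp_form[OF U nondegenerate_on_inner] by auto
  have \<pi>_id: "\<pi> z = z" if "z \<in> U" for z
    unfolding \<pi>_def by (rule i.sharp_eqI[OF U nondegenerate_on_inner that]) simp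
  have lin\<pi>: "linear \<pi>" unfolding \<pi>_def by (rule i.linear_sharp[OF U nondegenerate_on_inner])
  have \<beta>: "\<beta> z \<bullet> w = b z w" for z w
  proof -
    have "linear (b z)" using bil by (simp add: bilinear_def)
    from linear_euclidean_sum[OF this, of w] show ?thesis
      by (simp add: \<beta>_def inner_sum_left inner_commute[of w] mult.commute)
  qed
  have lin\<beta>: "linear \<beta>"
    by (rule linearI) (auto simp: \<beta>_def form_simps algebra_simps sum.distrib scaleR_sum_right)
  show lin: "linear (compress b U)"
    by (rule linearI) (auto simp: comp linear_add[OF lin\<pi>] linear_add[OF lin\<beta>] linear_scale[OF lin\<pi>]
        linear_scale[OF lin\<beta>] algebra_simps)
  show "compress b U (sharp b U v) = sharp (\<bullet>) U v" if nd: "nondegenerate_on b U"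
  proof -
    have "\<pi> (\<beta> (sharp b U v)) = sharp (\<bullet>) U v"
      unfolding \<pi>_def by (rule i.sharp_eqI[OF U nondegenerate_on_inner])
        (use \<pi> sharp_form[OF U nd] in \<open>auto simp: \<pi>_def[symmetric] \<beta>\<close>)
    then show ?thesis using \<pi>_id[OF sharp_mem[OF U nd]] by (simp add: comp)
  qed
  show "inj (compress b U) \<longleftrightarrow> nondegenerate_on b U"
  proof
    assume inj: "inj (compress b U)"
    show "nondegenerate_on b U"
      unfolding nondegenerate_on_def
    proof (intro ballI impI)
      fix z assume z: "z \<in> U" "\<forall>w\<in>U. b z w = 0"
      have "\<pi> (\<beta> z) = 0"
        unfolding \<pi>_def by (rule i.sharp_eqI[OF U nondegenerate_on_inner])
          (use z \<beta> subspace_0[OF U] in auto)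
      then have "compress b U z = 0" using \<pi>_id[OF z(1)] by (simp add: comp)
      then show "z = 0" using inj lin linear_injective_0 by blast
    qed
  next
    assume nd: "nondegenerate_on b U"
    have "z = 0" if z: "compress b U z = 0" for z
    proof -
      have "z - \<pi> z = - \<pi> (\<beta> (\<pi> z))" using z by (simp add: comp eq_neg_iff_add_eq_0 add.commute)
      then have "z - \<pi> z \<in> U" using \<pi>(1) subspace_neg[OF U] by metis
      then have zU: "z \<in> U" using \<pi>(1) subspace_add[OF U] by (metis diff_add_cancel)
      then have "\<pi> (\<beta> z) = 0" using z \<pi>_id by (simp add: comp)
      then have "b z w = 0" if "w \<in> U" for w
        using \<pi>(2)[OF that, of "\<beta> z"] by (simp add: \<beta>)
      then show "z = 0" using nd zU by (simp add: nondegenerate_on_def)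
    qed
    then show "inj (compress b U)" using lin linear_injective_0 by blast
  qed
qed

end

locale form_family =
  fixes S :: "'s::topological_space set" and b :: "'s \<Rightarrow> 'v::euclidean_space \<Rightarrow> 'v \<Rightarrow> real"
  assumes form: "s \<in> S \<Longrightarrow> symmetric_form (b s)"
    and form_continuous: "continuous_on S (\<lambda>s. b s u v)"
begin

lemma form_bilinear: "s \<in> S \<Longrightarrow> bilinear (b s)"
  using form symmetric_form.bil by blast

lemma continuous_compress:
  assumes "subspace U"
  shows "continuous_on S (\<lambda>s. compress (b s) U v)"
proof -
  have "linear (sharp (\<bullet>) U)"
    by (rule symmetric_form.linear_sharp[OF symmetric_form_inner assms nondegenerate_on_inner])
  then have "continuous_on UNIV (sharp (\<bullet>) U)"
    by (simp add: linear_continuous_on linear_linear)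
  then have "continuous_on S (\<lambda>s. sharp (\<bullet>) U (\<Sum>e\<in>Basis. b s (sharp (\<bullet>) U v) e *\<^sub>R e))"
    by (rule continuous_on_compose2) (auto intro!: continuous_intros form_continuous)
  then show ?thesis
    unfolding compress_def Let_def by (intro continuous_intros)
qed

lemma continuous_sharp:
  assumes U: "subspace U" "\<And>s. s \<in> S \<Longrightarrow> nondegenerate_on (b s) U"
  shows "continuous_on S (\<lambda>s. sharp (b s) U v)"
proof (rule continuous_on_linear_solution[where f = "\<lambda>s. compress (b s) U"])
  show "continuous_on S (\<lambda>s. compress (b s) U w)" for w by (rule continuous_compress[OF U(1)])
  show "continuous_on S (\<lambda>s. sharp (\<bullet>) U v)" by simp
qed (use U symmetric_form.linear_compress symmetric_form.inj_compress_iff symmetric_form.compress_sharp form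
    in blast)+

lemma eventually_nondegenerate:
  assumes U: "subspace U" "nondegenerate_on (b s0) U" and s0: "s0 \<in> S"
  shows "\<forall>\<^sub>F s in at s0 within S. nondegenerate_on (b s) U"
proof -
  have "\<forall>\<^sub>F s in at s0 within S. inj (compress (b s) U)"
    by (rule eventually_inj)
       (use s0 U form symmetric_form.linear_compress symmetric_form.inj_compress_iff continuous_compress in blast)+
  moreover have "\<forall>\<^sub>F s in at s0 within S. s \<in> S"
    by (simp add: eventually_at_filter)
  ultimately show ?thesis
    by eventually_elim (use U(1) form symmetric_form.inj_compress_iff in blast)
qed

end

locale split_family = form_family +
  fixes W
  assumes split: "s \<in> S \<Longrightarrow> split_form (b s) W"
begin

lemma continuous_sharp_W: "continuous_on S (\<lambda>s. sharp (b s) W v)"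
proof (cases "S = {}")
  case False
  then have "subspace W" using split split_form.W(1) by blast
  then show ?thesis using continuous_sharp split split_form.W(2) by blast
qed simp

lemma continuous_sharp_orth: "continuous_on S (\<lambda>s. sharp (b s) (orth (b s) W) v)"
proof -
  have nd: "nondegenerate_on (b s) UNIV" if "s \<in> S" for s
    using split_form.nondegenerate[OF split[OF that]] by (auto simp: nondegenerate_on_def)
  have "sharp (b s) UNIV v - sharp (b s) W v = sharp (b s) (orth (b s) W) v" if "s \<in> S" for s
    by (rule split_form.sharp_orth_eqI[OF split[OF that], symmetric])
       (rule symmetric_form.sharp_form[OF form[OF that] subspace_UNIV nd[OF that] UNIV_I])
  moreover have "continuous_on S (\<lambda>s. sharp (b s) UNIV v - sharp (b s) W v)"
    by (intro continuous_intros continuous_sharp_W continuous_sharp) (auto simp: nd)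
  ultimately show ?thesis by (rule continuous_on_eq[rotated]) 
qed

lemma continuous_mixed_scalar:
  assumes T: "\<And>s. s \<in> S \<Longrightarrow> bilinear (T s)" "\<And>u v. continuous_on S (\<lambda>s. T s u v)"
  shows "continuous_on S (\<lambda>s. mixed_scalar (b s) W (T s))"
proof -
  have "continuous_on S (\<lambda>s. \<Sum>k\<in>Basis. \<Sum>l\<in>Basis.
      mixed_term (b s) (T s) k (sharp (b s) W k) l (sharp (b s) (orth (b s) W) l))"
    unfolding mixed_term_def
    by (intro continuous_on_sum continuous_on_add continuous_on_diff continuous_on_const
        continuous_on_bilinear_eval[of S b, OF form_bilinear form_continuous]
        continuous_on_bilinear_eval[of S T, OF T] continuous_sharp_W continuous_sharp_orth)
  then show ?thesis
    by (rule continuous_on_eq) (simp add: split_form.mixed_scalar_contraction[OF split T(1)])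
qed

end

section \<open>Coordinates in which the distribution is constant\<close>

text \<open>In a chart, the distribution near a point is the image of its value \<open>V\<close> at that point under
  an invertible continuous matrix field \<open>B\<close>. Pulling metric and tensor back by \<open>B\<close> turns the mixed
  scalar into that of a continuous family of forms for which the subspace is fixed.\<close>

locale frame_chart = atlas A
  for A :: "('a::topological_space, 'v::euclidean_space) chart set" +
  fixes W :: "'a \<Rightarrow> 'v set" and c :: "('a, 'v) chart" and S :: "'v set" and V :: "'v set"
    and B B' :: "'v \<Rightarrow> 'v \<Rightarrow> 'v"
  assumes chart: "c \<in> A" and S: "open S" "S \<subseteq> snd c ` chart_dom c" and V: "subspace V"
    and B: "y \<in> S \<Longrightarrow> linear (B y)" "y \<in> S \<Longrightarrow> B y (B' y v) = v" "continuous_on S (\<lambda>y. B y v)"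
    and B': "y \<in> S \<Longrightarrow> linear (B' y)" "y \<in> S \<Longrightarrow> B' y (B y v) = v" "continuous_on S (\<lambda>y. B' y v)"
    and W_eq: "y \<in> S \<Longrightarrow> W (chart_inv c y) = (\<lambda>v. from_coords A c (chart_inv c y) (B y v)) ` V"
begin

definition form_pull :: "('a \<Rightarrow> 'v \<Rightarrow> 'v \<Rightarrow> real) \<Rightarrow> 'v \<Rightarrow> 'v \<Rightarrow> 'v \<Rightarrow> real" where
  "form_pull h y u v = coords02 A c h y (B y u) (B y v)"

definition tensor_pull :: "('a \<Rightarrow> 'v \<Rightarrow> 'v \<Rightarrow> 'v) \<Rightarrow> 'v \<Rightarrow> 'v \<Rightarrow> 'v \<Rightarrow> 'v" where
  "tensor_pull T y u v = B' y (coords12 A c T y (B y u) (B y v))"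

lemma point:
  assumes "y \<in> S"
  shows "chart_inv c y \<in> chart_dom c" "snd c (chart_inv c y) = y"
  using subsetD[OF S(2) assms] by (rule chart_inv_mem, rule chart_chart_inv)

lemma point_frame:
  fixes y
  assumes y: "y \<in> S"
  defines "x \<equiv> chart_inv c y"
  defines "L \<equiv> \<lambda>v. from_coords A c x (B y v)" and "L' \<equiv> \<lambda>v. B' y (to_coords A c x v)"
  shows "linear L" "linear L'" "L (L' v) = v" "L' (L v) = v" "W x = L ` V"
    "form_pull h y u v = h x (L u) (L v)" "tensor_pull T y u v = L' (T x (L u) (L v))"
proof -
  note x = point[OF y, folded x_def]
  show "linear L" "linear L'"
    unfolding L_def L'_def
    using linear_compose[OF B(1)[OF y] linear_from_coords[OF chart x(1)]]
      linear_compose[OF linear_to_coords[OF chart x(1)] B'(1)[OF y]] by (simp_all add: comp_def)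
  show "L (L' v) = v" "L' (L v) = v"
    using B(2)[OF y] B'(2)[OF y] from_to_coords[OF chart x(1)] to_from_coords[OF chart x(1)]
    by (simp_all add: L_def L'_def)
  show "W x = L ` V" using W_eq[OF y] by (simp add: x_def L_def)
  show "form_pull h y u v = h x (L u) (L v)" "tensor_pull T y u v = L' (T x (L u) (L v))"
    using coords02_chart[OF chart x(1)] coords12_chart[OF chart x(1)]
    by (simp_all add: form_pull_def tensor_pull_def x L_def L'_def)
qed

lemma split_form_iff:
  assumes y: "y \<in> S"
  shows "split_form (form_pull h y) V \<longleftrightarrow> split_form (h (chart_inv c y)) (W (chart_inv c y))"
proof
  note f = point_frame[OF y]
  let ?x = "chart_inv c y"
  let ?L = "\<lambda>v. from_coords A c ?x (B y v)" and ?L' = "\<lambda>v. B' y (to_coords A c ?x v)"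
  have pull: "form_pull h y = (\<lambda>u v. h ?x (?L u) (?L v))"
    by (intro ext) (rule f(6))
  show "split_form (h ?x) (W ?x) \<Longrightarrow> split_form (form_pull h y) V"
    unfolding pull
    by (rule split_form.split_form_pullback[OF _ f(1,2) f(3) f(4) f(5) V])
  assume s: "split_form (form_pull h y) V"
  have "h ?x = (\<lambda>u v. form_pull h y (?L' u) (?L' v))"
    by (intro ext) (simp add: pull f(3))
  moreover have "V = ?L' ` W ?x"
    unfolding f(5) by (simp add: image_image f(4))
  moreover have "subspace (W ?x)"
    unfolding f(5) by (rule linear_subspace_image[OF f(1) V])
  ultimately show "split_form (h ?x) (W ?x)"
    using split_form.split_form_pullback[OF s f(2,1) f(4) f(3), of "W ?x"] by simp
qed

lemma bilinear_tensor_pull: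
  assumes y: "y \<in> S" and T: "bilinear (T (chart_inv c y))"
  shows "bilinear (tensor_pull T y)"
proof -
  note f = point_frame[OF y]
  show ?thesis
    using T by (intro bilinearI) (auto simp: f(7) linear_add[OF f(1)] linear_add[OF f(2)] linear_scale[OF f(1)]
        linear_scale[OF f(2)] bilinear_ladd bilinear_radd bilinear_lmul bilinear_rmul)
qed

lemma mixed_scalar_pull:
  assumes y: "y \<in> S" and h: "split_form (h (chart_inv c y)) (W (chart_inv c y))"
    and T: "bilinear (T (chart_inv c y))"
  shows "mixed_scalar (h (chart_inv c y)) (W (chart_inv c y)) (T (chart_inv c y))
    = mixed_scalar (form_pull h y) V (tensor_pull T y)"
proof -
  note f = point_frame[OF y]
  let ?x = "chart_inv c y"
  let ?L = "\<lambda>v. from_coords A c ?x (B y v)" and ?L' = "\<lambda>v. B' y (to_coords A c ?x v)"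
  have "form_pull h y = (\<lambda>u v. h ?x (?L u) (?L v))" "tensor_pull T y = (\<lambda>u v. ?L' (T ?x (?L u) (?L v)))"
    by (intro ext f(6,7))+
  then show ?thesis
    using split_form.mixed_scalar_pullback[OF h f(1,2) f(3) f(4) f(5) V T] by simp
qed

text \<open>The parameter space \<open>P\<close> accommodates both a single metric or tensor and a variation of it.\<close>

lemma continuous_form_pull:
  assumes q: "\<And>p. p \<in> P \<Longrightarrow> q p \<in> S" "continuous_on P q"
    and bil: "\<And>p. p \<in> P \<Longrightarrow> bilinear (h p (chart_inv c (q p)))"
    and cont: "\<And>u v. continuous_on P (\<lambda>p. coords02 A c (h p) (q p) u v)"
  shows "continuous_on P (\<lambda>p. form_pull (h p) (q p) u v)"
proof -
  have qS: "q ` P \<subseteq> S" using q(1) by (rule image_subsetI)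
  have cB: "continuous_on P (\<lambda>p. B (q p) w)" for w
    by (rule continuous_on_compose2[OF B(3) q(2) qS])
  have "bilinear (coords02 A c (h p) (q p))" if "p \<in> P" for p
    using bilinear_coords02[where g = "h p" and x = "chart_inv c (q p)", OF bil[OF that] chart point(1)[OF q(1)[OF that]]]
    unfolding point(2)[OF q(1)[OF that]] .
  then show ?thesis
    unfolding form_pull_def
    by (rule continuous_on_bilinear_eval[where f = "\<lambda>p. coords02 A c (h p) (q p)", OF _ cont cB cB])
qed

lemma continuous_tensor_pull:
  assumes q: "\<And>p. p \<in> P \<Longrightarrow> q p \<in> S" "continuous_on P q"
    and bil: "\<And>p. p \<in> P \<Longrightarrow> bilinear (T p (chart_inv c (q p)))"
    and cont: "\<And>u v. continuous_on P (\<lambda>p. coords12 A c (T p) (q p) u v)"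
  shows "continuous_on P (\<lambda>p. tensor_pull (T p) (q p) u v)"
proof -
  have qS: "q ` P \<subseteq> S" using q(1) by (rule image_subsetI)
  have cB: "continuous_on P (\<lambda>p. B (q p) w)" "continuous_on P (\<lambda>p. B' (q p) w)" for w
    by (rule continuous_on_compose2[OF B(3) q(2) qS] continuous_on_compose2[OF B'(3) q(2) qS])+
  have bt: "bilinear (coords12 A c (T p) (q p))" if "p \<in> P" for p
    using bilinear_coords12[where T = "T p" and x = "chart_inv c (q p)", OF bil[OF that] chart point(1)[OF q(1)[OF that]]]
    unfolding point(2)[OF q(1)[OF that]] .
  show ?thesis
    unfolding tensor_pull_def
    by (rule continuous_on_linear_eval[where f = "\<lambda>p. B' (q p)", OF B'(1)[OF q(1)] cB(2)
        continuous_on_bilinear_eval[where f = "\<lambda>p. coords12 A c (T p) (q p)", OF bt cont cB(1) cB(1)]])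
qed

end

context atlas
begin

text \<open>Choose functionals \<open>\<eta>\<^sub>i\<close> dual to the values \<open>\<xi>\<^sub>i(y\<^sub>0)\<close> of a local spanning family of the
  distribution and let \<open>B(y) v = v + \<Sum>\<^sub>i \<eta>\<^sub>i(v) (\<xi>\<^sub>i(y) - \<xi>\<^sub>i(y\<^sub>0))\<close>. This is the identity at \<open>y\<^sub>0\<close>,
  hence invertible nearby, and it maps \<open>\<xi>\<^sub>i(y\<^sub>0)\<close> to \<open>\<xi>\<^sub>i(y)\<close>.\<close>

lemma exists_frame_chart:
  assumes W: "smooth_distribution A n W" and c: "c \<in> A" and x0: "x0 \<in> chart_dom c"
  obtains S V B B' where "frame_chart A W c S V B B'" "snd c x0 \<in> S"
proof -
  let ?y0 = "snd c x0"
  obtain U X where U: "open U" "x0 \<in> U" and X: "\<And>i. i < n \<Longrightarrow> smooth_vector_field_on A U (X i)"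
    and span: "\<And>x. x \<in> U \<Longrightarrow> W x = span ((\<lambda>i. X i x) ` {..<n})"
  proof -
    have "\<exists>U X. open U \<and> x0 \<in> U \<and> (\<forall>i<n. smooth_vector_field_on A U (X i)) \<and>
        (\<forall>y\<in>U. W y = span ((\<lambda>i. X i y) ` {..<n}))"
      using W unfolding smooth_distribution_def by (elim conjE) (erule spec)
    then show ?thesis using that by metis
  qed
  have dimW: "dim (W x) = n" for x using W by (simp add: smooth_distribution_def)
  define S1 where "S1 = snd c ` (chart_dom c \<inter> U)"
  have S1: "open S1" "?y0 \<in> S1" "S1 \<subseteq> snd c ` chart_dom c"
    using open_chart_image[OF c U(1)] x0 U(2) by (auto simp: S1_def)
  define \<xi> where "\<xi> i y = to_coords A c (chart_inv c y) (X i (chart_inv c y))" for i y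
  have cont\<xi>: "continuous_on S1 (\<xi> i)" if "i < n" for i
    using smooth_on_imp_continuous_on X[OF that] c
    by (auto simp: smooth_vector_field_on_def S1_def \<xi>_def[abs_def])
  define V where "V = span ((\<lambda>i. \<xi> i ?y0) ` {..<n})"
  have Wim: "W (chart_inv c y) = from_coords A c (chart_inv c y) ` span ((\<lambda>i. \<xi> i y) ` {..<n})"
    if y: "y \<in> S1" for y
  proof -
    obtain x where x: "x \<in> chart_dom c" "x \<in> U" "y = snd c x" using y by (auto simp: S1_def)
    have "from_coords A c x ` span ((\<lambda>i. \<xi> i y) ` {..<n}) = span (from_coords A c x ` (\<lambda>i. \<xi> i y) ` {..<n})"
      by (rule linear_span_image[OF linear_from_coords[OF c x(1)], symmetric])
    also have "from_coords A c x ` (\<lambda>i. \<xi> i y) ` {..<n} = (\<lambda>i. X i x) ` {..<n}"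
      using c x by (simp add: image_image \<xi>_def from_to_coords)
    finally show ?thesis using span[OF x(2)] c x by simp
  qed
  have dimV: "dim V = n"
  proof -
    have "inj (from_coords A c x0)"
      by (metis injI to_from_coords[OF c x0])
    then have "dim (from_coords A c x0 ` V) = dim V"
      by (intro dim_image_eq linear_from_coords[OF c x0]) (auto intro: inj_on_subset)
    then show ?thesis using Wim[OF S1(2)] dimW[of x0] c x0 by (simp add: V_def)
  qed
  define Z where "Z = (\<lambda>i. \<xi> i ?y0) ` {..<n}"
  have "card Z \<le> n" using card_image_le[of "{..<n}" "\<lambda>i. \<xi> i ?y0"] by (simp add: Z_def)
  moreover have "n \<le> card Z" using dimV dim_le_card'[of Z] by (simp add: V_def Z_def)
  ultimately have cardZ: "card Z = n" by simp
  then have inj\<xi>: "inj_on (\<lambda>i. \<xi> i ?y0) {..<n}"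
    by (intro eq_card_imp_inj_on) (auto simp: Z_def)
  have "independent Z"
    by (rule card_le_dim_spanning[of Z V]) (use cardZ dimV in \<open>auto simp: Z_def V_def span_base\<close>)
  then have "\<forall>i. \<exists>g. linear g \<and> (\<forall>x\<in>Z. g x = (if x = \<xi> i ?y0 then 1 else (0::real)))"
    by (intro allI linear_independent_extend)
  then have "\<exists>\<eta>. \<forall>i. linear (\<eta> i) \<and> (\<forall>x\<in>Z. \<eta> i x = (if x = \<xi> i ?y0 then 1 else (0::real)))"
    by (rule choice)
  then obtain \<eta> where "\<forall>i. linear (\<eta> i) \<and> (\<forall>x\<in>Z. \<eta> i x = (if x = \<xi> i ?y0 then 1 else (0::real)))" ..
  then have \<eta>: "\<And>i. linear (\<eta> i)" "\<And>i x. x \<in> Z \<Longrightarrow> \<eta> i x = (if x = \<xi> i ?y0 then 1 else 0)"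
    by simp_all
  have dual: "\<eta> i (\<xi> j ?y0) = (if i = j then 1 else 0)" if "i < n" "j < n" for i j
    using \<eta>(2)[of "\<xi> j ?y0" i] inj\<xi> that by (auto simp: Z_def inj_on_def)
  define B where "B y v = v + (\<Sum>i<n. \<eta> i v *\<^sub>R (\<xi> i y - \<xi> i ?y0))" for y v
  have linB: "linear (B y)" for y
    by (rule linearI) (auto simp: B_def linear_add[OF \<eta>(1)] linear_scale[OF \<eta>(1)] algebra_simps
        sum.distrib sum_subtractf scaleR_sum_right)
  have contB: "continuous_on S1 (\<lambda>y. B y v)" for v
    unfolding B_def by (intro continuous_intros cont\<xi>) auto
  have B\<xi>: "B y (\<xi> j ?y0) = \<xi> j y" if "j < n" for j y
  proof -
    have "(\<Sum>i<n. \<eta> i (\<xi> j ?y0) *\<^sub>R (\<xi> i y - \<xi> i ?y0)) = (\<Sum>i<n. if i = j then \<xi> i y - \<xi> i ?y0 else 0)"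
      by (rule sum.cong) (auto simp: dual that)
    then show ?thesis using that by (simp add: B_def)
  qed
  have "inj (B ?y0)" by (simp add: B_def inj_def)
  then have "\<forall>\<^sub>F y in at ?y0 within S1. inj (B y)"
    by (intro eventually_inj linB contB S1(2))
  then have "\<forall>\<^sub>F y in at ?y0. inj (B y)"
    unfolding at_within_open[OF S1(2,1)] .
  then obtain S2 where S2: "open S2" "?y0 \<in> S2" "\<And>y. y \<in> S2 \<Longrightarrow> y \<noteq> ?y0 \<Longrightarrow> inj (B y)"
    unfolding eventually_at_topological by auto
  define S where "S = S1 \<inter> S2"
  have S: "open S" "?y0 \<in> S" "S \<subseteq> S1" using S1 S2 by (auto simp: S_def)
  have injB: "inj (B y)" if "y \<in> S" for y
    using S2(3)[of y] \<open>inj (B ?y0)\<close> that by (cases "y = ?y0") (auto simp: S_def)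
  define B' where "B' y = inv (B y)" for y
  have bij: "bij (B y)" if "y \<in> S" for y
    using linear_injective_imp_surjective[OF linB injB[OF that]] injB[OF that] by (simp add: bij_def)
  have BB': "B y (B' y v) = v" and B'B: "B' y (B y v) = v" if "y \<in> S" for y v
    using bij[OF that] by (auto simp: B'_def bij_def surj_f_inv_f)
  have "frame_chart A W c S V B B'"
  proof (intro frame_chart.intro frame_chart_axioms.intro atlas_axioms)
    show "linear (B' y)" if y: "y \<in> S" for y
    proof (rule linearI)
      show "B' y (u + v) = B' y u + B' y v" for u v
        using B'B[OF y, of "B' y u + B' y v"] by (simp add: linear_add[OF linB] BB'[OF y])
      show "B' y (r *\<^sub>R v) = r *\<^sub>R B' y v" for r v
        using B'B[OF y, of "r *\<^sub>R B' y v"] by (simp add: linear_scale[OF linB] BB'[OF y])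
    qed
    have cB: "continuous_on S (\<lambda>y. B y v)" for v
      using contB S(3) continuous_on_subset by blast
    show "continuous_on S (\<lambda>y. B y v)" for v by (rule cB)
    show "continuous_on S (\<lambda>y. B' y v)" for v
      by (rule continuous_on_linear_solution[where f = B and r = "\<lambda>y. v"])
         (use linB cB injB BB' in auto)
    show "W (chart_inv c y) = (\<lambda>v. from_coords A c (chart_inv c y) (B y v)) ` V" if "y \<in> S" for y
    proof -
      have "B y ` V = span (B y ` (\<lambda>i. \<xi> i ?y0) ` {..<n})"
        unfolding V_def by (rule linear_span_image[OF linB, symmetric])
      also have "B y ` (\<lambda>i. \<xi> i ?y0) ` {..<n} = (\<lambda>i. \<xi> i y) ` {..<n}"
        by (simp add: image_image B\<xi>)
      finally show ?thesis
        using Wim[of y] that S(3) by (auto simp: image_image[symmetric])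
    qed
    show "S \<subseteq> snd c ` chart_dom c" using S(3) S1(3) by blast
  qed (use c S linB BB' B'B in \<open>auto simp: V_def\<close>)
  then show ?thesis using that S(2) by blast
qed

end

locale distribution_atlas = metric_atlas A g
  for A :: "('a::t2_space, 'v::euclidean_space) chart set" and g +
  fixes W :: "'a \<Rightarrow> 'v set" and n :: nat
  assumes distribution: "smooth_distribution A n W" and nondegenerate_W: "nondegenerate_on (g x) (W x)"
begin

lemma split_form_metric: "split_form (g x) (W x)"
proof -
  interpret symmetric_form "g x" by (rule symmetric_form_metric)
  show ?thesis
    using distribution nondegenerate_W metric_at(3)
    by unfold_locales (auto simp: smooth_distribution_def)
qed

lemma continuous_mixed_scalar:
  assumes T: "tensor12 A T"
  shows "continuous_on UNIV (\<lambda>x. mixed_scalar (g x) (W x) (T x))"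
proof (rule continuous_at_imp_continuous_on, rule ballI)
  fix x0
  define c where "c = chart_at A x0"
  have c: "c \<in> A" "x0 \<in> chart_dom c" using chart_at by (auto simp: c_def)
  obtain S V B B' where fc: "frame_chart A W c S V B B'" and x0: "snd c x0 \<in> S"
    using exists_frame_chart[OF distribution c] .
  interpret fc: frame_chart A W c S V B B' by (rule fc)
  have bilT: "bilinear (T x)" for x using T by (simp add: tensor12_def)
  interpret fam: split_family S "fc.form_pull g" V
  proof (intro split_family.intro form_family.intro split_family_axioms.intro)
    show s: "split_form (fc.form_pull g y) V" if "y \<in> S" for y
      using split_form_metric fc.split_form_iff[OF that] by blast
    show "symmetric_form (fc.form_pull g y)" if "y \<in> S" for y
      by (rule split_form.axioms(1)[OF s[OF that]])
  next
    show "continuous_on S (\<lambda>y. fc.form_pull g y u v)" for u v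
      by (rule fc.continuous_form_pull[where h = "\<lambda>p. g"])
         (use metric_at(1) continuous_on_subset[OF smooth_on_imp_continuous_on[OF metric_smooth[OF c(1)]] fc.S(2)] in auto)
  qed
  have "continuous_on S (\<lambda>y. mixed_scalar (fc.form_pull g y) V (fc.tensor_pull T y))"
  proof (rule fam.continuous_mixed_scalar)
    show "bilinear (fc.tensor_pull T y)" if "y \<in> S" for y
      using fc.bilinear_tensor_pull[OF that bilT] .
    have "continuous_on S (\<lambda>y. coords12 A c T y u v)" for u v
      by (rule continuous_on_subset[OF smooth_on_imp_continuous_on fc.S(2)]) (use T c in \<open>auto simp: tensor12_def\<close>)
    then show "continuous_on S (\<lambda>y. fc.tensor_pull T y u v)" for u v
      by (intro fc.continuous_tensor_pull[where T = "\<lambda>p. T"]) (use bilT in auto)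
  qed
  moreover have "continuous_on (chart_dom c \<inter> snd c -` S) (snd c)"
    using continuous_on_subset[OF chart_homeo(4)[OF c(1)]] by blast
  ultimately have "continuous_on (chart_dom c \<inter> snd c -` S)
      (\<lambda>x. mixed_scalar (fc.form_pull g (snd c x)) V (fc.tensor_pull T (snd c x)))"
    by (rule continuous_on_compose2) auto
  then have "continuous_on (chart_dom c \<inter> snd c -` S) (\<lambda>x. mixed_scalar (g x) (W x) (T x))"
  proof (rule continuous_on_eq)
    fix x assume "x \<in> chart_dom c \<inter> snd c -` S"
    then show "mixed_scalar (fc.form_pull g (snd c x)) V (fc.tensor_pull T (snd c x)) = mixed_scalar (g x) (W x) (T x)"
      using fc.mixed_scalar_pull[of "snd c x" g T] split_form_metric bilT c by simp
  qed
  then show "isCont (\<lambda>x. mixed_scalar (g x) (W x) (T x)) x0"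
    using open_chart_preimage[OF c(1) fc.S(1)] c x0 by (simp add: continuous_on_eq_continuous_at)
qed

end

section \<open>Estimates for one-parameter variations\<close>

text \<open>The derivative in \<open>t\<close> is continuous in \<open>(t, y)\<close>, hence bounded on compact sets, and the mean
  value inequality applies.\<close>

lemma smooth_family_lipschitz:
  fixes F :: "real \<times> 'v::euclidean_space \<Rightarrow> 'w::real_normed_vector"
  assumes F: "smooth_on ({-e<..<e} \<times> U) F" and Q: "compact Q" "Q \<subseteq> U" and \<delta>: "0 < \<delta>" "\<delta> < e"
  obtains C where "C \<ge> 0" "\<And>t y. \<bar>t\<bar> \<le> \<delta> \<Longrightarrow> y \<in> Q \<Longrightarrow> norm (F (t, y) - F (0, y)) \<le> C * \<bar>t\<bar>"
proof -
  define D where "D z = frechet_derivative F (at z) (1, 0)" for z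
  have sub: "{-\<delta>..\<delta>} \<times> Q \<subseteq> {-e<..<e} \<times> U" using Q(2) \<delta> by auto
  have "continuous_on ({-\<delta>..\<delta>} \<times> Q) D"
    unfolding D_def
    by (rule continuous_on_subset[OF smooth_on_imp_continuous_on[OF smooth_on_frechet_derivative[OF F]] sub])
  then have "bounded (D ` ({-\<delta>..\<delta>} \<times> Q))"
    by (intro compact_imp_bounded compact_continuous_image compact_Times Q compact_Icc)
  then obtain C where C: "\<And>z. z \<in> {-\<delta>..\<delta>} \<times> Q \<Longrightarrow> norm (D z) \<le> C"
    unfolding bounded_iff by blast
  show ?thesis
  proof
    show "max C 0 \<ge> 0" by simp
    fix t :: real and y assume t: "\<bar>t\<bar> \<le> \<delta>" and y: "y \<in> Q"
    have der: "((\<lambda>s. F (s, y)) has_vector_derivative D (s, y)) (at s within {-\<delta>..\<delta>})" if s: "s \<in> {-\<delta>..\<delta>}" for s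
    proof -
      have "(s, y) \<in> {-e<..<e} \<times> U" using sub s y by blast
      then have diff: "F differentiable (at (s, y))" by (rule smooth_on_imp_differentiable[OF F])
      then have "(F has_derivative frechet_derivative F (at (s, y))) (at (s, y))"
        by (rule has_frechet_derivative)
      moreover have "((\<lambda>s. (s, y)) has_derivative (\<lambda>h. (h, 0))) (at s)"
        by (auto intro!: derivative_eq_intros)
      ultimately have d: "((\<lambda>s. F (s, y)) has_derivative (\<lambda>h. frechet_derivative F (at (s, y)) (h, 0))) (at s)"
        by (rule has_derivative_compose[rotated])
      have "linear (frechet_derivative F (at (s, y)))"
        by (rule linear_frechet_derivative[OF diff])
      then have "frechet_derivative F (at (s, y)) (h, 0) = h *\<^sub>R D (s, y)" for h
        using linear_scale[of "frechet_derivative F (at (s, y))" h "(1, 0)"] by (simp add: D_def)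
      with d show ?thesis
        by (simp add: has_vector_derivative_def has_derivative_at_withinI)
    qed
    have "norm (F (t, y) - F (0, y)) \<le> max C 0 * norm (t - 0)"
    proof (rule differentiable_bound)
      show "((\<lambda>s. F (s, y)) has_derivative (\<lambda>h. h *\<^sub>R D (s, y))) (at s within {-\<delta>..\<delta>})"
        if "s \<in> {-\<delta>..\<delta>}" for s
        using der[OF that] by (simp add: has_vector_derivative_def)
      show "onorm (\<lambda>h. h *\<^sub>R D (s, y)) \<le> max C 0" if "s \<in> {-\<delta>..\<delta>}" for s
      proof (rule onorm_le)
        fix h :: real
        show "norm (h *\<^sub>R D (s, y)) \<le> max C 0 * norm h"
          using C[of "(s, y)"] that y by (auto simp: mult.commute intro!: mult_left_mono)
      qed
    qed (use t \<delta> in auto)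
    then show "norm (F (t, y) - F (0, y)) \<le> max C 0 * \<bar>t\<bar>" by simp
  qed
qed

lemma bilinear_smooth_family_lipschitz:
  fixes F :: "real \<Rightarrow> 'v::euclidean_space \<Rightarrow> 'u::euclidean_space \<Rightarrow> 'u \<Rightarrow> 'w::real_normed_vector"
  assumes F: "\<And>u v. smooth_on ({-e<..<e} \<times> U) (\<lambda>(t, y). F t y u v)"
    and bil: "\<And>t y. \<bar>t\<bar> \<le> \<delta> \<Longrightarrow> y \<in> Q \<Longrightarrow> bilinear (F t y)"
    and Q: "compact Q" "Q \<subseteq> U" and \<delta>: "0 < \<delta>" "\<delta> < e"
  obtains C where "C \<ge> 0" "\<And>t y u v. \<bar>t\<bar> \<le> \<delta> \<Longrightarrow> y \<in> Q \<Longrightarrow>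
    norm (F t y u v - F 0 y u v) \<le> C * \<bar>t\<bar> * norm u * norm v"
proof -
  let ?D = "\<lambda>(t, y) u v. (1 / t) *\<^sub>R (F t y u v - F 0 y u v)"
  let ?Q = "{(t, y). \<bar>t\<bar> \<le> \<delta> \<and> y \<in> Q}"
  have bilD: "bilinear (?D s)" if "s \<in> ?Q" for s
  proof -
    obtain t y where s: "s = (t, y)" by force
    then have "bilinear (F t y)" "bilinear (F 0 y)" using bil that \<delta> by auto
    then show ?thesis
      unfolding s by (intro bilinearI) (auto simp: bilinear_ladd bilinear_radd bilinear_lmul bilinear_rmul
          algebra_simps scaleR_diff_right)
  qed
  have bdd: "bounded ((\<lambda>s. ?D s u v) ` ?Q)" for u v
  proof -
    obtain C where C: "C \<ge> 0"
      "\<And>t y. \<bar>t\<bar> \<le> \<delta> \<Longrightarrow> y \<in> Q \<Longrightarrow> norm (F t y u v - F 0 y u v) \<le> C * \<bar>t\<bar>"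
      using smooth_family_lipschitz[OF F Q \<delta>, of u v] by auto
    have "norm (?D s u v) \<le> C" if "s \<in> ?Q" for s
      using that C(2)[of "fst s" "snd s"] C(1)
      by (cases "fst s = 0") (auto simp: divide_simps mult.commute split: prod.splits)
    then show ?thesis unfolding bounded_iff by blast
  qed
  obtain C where C: "C \<ge> 0" "\<And>s u v. s \<in> ?Q \<Longrightarrow> norm (?D s u v) \<le> C * norm u * norm v"
    by (rule bilinear_family_bounded[of ?Q ?D, OF bilD bdd]) blast+
  show ?thesis
  proof
    fix t y u v assume ty: "\<bar>t\<bar> \<le> \<delta>" "y \<in> Q"
    show "norm (F t y u v - F 0 y u v) \<le> C * \<bar>t\<bar> * norm u * norm v"
    proof (cases "t = 0")
      case False
      have "norm (F t y u v - F 0 y u v) = \<bar>t\<bar> * norm (?D (t, y) u v)"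
        using False by simp
      also have "\<dots> \<le> \<bar>t\<bar> * (C * norm u * norm v)"
        using C(2)[of "(t, y)" u v] ty by (intro mult_left_mono) auto
      finally show ?thesis by (simp add: mult_ac)
    qed simp
  qed (rule C(1))
qed

text \<open>The action is one of two integrals, depending on the integrability of its integrand. A
  locally uniform bound \<open>O(t\<^sup>2)\<close> on a compact support controls both: the integral of a function that
  is not integrable is zero by convention.\<close>

lemma integral_quadratic_bound:
  fixes \<mu> :: "real \<Rightarrow> 'a::topological_space measure" and f :: "real \<Rightarrow> 'a \<Rightarrow> real"
  assumes K: "compact K" and sets: "\<And>t. \<bar>t\<bar> < e \<Longrightarrow> sets (\<mu> t) = sets borel" and e: "e > 0"
    and zero: "\<And>t x. \<bar>t\<bar> < e \<Longrightarrow> x \<notin> K \<Longrightarrow> f t x = 0"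
    and local: "\<And>x. x \<in> K \<Longrightarrow> \<exists>U C \<delta>. open U \<and> x \<in> U \<and> \<delta> > 0 \<and> C \<ge> 0 \<and>
      (\<forall>t. \<bar>t\<bar> < \<delta> \<longrightarrow> emeasure (\<mu> t) U \<le> ennreal C \<and> (\<forall>x\<in>U. \<bar>f t x\<bar> \<le> C * t\<^sup>2))"
  obtains C \<delta> where "\<delta> > 0" "\<And>t. \<bar>t\<bar> < \<delta> \<Longrightarrow> \<bar>integral\<^sup>L (\<mu> t) (f t)\<bar> \<le> C * t\<^sup>2"
    "\<And>t \<Omega>. \<bar>t\<bar> < \<delta> \<Longrightarrow> \<bar>LINT x:\<Omega>|\<mu> t. f t x\<bar> \<le> C * t\<^sup>2"
proof -
  obtain U C \<delta> where loc: "\<And>x. x \<in> K \<Longrightarrow> open (U x) \<and> x \<in> U x \<and> \<delta> x > (0::real) \<and> C x \<ge> (0::real) \<and>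
      (\<forall>t. \<bar>t\<bar> < \<delta> x \<longrightarrow> emeasure (\<mu> t) (U x) \<le> ennreal (C x) \<and> (\<forall>z\<in>U x. \<bar>f t z\<bar> \<le> C x * t\<^sup>2))"
    using local by metis
  obtain K' where K': "K' \<subseteq> K" "finite K'" "K \<subseteq> (\<Union>x\<in>K'. U x)"
  proof -
    have "K \<subseteq> (\<Union>x\<in>K. U x)" using loc by blast
    then show ?thesis
      by (rule compactE_image[OF K, rotated]) (use loc that in auto)
  qed
  define d where "d = Min (insert e (\<delta> ` K'))"
  have d: "d > 0" "d \<le> e" "\<And>x. x \<in> K' \<Longrightarrow> d \<le> \<delta> x"
    using K' loc e by (auto simp: d_def subset_iff)
  define M where "M = (\<Sum>x\<in>K'. C x * C x)"
  have bound: "\<bar>integral\<^sup>L (\<mu> t) h\<bar> \<le> M * t\<^sup>2"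
    if t: "\<bar>t\<bar> < d" and h: "\<And>x. \<bar>h x\<bar> \<le> \<bar>f t x\<bar>" for t and h :: "'a \<Rightarrow> real"
  proof -
    let ?g = "\<lambda>x. \<Sum>z\<in>K'. C z * t\<^sup>2 * indicator (U z) x"
    have st: "sets (\<mu> t) = sets borel" using sets t d(2) by auto
    have Um: "U z \<in> sets (\<mu> t)" "emeasure (\<mu> t) (U z) \<le> ennreal (C z)" if "z \<in> K'" for z
      using that loc[of z] K'(1) d(3)[OF that] t by (auto simp: st)
    have fin: "emeasure (\<mu> t) (U z) < \<infinity>" if "z \<in> K'" for z
      using Um(2)[OF that] by (auto intro: le_less_trans)
    have gint: "integrable (\<mu> t) ?g"
      by (intro Bochner_Integration.integrable_sum integrable_mult_right integrable_real_indicator Um fin)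
    have hg: "\<bar>h x\<bar> \<le> ?g x" for x
    proof (cases "x \<in> K")
      case True
      then obtain z where z: "z \<in> K'" "x \<in> U z" using K'(3) by auto
      have "\<bar>h x\<bar> \<le> C z * t\<^sup>2 * indicator (U z) x"
        using order_trans[OF h[of x]] loc[of z] z K'(1) d(3)[OF z(1)] t by auto
      also have "\<dots> \<le> ?g x"
        using loc K' z by (intro member_le_sum) (auto simp: subset_iff)
      finally show ?thesis .
    next
      case False
      then have "h x = 0" using h[of x] zero[of t x] t d(2) by auto
      moreover have "0 \<le> ?g x" using loc K' by (intro sum_nonneg) (auto simp: subset_iff)
      ultimately show ?thesis by simp
    qed
    have "\<bar>integral\<^sup>L (\<mu> t) h\<bar> \<le> integral\<^sup>L (\<mu> t) ?g"
    proof (cases "integrable (\<mu> t) h")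
      case True
      then show ?thesis using hg gint
        by (intro order_trans[OF integral_abs_bound] integral_mono) auto
    next
      case False
      have "0 \<le> integral\<^sup>L (\<mu> t) ?g"
        by (intro Bochner_Integration.integral_nonneg) (use hg order_trans abs_ge_zero in blast)
      then show ?thesis using False by (simp add: not_integrable_integral_eq)
    qed
    also have "integral\<^sup>L (\<mu> t) ?g = (\<Sum>z\<in>K'. C z * t\<^sup>2 * measure (\<mu> t) (U z))"
      by (subst Bochner_Integration.integral_sum)
         (auto intro!: integrable_mult_right integrable_real_indicator Um fin
           simp: Um fin measure_def sets_eq_imp_space_eq[OF st])
    also have "\<dots> \<le> (\<Sum>z\<in>K'. C z * t\<^sup>2 * C z)"
    proof (intro sum_mono mult_left_mono)
      fix z assume z: "z \<in> K'"
      show "measure (\<mu> t) (U z) \<le> C z"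
        using Um(2)[OF z] loc[of z] z K'(1) by (auto simp: measure_def intro: enn2real_leI)
      show "0 \<le> C z * t\<^sup>2" using loc[of z] z K'(1) by auto
    qed
    also have "\<dots> = M * t\<^sup>2" by (simp add: M_def sum_distrib_left mult_ac)
    finally show ?thesis .
  qed
  show ?thesis
  proof
    show "\<bar>integral\<^sup>L (\<mu> t) (f t)\<bar> \<le> M * t\<^sup>2" if "\<bar>t\<bar> < d" for t
      by (rule bound[OF that]) simp
    show "\<bar>LINT x:\<Omega>|\<mu> t. f t x\<bar> \<le> M * t\<^sup>2" if "\<bar>t\<bar> < d" for t \<Omega>
      unfolding set_lebesgue_integral_def by (rule bound[OF that]) (simp add: indicator_def)
  qed (rule d(1))
qed

lemma quadratic_bound_imp_derivative_0:
  fixes I :: "real \<Rightarrow> real"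
  assumes "\<delta> > 0" "\<And>t. \<bar>t\<bar> < \<delta> \<Longrightarrow> \<bar>I t\<bar> \<le> C * t\<^sup>2"
  shows "(I has_real_derivative 0) (at 0)"
proof -
  have I0: "I 0 = 0" using assms(2)[of 0] assms(1) by simp
  have "((\<lambda>t. I t / t) \<longlongrightarrow> 0) (at 0)"
  proof (rule Lim_null_comparison)
    show "\<forall>\<^sub>F t in at 0. norm (I t / t) \<le> \<bar>C\<bar> * \<bar>t\<bar>"
      unfolding eventually_at
    proof (intro exI[of _ \<delta>] conjI ballI impI assms(1))
      fix t :: real assume t: "t \<noteq> 0 \<and> dist t 0 < \<delta>"
      then have "\<bar>I t\<bar> \<le> C * t\<^sup>2" using assms(2) by simp
      also have "\<dots> \<le> \<bar>C\<bar> * \<bar>t\<bar> * \<bar>t\<bar>" by (simp add: power2_eq_square mult_right_mono abs_mult_self_eq mult.assoc)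
      finally show "norm (I t / t) \<le> \<bar>C\<bar> * \<bar>t\<bar>" using t by (simp add: divide_simps)
    qed
    have "((\<lambda>t::real. \<bar>C\<bar> * \<bar>t\<bar>) \<longlongrightarrow> \<bar>C\<bar> * \<bar>0\<bar>) (at 0)" by (intro tendsto_intros)
    then show "((\<lambda>t::real. \<bar>C\<bar> * \<bar>t\<bar>) \<longlongrightarrow> 0) (at 0)" by simp
  qed
  then show ?thesis by (simp add: has_field_derivative_iff I0)
qed

lemma (in volume_atlas) emeasure_vol_chart_le:
  assumes c: "c \<in> A" and B: "B \<in> sets borel" "B \<subseteq> snd c ` chart_dom c"
    and C: "\<And>y. y \<in> B \<Longrightarrow> vol_density A c g y \<le> C"
  shows "emeasure (vol A g) (chart_inv c ` B) \<le> ennreal C * emeasure lborel B"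
proof -
  have eq: "chart_inv c ` B = chart_dom c \<inter> snd c -` B"
  proof
    show "chart_inv c ` B \<subseteq> chart_dom c \<inter> snd c -` B"
      using B(2) chart_inv_mem[of _ c] chart_chart_inv[of _ c] by auto
    show "chart_dom c \<inter> snd c -` B \<subseteq> chart_inv c ` B"
    proof
      fix x assume "x \<in> chart_dom c \<inter> snd c -` B"
      then show "x \<in> chart_inv c ` B" using c by (intro image_eqI[of x _ "snd c x"]) auto
    qed
  qed
  have "(\<lambda>x. if x \<in> chart_dom c then snd c x else 0) \<in> borel_measurable borel" (is "?f \<in> _")
    using chart_homeo[OF c] by (intro borel_measurable_continuous_on_if) auto
  from measurable_sets[OF this B(1)] have "chart_dom c \<inter> ?f -` B \<in> sets borel"
    using chart_dom_borel[OF c] by simp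
  moreover have "chart_dom c \<inter> ?f -` B = chart_inv c ` B" unfolding eq by auto
  ultimately have m: "chart_inv c ` B \<in> sets borel" by simp
  have "snd c ` chart_inv c ` B = B"
    using B(2) chart_chart_inv[of _ c] by (force simp: image_image)
  then have "emeasure (vol A g) (chart_inv c ` B) = (\<integral>\<^sup>+y\<in>B. ennreal (vol_density A c g y) \<partial>lborel)"
    using emeasure_vol[OF c m] eq by simp
  also have "\<dots> \<le> (\<integral>\<^sup>+y\<in>B. ennreal C \<partial>lborel)"
    by (intro nn_integral_mono) (auto simp: indicator_def intro!: ennreal_leI C)
  also have "\<dots> = ennreal C * emeasure lborel B"
    using B(1) by (simp add: nn_integral_cmult_indicator)
  finally show ?thesis .
qed

section \<open>Critical tensors are critical for the action\<close>

lemma (in split_form) norm_top_part_le: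
  fixes \<beta> \<sigma> :: real
  assumes b: "\<And>u v. \<bar>b u v\<bar> \<le> \<beta> * norm u * norm v" and \<sigma>: "\<And>e. e \<in> Basis \<Longrightarrow> norm (sharp b W e) \<le> \<sigma>" "0 \<le> \<sigma>"
  shows "norm (top_part b W v - v) \<le> (DIM('a) * \<sigma> * (DIM('a) * \<beta>) + 1) * norm v"
proof -
  define c where "c = (\<Sum>e\<in>Basis. b v e *\<^sub>R e)"
  have c: "c \<bullet> w = b v w" for w
  proof -
    have "linear (b v)" using bil by (simp add: bilinear_def)
    from linear_euclidean_sum[OF this, of w] show ?thesis
      by (simp add: c_def inner_sum_left inner_commute[of w] mult.commute)
  qed
  have "sharp b W c = top_part b W v"
  proof (rule sharp_eqI[OF W top_part_mem])
    show "b (top_part b W v) w = c \<bullet> w" if "w \<in> W" for w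
      using orth_form(1)[OF that diff_top_part, of v] by (simp add: c form_simps)
  qed
  moreover have "norm c \<le> DIM('a) * \<beta> * norm v"
  proof -
    have "norm c \<le> (\<Sum>e\<in>(Basis::'a set). \<beta> * norm v)"
      unfolding c_def
    proof (rule order_trans[OF norm_sum], rule sum_mono)
      show "norm (b v e *\<^sub>R e) \<le> \<beta> * norm v" if "e \<in> Basis" for e
        using b[of v e] that by simp
    qed
    then show ?thesis by simp
  qed
  ultimately have nc: "norm (sharp b W c) \<le> DIM('a) * \<sigma> * norm c" "norm c \<le> DIM('a) * \<beta> * norm v"
      "sharp b W c = top_part b W v"
    using norm_sharp_le[OF W \<sigma>(1), of c] by auto
  have "norm (top_part b W v) \<le> DIM('a) * \<sigma> * (DIM('a) * \<beta> * norm v)"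
    unfolding nc(3)[symmetric] by (rule order_trans[OF nc(1) mult_left_mono[OF nc(2)]]) (use \<sigma>(2) in simp)
  then show ?thesis
    using norm_triangle_ineq4[of "top_part b W v" v] by (simp add: algebra_simps)
qed

text \<open>Near a point, all quantities that enter the pointwise estimates are bounded uniformly in the
  parameter \<open>t\<close> of a family \<open>gt\<close> of metrics. The bounds and the coordinate ball on which they hold
  are collected here because variations of the metric and of the tensor share them.\<close>

locale bounded_frame = frame_chart A W c S V B B'
  for A :: "('a::topological_space, real^'m) chart set" and W c S V B B' +
  fixes gt :: "real \<Rightarrow> 'a \<Rightarrow> real^'m \<Rightarrow> real^'m \<Rightarrow> real" and x0 :: 'a and \<delta> r \<beta> \<sigma> C :: real
  assumes center: "x0 \<in> chart_dom c" and radius: "0 < \<delta>" "0 < r" "cball (snd c x0) r \<subseteq> S"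
    and nonneg: "0 \<le> \<beta>" "0 \<le> \<sigma>" "0 \<le> C"
    and split: "\<And>t y. \<bar>t\<bar> \<le> \<delta> \<Longrightarrow> y \<in> cball (snd c x0) r \<Longrightarrow> split_form (form_pull (gt t) y) V"
    and form_bound: "\<And>t y u v. \<bar>t\<bar> \<le> \<delta> \<Longrightarrow> y \<in> cball (snd c x0) r \<Longrightarrow>
      \<bar>form_pull (gt t) y u v\<bar> \<le> \<beta> * norm u * norm v"
    and sharp_bound: "\<And>t y k. \<bar>t\<bar> \<le> \<delta> \<Longrightarrow> y \<in> cball (snd c x0) r \<Longrightarrow> k \<in> Basis \<Longrightarrow>
        norm (sharp (form_pull (gt t) y) V k) \<le> \<sigma>"
      "\<And>t y k. \<bar>t\<bar> \<le> \<delta> \<Longrightarrow> y \<in> cball (snd c x0) r \<Longrightarrow> k \<in> Basis \<Longrightarrow>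
        norm (sharp (form_pull (gt t) y) (orth (form_pull (gt t) y) V) k) \<le> \<sigma>"
    and vol_bound: "\<And>t. \<bar>t\<bar> \<le> \<delta> \<Longrightarrow> emeasure (vol A (gt t)) (chart_inv c ` ball (snd c x0) r) \<le> ennreal C"
begin

abbreviation "Q \<equiv> cball (snd c x0) r"

lemma Q_mem: "y \<in> Q \<Longrightarrow> y \<in> S" and Q_chart: "Q \<subseteq> snd c ` chart_dom c"
  using radius(3) S(2) by blast+

lemma B_bound:
  obtains \<kappa> where "\<kappa> \<ge> 0" "\<And>y v. y \<in> Q \<Longrightarrow> norm (B y v) \<le> \<kappa> * norm v" "\<And>y v. y \<in> Q \<Longrightarrow> norm (B' y v) \<le> \<kappa> * norm v"
proof -
  obtain k where k: "\<And>y v. y \<in> Q \<Longrightarrow> norm (B y v) \<le> k * norm v"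
    by (rule linear_family_bounded[of Q B])
       (use B(1) Q_mem bounded_continuous_image[OF compact_cball continuous_on_subset[OF B(3) radius(3)]] in blast)+
  obtain k' where k': "\<And>y v. y \<in> Q \<Longrightarrow> norm (B' y v) \<le> k' * norm v"
    by (rule linear_family_bounded[of Q B'])
       (use B'(1) Q_mem bounded_continuous_image[OF compact_cball continuous_on_subset[OF B'(3) radius(3)]] in blast)+
  show ?thesis
  proof
    show "max (max k k') 0 \<ge> 0" by simp
    fix y v assume y: "y \<in> Q"
    show "norm (B y v) \<le> max (max k k') 0 * norm v" "norm (B' y v) \<le> max (max k k') 0 * norm v"
      by (rule order_trans[OF k[OF y] mult_right_mono] order_trans[OF k'[OF y] mult_right_mono]; simp)+
  qed
qed

lemma local_quadratic_bound:
  assumes C': "0 \<le> C'" and f: "\<And>t y. \<bar>t\<bar> \<le> \<delta> \<Longrightarrow> y \<in> Q \<Longrightarrow> \<bar>f t (chart_inv c y)\<bar> \<le> C' * t\<^sup>2"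
  shows "\<exists>U C \<delta>. open U \<and> x0 \<in> U \<and> \<delta> > 0 \<and> C \<ge> 0 \<and> (\<forall>t. \<bar>t\<bar> < \<delta> \<longrightarrow>
    emeasure (vol A (gt t)) U \<le> ennreal C \<and> (\<forall>x\<in>U. \<bar>f t x\<bar> \<le> C * t\<^sup>2))"
proof (rule exI[of _ "chart_inv c ` ball (snd c x0) r"], rule exI[of _ "max C C'"], rule exI[of _ \<delta>],
    intro conjI allI impI ballI)
  show "open (chart_inv c ` ball (snd c x0) r)"
    using open_chart_inv_ball[OF chart] Q_chart ball_subset_cball by blast
  show "x0 \<in> chart_inv c ` ball (snd c x0) r"
    using chart center radius(2) by (intro image_eqI[of _ _ "snd c x0"]) auto
  fix t assume t: "\<bar>t\<bar> < \<delta>"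
  show "emeasure (vol A (gt t)) (chart_inv c ` ball (snd c x0) r) \<le> ennreal (max C C')"
    by (rule order_trans[OF vol_bound ennreal_leI]) (use t in auto)
  fix x assume "x \<in> chart_inv c ` ball (snd c x0) r"
  then obtain y where y: "y \<in> Q" "x = chart_inv c y" using ball_subset_cball by blast
  show "\<bar>f t x\<bar> \<le> max C C' * t\<^sup>2"
    unfolding y(2) by (rule order_trans[OF f mult_right_mono]) (use t y in auto)
qed (use radius nonneg in auto)

end

locale setting = distribution_atlas A g W n + volume_atlas A g
  for A :: "('a::{t2_space,second_countable_topology}, real^'m) chart set" and g W n
begin

text \<open>A variation of the metric may lose non-degeneracy along the distribution, but for small \<open>t\<close> it
  is inherited from \<open>g\<close> by continuity. The bounds then follow by compactness.\<close>

lemma local_frame_bounds: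
  fixes gt :: "real \<Rightarrow> 'a \<Rightarrow> real^'m \<Rightarrow> real^'m \<Rightarrow> real"
  assumes e: "0 < e" and gt: "\<And>t. \<bar>t\<bar> < e \<Longrightarrow> pseudo_riemannian A (gt t)" "gt 0 = g"
    and smooth: "\<And>c v w. c \<in> A \<Longrightarrow> smooth_on ({-e<..<e} \<times> snd c ` chart_dom c) (\<lambda>(t, y). coords02 A c (gt t) y v w)"
  obtains c S V B B' \<delta> r \<beta> \<sigma> C where "bounded_frame A W c S V B B' gt z \<delta> r \<beta> \<sigma> C" "\<delta> < e"
proof -
  define c where "c = chart_at A z"
  have c: "c \<in> A" "z \<in> chart_dom c" using chart_at by (auto simp: c_def)
  let ?y0 = "snd c z"
  obtain S V B B' where fc: "frame_chart A W c S V B B'" and y0: "?y0 \<in> S"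
    using exists_frame_chart[OF distribution c] by blast
  interpret fc: frame_chart A W c S V B B' by (rule fc)
  let ?P = "{-e<..<e} \<times> S"
  define b where "b p = fc.form_pull (gt (fst p)) (snd p)" for p
  have ma: "metric_atlas A (gt t)" if "\<bar>t\<bar> < e" for t
    using gt(1)[OF that] atlas by unfold_locales
  have coords_cont: "continuous_on ?P (\<lambda>p. coords02 A c (gt (fst p)) (snd p) u v)" for u v
    using continuous_on_subset[OF smooth_on_imp_continuous_on[OF smooth[OF c(1), of u v]], of ?P] fc.S(2)
    by (auto simp: case_prod_beta)
  have bil: "bilinear (b p)" and bsym: "b p u v = b p v u" and bnd: "(\<And>w. b p u w = 0) \<Longrightarrow> u = 0"
    if p: "p \<in> ?P" for p u v
  proof -
    have t: "\<bar>fst p\<bar> < e" and y: "snd p \<in> S" using p by (auto simp: abs_less_iff)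
    note f = fc.point_frame[OF y]
    note m = metric_atlas.metric_at[OF ma[OF t], of "chart_inv c (snd p)"]
    show "bilinear (b p)"
      unfolding b_def using m(1)
      by (intro bilinearI) (auto simp: f(6) linear_add[OF f(1)] linear_scale[OF f(1)] bilinear_ladd bilinear_radd
          bilinear_lmul bilinear_rmul)
    show "b p u v = b p v u" by (simp add: b_def f(6) m(2))
    assume null: "\<And>w. b p u w = 0"
    let ?L = "\<lambda>v. from_coords A c (chart_inv c (snd p)) (B (snd p) v)"
    have "gt (fst p) (chart_inv c (snd p)) (?L u) w = 0" for w
      using null[of "B' (snd p) (to_coords A c (chart_inv c (snd p)) w)"] by (simp add: b_def f(6) f(3))
    then have "?L u = 0" by (rule m(3))
    then show "u = 0" using f(4)[of u] linear_0[OF f(2)] by simp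
  qed
  interpret fam: form_family ?P b
  proof (intro form_family.intro)
    show "symmetric_form (b p)" if "p \<in> ?P" for p
      using bil[OF that] bsym[OF that] by (intro symmetric_form.intro)
    show "continuous_on ?P (\<lambda>p. b p u v)" for u v
      unfolding b_def
      by (rule fc.continuous_form_pull[where h = "\<lambda>p. gt (fst p)"])
         (use coords_cont metric_atlas.metric_at(1)[OF ma] in
           \<open>auto intro: continuous_on_snd simp: abs_less_iff\<close>)
  qed
  have P0: "(0, ?y0) \<in> ?P" using e y0 by simp
  have openP: "open ?P" by (intro open_Times fc.S) auto
  have "split_form (fc.form_pull g ?y0) V"
    using fc.split_form_iff[OF y0] split_form_metric by blast
  then have nd0: "nondegenerate_on (b (0, ?y0)) V"
    using split_form.W(2) by (simp add: b_def gt(2))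
  have "\<forall>\<^sub>F p in at (0, ?y0) within ?P. nondegenerate_on (b p) V"
    by (rule fam.eventually_nondegenerate[OF fc.V nd0 P0])
  then have "\<forall>\<^sub>F p in at (0, ?y0). nondegenerate_on (b p) V"
    unfolding at_within_open[OF P0 openP] .
  then obtain N where N: "open N" "(0, ?y0) \<in> N" "\<And>p. p \<in> N \<Longrightarrow> p \<noteq> (0, ?y0) \<Longrightarrow> nondegenerate_on (b p) V"
    unfolding eventually_at_topological by auto
  have "open (N \<inter> ?P)" "(0, ?y0) \<in> N \<inter> ?P" using N P0 openP by auto
  then obtain N1 N2 where N12: "open N1" "open N2" "0 \<in> N1" "?y0 \<in> N2" "N1 \<times> N2 \<subseteq> N \<inter> ?P"
    by (elim open_prod_elim) auto
  obtain \<delta> where \<delta>: "\<delta> > 0" "cball 0 \<delta> \<subseteq> N1" using open_contains_cball N12(1,3) by blast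
  obtain r where r: "r > 0" "cball ?y0 r \<subseteq> N2" using open_contains_cball N12(2,4) by blast
  let ?Q = "{-\<delta>..\<delta>} \<times> cball ?y0 r"
  have "{-\<delta>..\<delta>} = cball 0 \<delta>" by (auto simp: dist_real_def)
  then have Q: "?Q \<subseteq> N" "?Q \<subseteq> ?P" using \<delta>(2) r(2) N12(5) by blast+
  have compQ: "compact ?Q" by (intro compact_Times compact_Icc compact_cball)
  have "(\<delta>, ?y0) \<in> ?Q" using \<delta>(1) r(1) by simp
  then have "(\<delta>, ?y0) \<in> ?P" using Q(2) by blast
  then have \<delta>e: "\<delta> < e" by simp
  have ballS: "cball ?y0 r \<subseteq> S"
  proof
    fix y assume "y \<in> cball ?y0 r"
    then have "(0, y) \<in> ?Q" using \<delta>(1) by simp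
    then have "(0, y) \<in> ?P" using Q(2) by blast
    then show "y \<in> S" by simp
  qed
  have splitQ: "split_form (b p) V" if p: "p \<in> ?Q" for p
  proof (intro split_form.intro split_form_axioms.intro)
    have pP: "p \<in> ?P" using p Q(2) by blast
    show "symmetric_form (b p)" by (rule fam.form[OF pP])
    show "nondegenerate_on (b p) V" using N(3) nd0 p Q(1) by (cases "p = (0, ?y0)") auto
    show "v = 0" if "\<And>w. b p v w = 0" for v using bnd[OF pP that] .
  qed (rule fc.V)
  interpret q: split_family ?Q b V
    by (intro split_family.intro form_family.intro split_family_axioms.intro splitQ)
       (use fam.form fam.form_continuous Q(2) continuous_on_subset in blast)+
  obtain \<beta> where \<beta>: "\<beta> \<ge> 0" "\<And>p u v. p \<in> ?Q \<Longrightarrow> norm (b p u v) \<le> \<beta> * norm u * norm v"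
    by (rule bilinear_family_bounded[of ?Q b, OF q.form_bilinear
          bounded_continuous_image[OF compQ q.form_continuous]]) blast+
  have sl: "linear (sharp (b p) V)" "linear (sharp (b p) (orth (b p) V))" if "p \<in> ?Q" for p
    using symmetric_form.linear_sharp[OF q.form[OF that]] split_form.W[OF splitQ[OF that]]
      split_form.O[OF splitQ[OF that]] by blast+
  obtain \<sigma>1 where \<sigma>1: "\<sigma>1 \<ge> 0" "\<And>p v. p \<in> ?Q \<Longrightarrow> norm (sharp (b p) V v) \<le> \<sigma>1 * norm v"
    by (rule linear_family_bounded[of ?Q "\<lambda>p. sharp (b p) V", OF sl(1)
          bounded_continuous_image[OF compQ q.continuous_sharp_W]]) blast+
  obtain \<sigma>2 where \<sigma>2: "\<sigma>2 \<ge> 0" "\<And>p v. p \<in> ?Q \<Longrightarrow> norm (sharp (b p) (orth (b p) V) v) \<le> \<sigma>2 * norm v"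
    by (rule linear_family_bounded[of ?Q "\<lambda>p. sharp (b p) (orth (b p) V)", OF sl(2)
          bounded_continuous_image[OF compQ q.continuous_sharp_orth]]) blast+
  have "continuous_on ?Q (\<lambda>p. vol_density A c (gt (fst p)) (snd p))"
    unfolding vol_density_def det_def
    by (intro continuous_intros) (simp add: continuous_on_subset[OF coords_cont Q(2)])
  then have "bounded ((\<lambda>p. vol_density A c (gt (fst p)) (snd p)) ` ?Q)"
    by (rule bounded_continuous_image[OF compQ])
  then obtain D where "\<forall>x\<in>(\<lambda>p. vol_density A c (gt (fst p)) (snd p)) ` ?Q. norm x \<le> D"
    unfolding bounded_iff by blast
  then have D: "vol_density A c (gt (fst p)) (snd p) \<le> D" if "p \<in> ?Q" for p
    using that abs_le_D1 by fastforce
  obtain M where M: "emeasure lborel (ball ?y0 r) = ennreal M" "0 \<le> M"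
    using emeasure_lborel_ball_finite[of ?y0 r] by (cases "emeasure lborel (ball ?y0 r)") auto
  have ball_vol: "emeasure (vol A (gt t)) (chart_inv c ` ball ?y0 r) \<le> ennreal (max D 0 * M)" if t: "\<bar>t\<bar> \<le> \<delta>" for t
  proof -
    have "\<bar>t\<bar> < e" using t \<delta>e by simp
    then interpret m: volume_atlas A "gt t"
      by (intro volume_atlas.intro ma)
    have "emeasure (vol A (gt t)) (chart_inv c ` ball ?y0 r) \<le> ennreal (max D 0) * emeasure lborel (ball ?y0 r)"
    proof (rule m.emeasure_vol_chart_le[OF c(1)])
      show "ball ?y0 r \<subseteq> snd c ` chart_dom c" using ballS fc.S(2) ball_subset_cball by blast
      show "vol_density A c (gt t) y \<le> max D 0" if "y \<in> ball ?y0 r" for y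
        using D[of "(t, y)"] t that by (auto simp: abs_le_iff)
    qed simp
    then show ?thesis using M by (simp add: ennreal_mult)
  qed
  have "bounded_frame A W c S V B B' gt z \<delta> r \<beta> (max \<sigma>1 \<sigma>2) (max D 0 * M)"
  proof (intro bounded_frame.intro bounded_frame_axioms.intro fc)
    fix t :: real and y assume t: "\<bar>t\<bar> \<le> \<delta>" and y: "y \<in> cball ?y0 r"
    then have p: "(t, y) \<in> ?Q" by auto
    have bp: "b (t, y) = fc.form_pull (gt t) y" by (simp add: b_def)
    show "split_form (fc.form_pull (gt t) y) V" using splitQ[OF p] by (simp add: bp)
    show "\<bar>fc.form_pull (gt t) y u v\<bar> \<le> \<beta> * norm u * norm v" for u v
      using \<beta>(2)[OF p, of u v] by (simp add: bp)
    fix k :: "real^'m" assume "k \<in> Basis"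
    then have "norm k = 1" by simp
    then show "norm (sharp (fc.form_pull (gt t) y) V k) \<le> max \<sigma>1 \<sigma>2"
      "norm (sharp (fc.form_pull (gt t) y) (orth (fc.form_pull (gt t) y) V) k) \<le> max \<sigma>1 \<sigma>2"
      using \<sigma>1(2)[OF p, of k] \<sigma>2(2)[OF p, of k] by (auto simp: bp)
  qed (use c \<delta> r ballS \<beta> \<sigma>1 M ball_vol in auto)
  then show ?thesis using \<delta>e by (rule that)
qed

text \<open>The projections onto the distribution along the complements for \<open>g\<close> and for \<open>gt t\<close> differ by
  \<open>O(t)\<close>, and at a critical tensor the mixed scalar is quadratic in this difference.\<close>

lemma metric_variation_local_bound:
  assumes T: "tensor12 A T" "\<And>x. statistical_at (g x) (T x)" "\<And>x. critical_at (g x) (W x) (T x)"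
    and var: "metric_variation A \<Omega> g e gt"
  shows "\<exists>U C \<delta>. open U \<and> x0 \<in> U \<and> \<delta> > 0 \<and> C \<ge> 0 \<and> (\<forall>t. \<bar>t\<bar> < \<delta> \<longrightarrow>
    emeasure (vol A (gt t)) U \<le> ennreal C \<and> (\<forall>x\<in>U. \<bar>mixed_scalar (gt t x) (W x) (T x)\<bar> \<le> C * t\<^sup>2))"
proof -
  have e: "0 < e" and gt: "\<And>t. \<bar>t\<bar> < e \<Longrightarrow> pseudo_riemannian A (gt t)" "gt 0 = g"
    and smooth: "\<And>c v w. c \<in> A \<Longrightarrow> smooth_on ({-e<..<e} \<times> snd c ` chart_dom c) (\<lambda>(t, y). coords02 A c (gt t) y v w)"
    using var by (auto simp: metric_variation_def abs_less_iff)
  obtain c S V B B' \<delta> r \<beta> \<sigma> C where bf: "bounded_frame A W c S V B B' gt x0 \<delta> r \<beta> \<sigma> C" and \<delta>e: "\<delta> < e"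
    by (rule local_frame_bounds[OF e gt smooth, where z = x0]) (assumption | rule that)+
  interpret fc: bounded_frame A W c S V B B' gt x0 \<delta> r \<beta> \<sigma> C by (rule bf)
  note c = fc.chart
  have bilT: "bilinear (T x)" and symT: "T x u v = T x v u" for x u v
    using T(2)[of x] by (auto simp: statistical_at_def)
  obtain \<kappa> where \<kappa>: "\<kappa> \<ge> 0" "\<And>y v. y \<in> fc.Q \<Longrightarrow> norm (B y v) \<le> \<kappa> * norm v"
    by (rule fc.B_bound) (rule that)
  have "continuous_on S (\<lambda>y. coords12 A c T y u v)" for u v
    by (rule continuous_on_subset[OF smooth_on_imp_continuous_on fc.S(2)]) (use T(1) c in \<open>auto simp: tensor12_def\<close>)
  then have "continuous_on S (\<lambda>y. fc.tensor_pull T y u v)" for u v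
    by (intro fc.continuous_tensor_pull[where T = "\<lambda>p. T"]) (use bilT in auto)
  then have contT: "continuous_on fc.Q (\<lambda>y. fc.tensor_pull T y u v)" for u v
    using fc.radius(3) continuous_on_subset by blast
  have bt: "bilinear (fc.tensor_pull T y)" if "y \<in> fc.Q" for y
    by (rule fc.bilinear_tensor_pull[where T = T, OF fc.Q_mem[OF that] bilT])
  obtain \<tau> where \<tau>: "\<tau> \<ge> 0" "\<And>y u v. y \<in> fc.Q \<Longrightarrow> norm (fc.tensor_pull T y u v) \<le> \<tau> * norm u * norm v"
    by (rule bilinear_family_bounded[of fc.Q "fc.tensor_pull T",
          OF bt bounded_continuous_image[OF compact_cball contT]]) blast+
  have bilc: "bilinear (coords02 A c (gt t) y)" if t: "\<bar>t\<bar> \<le> \<delta>" and y: "y \<in> fc.Q" for t y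
  proof -
    have "metric_atlas A (gt t)"
      using gt(1)[of t] t \<delta>e atlas by unfold_locales auto
    then show ?thesis
      using metric_atlas.symmetric_form_coords02[of A "gt t" c y] symmetric_form.bil c y fc.Q_chart by blast
  qed
  obtain L where L: "L \<ge> 0" "\<And>t y u v. \<bar>t\<bar> \<le> \<delta> \<Longrightarrow> y \<in> fc.Q \<Longrightarrow>
      norm (coords02 A c (gt t) y u v - coords02 A c (gt 0) y u v) \<le> L * \<bar>t\<bar> * norm u * norm v"
    by (rule bilinear_smooth_family_lipschitz[where F = "\<lambda>t. coords02 A c (gt t)",
          OF smooth[OF c] bilc compact_cball fc.Q_chart fc.radius(1) \<delta>e]) blast+
  let ?D = "real DIM(real^'m)"
  define \<pi> where "\<pi> = ?D * \<sigma> * (?D * \<beta>) + 1"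
  define \<nu> where "\<nu> = ?D * \<sigma> * (?D * (L * \<kappa>\<^sup>2 * \<pi>))"
  have \<pi>: "0 \<le> \<pi>" using fc.nonneg by (simp add: \<pi>_def)
  then have \<nu>: "0 \<le> \<nu>" using fc.nonneg L \<kappa> by (simp add: \<nu>_def)
  define C' where "C' = ?D\<^sup>2 * (2 * (\<beta> * \<tau>\<^sup>2 * \<nu>\<^sup>2 * \<sigma>\<^sup>2))"
  have C': "0 \<le> C'" using fc.nonneg by (simp add: C'_def)
  have est: "\<bar>mixed_scalar (gt t (chart_inv c y)) (W (chart_inv c y)) (T (chart_inv c y))\<bar> \<le> C' * t\<^sup>2"
    if t: "\<bar>t\<bar> \<le> \<delta>" and "y \<in> fc.Q" for t y
  proof -
    define x where "x = chart_inv c y"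
    have y: "y \<in> fc.Q" "x = chart_inv c y" using that(2) by (simp_all add: x_def)
    note yS = fc.Q_mem[OF y(1)]
    note f = fc.point_frame[OF yS, folded y(2)]
    let ?L = "\<lambda>v. from_coords A c x (B y v)" and ?L' = "\<lambda>v. B' y (to_coords A c x v)"
    interpret b: split_form "fc.form_pull (gt t) y" V by (rule fc.split[OF t y(1)])
    have s0: "split_form (fc.form_pull g y) V" using fc.split[of 0 y] fc.radius(1) y(1) by (simp add: gt(2))
    interpret b\<^sub>0: split_form "fc.form_pull g y" V by (rule s0)
    interpret x: split_form "g x" "W x" by (rule split_form_metric)
    have WL: "?L u \<in> W x" if "u \<in> V" for u using that by (simp add: f(5))
    have L'W: "?L' w \<in> V" if "w \<in> W x" for w using that by (auto simp: f(5) f(4))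
    have OL: "?L u \<in> orth (g x) (W x)" if "u \<in> orth (fc.form_pull g y) V" for u
      using that by (auto simp: orth_def f(5) f(6))
    have L'O: "?L' w \<in> orth (fc.form_pull g y) V" if "w \<in> orth (g x) (W x)" for w
      using that WL by (auto simp: orth_def f(6) f(3))
    have crit: "\<And>X Y. X \<in> W x \<Longrightarrow> Y \<in> W x \<Longrightarrow> T x X Y \<in> W x"
      "\<And>X Y. X \<in> orth (g x) (W x) \<Longrightarrow> Y \<in> orth (g x) (W x) \<Longrightarrow> T x X Y \<in> orth (g x) (W x)"
      "\<And>X U. X \<in> W x \<Longrightarrow> U \<in> orth (g x) (W x) \<Longrightarrow> T x X U = 0"
      using T(3)[of x] x.critical_at_consequences(3)[OF T(2,3)] unfolding x.critical_at_iff by blast+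
    have lip: "\<bar>fc.form_pull (gt t) y u v - fc.form_pull g y u v\<bar> \<le> (L * \<kappa>\<^sup>2 * \<bar>t\<bar>) * norm u * norm v" for u v
    proof -
      have "\<bar>fc.form_pull (gt t) y u v - fc.form_pull g y u v\<bar> \<le> L * \<bar>t\<bar> * norm (B y u) * norm (B y v)"
        using L(2)[OF t y(1), of "B y u" "B y v"] by (simp add: fc.form_pull_def gt(2))
      also have "\<dots> \<le> L * \<bar>t\<bar> * (\<kappa> * norm u) * (\<kappa> * norm v)"
        using L(1) \<kappa> y(1) by (intro mult_mono mult_nonneg_nonneg order_refl) auto
      finally show ?thesis by (simp add: power2_eq_square mult_ac)
    qed
    have "\<bar>mixed_scalar (fc.form_pull (gt t) y) V (fc.tensor_pull T y)\<bar>
        \<le> ?D\<^sup>2 * (2 * (\<beta> * \<tau>\<^sup>2 * (\<nu> * \<bar>t\<bar>)\<^sup>2 * \<sigma>\<^sup>2))"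
    proof (rule b.abs_mixed_scalar_adapted_le[OF fc.form_bound[OF t y(1)] fc.nonneg(1) bt[OF y(1)]
          \<tau>(2)[OF y(1)] \<tau>(1) _ fc.sharp_bound[OF t y(1)] s0])
      show "fc.tensor_pull T y u v = fc.tensor_pull T y v u" for u v
        unfolding f(7) by (subst symT) simp
      show "fc.tensor_pull T y X Y \<in> V" if "X \<in> V" "Y \<in> V" for X Y
        unfolding f(7) by (intro L'W crit WL that)
      show "fc.tensor_pull T y X U = 0" if "X \<in> V" "U \<in> orth (fc.form_pull g y) V" for X U
        unfolding f(7) using crit(3)[OF WL OL, OF that] linear_0[OF f(2)] by simp
      show "fc.tensor_pull T y X Y \<in> orth (fc.form_pull g y) V"
        if "X \<in> orth (fc.form_pull g y) V" "Y \<in> orth (fc.form_pull g y) V" for X Y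
        unfolding f(7) by (intro L'O crit OL that)
      have "norm (top_part (fc.form_pull g y) V v - top_part (fc.form_pull (gt t) y) V v)
          \<le> ?D * \<sigma> * (?D * ((L * \<kappa>\<^sup>2 * \<bar>t\<bar>) * \<pi>)) * norm v" for v
      proof (rule b.norm_top_part_diff_le[OF s0 fc.sharp_bound(1)[OF t y(1)] lip])
        show "norm (top_part (fc.form_pull g y) V v - v) \<le> \<pi> * norm v" for v
          unfolding \<pi>_def
          by (rule b\<^sub>0.norm_top_part_le[OF _ _ fc.nonneg(2)])
             (use fc.form_bound[of 0 y] fc.sharp_bound(1)[of 0 y] fc.radius(1) y(1) gt(2) in auto)
      qed
      then show "norm (top_part (fc.form_pull g y) V v - top_part (fc.form_pull (gt t) y) V v) \<le> \<nu> * \<bar>t\<bar> * norm v" for v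
        by (simp add: \<nu>_def mult_ac)
      show "0 \<le> \<nu> * \<bar>t\<bar>" using \<nu> by simp
    qed
    moreover have "mixed_scalar (gt t x) (W x) (T x) = mixed_scalar (fc.form_pull (gt t) y) V (fc.tensor_pull T y)"
      unfolding y(2)
      by (rule fc.mixed_scalar_pull[OF yS _ bilT]) (use fc.split_form_iff[OF yS] fc.split[OF t y(1)] in blast)
    ultimately show ?thesis by (simp add: C'_def y(2) power_mult_distrib mult_ac)
  qed
  show ?thesis by (rule fc.local_quadratic_bound[where f = "\<lambda>t x. mixed_scalar (gt t x) (W x) (T x)", OF C' est])
qed

end

context setting
begin

lemma tensor12_smooth: "tensor12 A T \<Longrightarrow> c \<in> A \<Longrightarrow> smooth_on (snd c ` chart_dom c) (\<lambda>y. coords12 A c T y v w)"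
  by (simp add: tensor12_def)

text \<open>At a critical tensor the terms of order zero and one vanish, so the mixed scalar of \<open>Tt t\<close> is
  that of the difference \<open>Tt t - T = O(t)\<close>.\<close>

lemma statistical_variation_local_bound:
  assumes T: "tensor12 A T" "\<And>x. statistical_at (g x) (T x)" "\<And>x. critical_at (g x) (W x) (T x)"
    and var: "statistical_variation A \<Omega> g T e Tt"
  shows "\<exists>U C \<delta>. open U \<and> x0 \<in> U \<and> \<delta> > 0 \<and> C \<ge> 0 \<and> (\<forall>t. \<bar>t\<bar> < \<delta> \<longrightarrow>
    emeasure (vol A g) U \<le> ennreal C \<and> (\<forall>x\<in>U. \<bar>mixed_scalar (g x) (W x) (Tt t x)\<bar> \<le> C * t\<^sup>2))"
proof -
  have e: "0 < e" and Tt0: "Tt 0 = T"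
    and stat: "\<And>t. \<bar>t\<bar> < e \<Longrightarrow> tensor12 A (Tt t) \<and> (\<forall>x. statistical_at (g x) (Tt t x))"
    and smooth: "\<And>c v w. c \<in> A \<Longrightarrow> smooth_on ({-e<..<e} \<times> snd c ` chart_dom c) (\<lambda>(t, y). coords12 A c (Tt t) y v w)"
    using var by (auto simp: statistical_variation_def statistical_iff abs_less_iff)
  have smooth_g: "smooth_on ({-e<..<e} \<times> snd c ` chart_dom c) (\<lambda>(t, y). coords02 A c g y v w)" if c: "c \<in> A" for c v w
  proof -
    have "smooth_on ({-e<..<e} \<times> snd c ` chart_dom c) (\<lambda>p. coords02 A c g (snd p) v w)"
      by (rule smooth_on_compose[OF _ chart_homeo(2)[OF c] _ metric_smooth[OF c]])
         (use chart_homeo(2)[OF c] in \<open>auto intro!: open_Times smooth_on_linear bounded_linear_snd\<close>)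
    then show ?thesis by (simp add: case_prod_beta')
  qed
  obtain c S V B B' \<delta> r \<beta> \<sigma> C where bf: "bounded_frame A W c S V B B' (\<lambda>t. g) x0 \<delta> r \<beta> \<sigma> C" and \<delta>e: "\<delta> < e"
    by (rule local_frame_bounds[where gt = "\<lambda>t. g", OF e metric refl smooth_g, where z = x0])
       (assumption | rule that)+
  interpret fc: bounded_frame A W c S V B B' "\<lambda>t. g" x0 \<delta> r \<beta> \<sigma> C by (rule bf)
  note c = fc.chart
  obtain \<kappa> where \<kappa>: "\<kappa> \<ge> 0" "\<And>y v. y \<in> fc.Q \<Longrightarrow> norm (B y v) \<le> \<kappa> * norm v"
    "\<And>y v. y \<in> fc.Q \<Longrightarrow> norm (B' y v) \<le> \<kappa> * norm v"
    by (rule fc.B_bound) (rule that)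
  have bilTt: "bilinear (Tt t x)" if "\<bar>t\<bar> < e" for t x
    using stat[OF that] by (auto simp: tensor12_def)
  have bilc: "bilinear (coords12 A c (Tt t) y)" if t: "\<bar>t\<bar> \<le> \<delta>" and y: "y \<in> fc.Q" for t y
    using bilinear_coords12[where T = "Tt t" and x = "chart_inv c y", OF bilTt c fc.point(1)[OF fc.Q_mem[OF y]]]
      fc.point(2)[OF fc.Q_mem[OF y]] t \<delta>e by simp
  obtain L where L: "L \<ge> 0" "\<And>t y u v. \<bar>t\<bar> \<le> \<delta> \<Longrightarrow> y \<in> fc.Q \<Longrightarrow>
      norm (coords12 A c (Tt t) y u v - coords12 A c (Tt 0) y u v) \<le> L * \<bar>t\<bar> * norm u * norm v"
    by (rule bilinear_smooth_family_lipschitz[where F = "\<lambda>t. coords12 A c (Tt t)",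
          OF smooth[OF c] bilc compact_cball fc.Q_chart fc.radius(1) \<delta>e]) blast+
  define \<tau> where "\<tau> = \<kappa> * L * \<kappa>\<^sup>2"
  have \<tau>: "0 \<le> \<tau>" using \<kappa> \<kappa> L by (simp add: \<tau>_def)
  define C' where "C' = (real DIM(real^'m))\<^sup>2 * (4 * (\<beta> * \<tau>\<^sup>2 * \<sigma>\<^sup>2))"
  have C': "0 \<le> C'" using fc.nonneg by (simp add: C'_def)
  have est: "\<bar>mixed_scalar (g (chart_inv c y)) (W (chart_inv c y)) (Tt t (chart_inv c y))\<bar> \<le> C' * t\<^sup>2"
    if t: "\<bar>t\<bar> \<le> \<delta>" and "y \<in> fc.Q" for t y
  proof -
    define x where "x = chart_inv c y"
    have y: "y \<in> fc.Q" "x = chart_inv c y" using that(2) by (simp_all add: x_def)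
    have te: "\<bar>t\<bar> < e" using t \<delta>e by simp
    note yS = fc.Q_mem[OF y(1)]
    note x = fc.point[OF yS, folded y(2)]
    interpret x: split_form "g x" "W x" by (rule split_form_metric)
    interpret b: split_form "fc.form_pull g y" V by (rule fc.split[OF t y(1)])
    define D where "D z u v = Tt t z u v - T z u v" for z u v
    have sT: "statistical_at (g x) (T x)" and sTt: "statistical_at (g x) (Tt t x)"
      using T(2) stat[OF te] by auto
    have sD: "statistical_at (g x) (D x)"
      unfolding statistical_at_def
    proof (intro conjI allI)
      show "bilinear (D x)"
        using sT sTt by (intro bilinearI) (auto simp: D_def statistical_at_def bilinear_ladd bilinear_radd
            bilinear_lmul bilinear_rmul algebra_simps)
      show "D x u v = D x v u" for u v
        using sT sTt unfolding D_def statistical_at_def by metis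
      show "g x (D x u v) w = g x v (D x u w)" for u v w
        using sT sTt by (simp add: D_def statistical_at_def x.form_simps)
    qed
    have bilT: "bilinear (T x)" and bilD: "bilinear (D x)"
      using sT sD by (auto simp: statistical_at_def)
    have "Tt t x = (\<lambda>u v. T x u v + 1 *\<^sub>R D x u v)"
      by (auto simp: D_def)
    then have "mixed_scalar (g x) (W x) (Tt t x) = mixed_scalar (g x) (W x) (D x)"
      using x.mixed_scalar_quadratic[OF bilT bilD, of 1] x.critical_at_imp_stationary[OF sT T(3)] sD by simp
    also have "\<dots> = mixed_scalar (fc.form_pull g y) V (fc.tensor_pull D y)"
      using fc.mixed_scalar_pull[of y g D] yS split_form_metric bilD y(2) by simp
    also have "\<bar>\<dots>\<bar> \<le> (real DIM(real^'m))\<^sup>2 * (4 * (\<beta> * (\<tau> * \<bar>t\<bar>)\<^sup>2 * \<sigma>\<^sup>2))"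
    proof (rule b.abs_mixed_scalar_le[OF fc.form_bound[OF t y(1)] fc.nonneg(1) _ _ _ fc.sharp_bound[OF t y(1)]])
      show "bilinear (fc.tensor_pull D y)"
        by (rule fc.bilinear_tensor_pull[OF yS]) (use bilD y(2) in simp)
      have diff: "coords12 A c D y u v = coords12 A c (Tt t) y u v - coords12 A c T y u v" for u v
        using linear_diff[OF linear_to_coords[OF c x(1)]] by (simp add: coords12_def D_def y(2)[symmetric])
      show "norm (fc.tensor_pull D y u v) \<le> (\<tau> * \<bar>t\<bar>) * norm u * norm v" for u v
      proof -
        have "norm (fc.tensor_pull D y u v) \<le> \<kappa> * norm (coords12 A c D y (B y u) (B y v))"
          unfolding fc.tensor_pull_def by (rule \<kappa>(3)[OF y(1)])
        also have "\<dots> \<le> \<kappa> * (L * \<bar>t\<bar> * norm (B y u) * norm (B y v))"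
          using L(2)[OF t y(1), of "B y u" "B y v"] \<kappa>(1) by (intro mult_left_mono) (auto simp: diff Tt0)
        also have "\<dots> \<le> \<kappa> * (L * \<bar>t\<bar> * (\<kappa> * norm u) * (\<kappa> * norm v))"
          using L(1) \<kappa> \<kappa>(1) y(1) by (intro mult_left_mono mult_mono mult_nonneg_nonneg order_refl) auto
        finally show ?thesis by (simp add: \<tau>_def power2_eq_square mult_ac)
      qed
    qed (use \<tau> in simp)
    finally show ?thesis by (simp add: C'_def y(2) power_mult_distrib mult_ac)
  qed
  show ?thesis by (rule fc.local_quadratic_bound[where f = "\<lambda>t x. mixed_scalar (g x) (W x) (Tt t x)", OF C' est])
qed

text \<open>The support condition restricts \<open>\<partial>\<^sub>t T\<^sub>t\<close> for each \<open>t\<close> separately, so at a point off \<open>\<Omega>\<close> the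
  curve \<open>t \<mapsto> T\<^sub>t\<close> has derivative zero throughout and is constant.\<close>

lemma statistical_variation_outside:
  assumes var: "statistical_variation A \<Omega> g T e Tt" and x: "x \<notin> \<Omega>" and t: "\<bar>t\<bar> < e"
  shows "Tt t x = T x"
proof (intro ext)
  fix v w
  define c where "c = chart_at A x"
  have c: "c \<in> A" "x \<in> chart_dom c" using chart_at by (auto simp: c_def)
  have e: "0 < e" using t by simp
  let ?F = "\<lambda>(t, y). coords12 A c (Tt t) y (to_coords A c x v) (to_coords A c x w)"
  have smooth: "smooth_on ({-e<..<e} \<times> snd c ` chart_dom c) ?F"
    using var c by (auto simp: statistical_variation_def)
  have zero: "vector_derivative (\<lambda>s. Tt s x v w) (at s) = 0" if "s \<in> {-e<..<e}" for s
  proof (rule ccontr)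
    assume "vector_derivative (\<lambda>s. Tt s x v w) (at s) \<noteq> 0"
    then have "x \<in> closure {x. \<exists>v w. vector_derivative (\<lambda>s. Tt s x v w) (at s) \<noteq> 0}"
      by (intro subsetD[OF closure_subset]) auto
    then show False using var that x unfolding statistical_variation_def by blast
  qed
  have der: "((\<lambda>s. Tt s x v w) has_vector_derivative 0) (at s)" if s: "s \<in> {-e<..<e}" for s
  proof -
    have "(s, snd c x) \<in> {-e<..<e} \<times> snd c ` chart_dom c" using s c by auto
    then have "?F differentiable (at (s, snd c x))"
      by (rule smooth_on_imp_differentiable[OF smooth])
    then have "(?F has_derivative frechet_derivative ?F (at (s, snd c x))) (at (s, snd c x))"
      by (rule has_frechet_derivative)
    moreover have "((\<lambda>s. (s, snd c x)) has_derivative (\<lambda>h. (h, 0))) (at s)"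
      by (auto intro!: derivative_eq_intros)
    ultimately have "((\<lambda>s. ?F (s, snd c x)) has_derivative (\<lambda>h. frechet_derivative ?F (at (s, snd c x)) (h, 0))) (at s)"
      by (rule has_derivative_compose[rotated])
    from bounded_linear.has_derivative[OF linear_linear[THEN iffD2, OF linear_from_coords[OF c]] this]
    have "(\<lambda>s. from_coords A c x (?F (s, snd c x))) differentiable (at s)"
      by (rule Derivative.differentiableI)
    moreover have "(\<lambda>s. from_coords A c x (?F (s, snd c x))) = (\<lambda>s. Tt s x v w)"
      using c by (simp add: coords12_chart from_to_coords)
    ultimately have "(\<lambda>s. Tt s x v w) differentiable (at s)" by simp
    then show ?thesis by (simp only: vector_derivative_works zero[OF s])
  qed
  have "((\<lambda>s. Tt s x v w) has_vector_derivative 0) (at s within {-e<..<e})" if "s \<in> {-e<..<e}" for s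
    by (rule has_vector_derivative_at_within[OF der[OF that]])
  then obtain k where "\<And>s. s \<in> {-e<..<e} \<Longrightarrow> Tt s x v w = k"
    by (rule has_vector_derivative_zero_constant[OF convex_real_interval(8)]) (assumption | rule that)+
  from this[of t] this[of 0] show "Tt t x v w = T x v w"
    using t e var by (simp add: abs_less_iff statistical_variation_def)
qed

lemma critical_at_imp_critical:
  assumes T: "statistical A g T" "\<And>x. critical_at (g x) (W x) (T x)"
  shows "critical A W g T"
  unfolding critical_def
proof (intro allI impI conjI)
  fix \<Omega> e and gt :: "real \<Rightarrow> 'a \<Rightarrow> real^'m \<Rightarrow> real^'m \<Rightarrow> real"
  assume var: "metric_variation A \<Omega> g e gt"
  have T': "tensor12 A T" "\<And>x. statistical_at (g x) (T x)" using T(1) by (auto simp: statistical_iff)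
  obtain K where K: "compact K" "\<And>t x. \<bar>t\<bar> < e \<Longrightarrow> x \<notin> K \<Longrightarrow> gt t x = g x" and e: "0 < e"
  proof -
    have "e > 0 \<and> (\<exists>K. compact K \<and> K \<subseteq> \<Omega> \<and> (\<forall>t\<in>{-e<..<e}. \<forall>x. x \<notin> K \<longrightarrow> gt t x = g x))"
      using var by (simp add: metric_variation_def)
    then obtain K where "e > 0" "compact K" "\<forall>t\<in>{-e<..<e}. \<forall>x. x \<notin> K \<longrightarrow> gt t x = g x" by blast
    then show ?thesis by (intro that[of K]) (auto simp: abs_less_iff)
  qed
  have sets: "sets (vol A (gt t)) = sets borel" if "\<bar>t\<bar> < e" for t
  proof -
    have "\<forall>t\<in>{-e<..<e}. pseudo_riemannian A (gt t)" using var by (simp add: metric_variation_def)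
    then have "pseudo_riemannian A (gt t)" using that by (simp add: abs_less_iff)
    then have "volume_atlas A (gt t)"
      using atlas by (intro volume_atlas.intro metric_atlas.intro atlas.intro metric_atlas_axioms.intro)
    then show ?thesis by (rule volume_atlas.sets_vol)
  qed
  have zero: "mixed_scalar (gt t x) (W x) (T x) = 0" if "\<bar>t\<bar> < e" "x \<notin> K" for t x
    using K(2)[OF that] split_form.critical_at_imp_stationary(1)[OF split_form_metric T'(2) T(2)] by simp
  obtain C \<delta> where "\<delta> > 0" "\<And>t. \<bar>t\<bar> < \<delta> \<Longrightarrow> \<bar>\<integral>x. mixed_scalar (gt t x) (W x) (T x) \<partial>vol A (gt t)\<bar> \<le> C * t\<^sup>2"
    "\<And>t \<Omega>. \<bar>t\<bar> < \<delta> \<Longrightarrow> \<bar>LINT x:\<Omega>|vol A (gt t). mixed_scalar (gt t x) (W x) (T x)\<bar> \<le> C * t\<^sup>2"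
    by (rule integral_quadratic_bound[where \<mu> = "\<lambda>t. vol A (gt t)" and f = "\<lambda>t x. mixed_scalar (gt t x) (W x) (T x)",
        OF K(1) sets e zero metric_variation_local_bound[OF T' T(2) var]]) (assumption | rule that)+
  then show "((\<lambda>t. action A W \<Omega> (gt t) T) has_real_derivative 0) (at 0)"
    by (intro quadratic_bound_imp_derivative_0[of \<delta> _ C]) (auto simp: action_def)
next
  fix \<Omega> e and Tt :: "real \<Rightarrow> 'a \<Rightarrow> real^'m \<Rightarrow> real^'m \<Rightarrow> real^'m"
  assume \<Omega>: "open \<Omega> \<and> connected \<Omega> \<and> compact (closure \<Omega>)" and var: "statistical_variation A \<Omega> g T e Tt"
  have T': "tensor12 A T" "\<And>x. statistical_at (g x) (T x)" using T(1) by (auto simp: statistical_iff)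
  have e: "0 < e" using var by (simp add: statistical_variation_def)
  have compact: "compact (closure \<Omega>)" using \<Omega> by blast
  have zero: "mixed_scalar (g x) (W x) (Tt t x) = 0" if "\<bar>t\<bar> < e" "x \<notin> closure \<Omega>" for t x
  proof -
    have "x \<notin> \<Omega>" using that(2) closure_subset by blast
    then show ?thesis
      using statistical_variation_outside[OF var _ that(1)]
        split_form.critical_at_imp_stationary(1)[OF split_form_metric T'(2) T(2)] by simp
  qed
  obtain C \<delta> where "\<delta> > 0" "\<And>t. \<bar>t\<bar> < \<delta> \<Longrightarrow> \<bar>\<integral>x. mixed_scalar (g x) (W x) (Tt t x) \<partial>vol A g\<bar> \<le> C * t\<^sup>2"
    "\<And>t \<Omega>. \<bar>t\<bar> < \<delta> \<Longrightarrow> \<bar>LINT x:\<Omega>|vol A g. mixed_scalar (g x) (W x) (Tt t x)\<bar> \<le> C * t\<^sup>2"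
    by (rule integral_quadratic_bound[where \<mu> = "\<lambda>t. vol A g" and f = "\<lambda>t x. mixed_scalar (g x) (W x) (Tt t x)",
        OF compact sets_vol e zero statistical_variation_local_bound[OF T' T(2) var]]) (assumption | rule that)+
  then show "((\<lambda>t. action A W \<Omega> g (Tt t)) has_real_derivative 0) (at 0)"
    by (intro quadratic_bound_imp_derivative_0[of \<delta> _ C]) (auto simp: action_def)
qed

end

section \<open>Critical pairs are pointwise critical\<close>

text \<open>The continuation by zero off the chart domain is smooth when \<open>\<phi>\<close> is smooth with compact
  support in the image of the chart.\<close>

definition bump_field :: "('a, 'v::euclidean_space) chart set \<Rightarrow> ('a, 'v) chart \<Rightarrow> ('v \<Rightarrow> real) \<Rightarrow> 'v \<Rightarrow> 'a \<Rightarrow> 'v" where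
  "bump_field A c \<phi> v x = (if x \<in> chart_dom c then \<phi> (snd c x) *\<^sub>R from_coords A c x v else 0)"

lemma bump_field_mult:
  "bump_field A c (\<lambda>y. \<phi> y * \<psi> y) v x = (if x \<in> chart_dom c then \<psi> (snd c x) else 0) *\<^sub>R bump_field A c \<phi> v x"
  by (simp add: bump_field_def)

lemma (in split_form) cube_scaleR: "cube b (r *\<^sub>R X) u v = r ^ 3 *\<^sub>R cube b X u v"
  by (simp add: cube_def form_simps power3_eq_cube mult_ac)

lemma (in split_form) mixed_polar_scaleR:
  assumes "bilinear T"
  shows "mixed_polar b W T (\<lambda>u v. r *\<^sub>R K u v) = r * mixed_polar b W T K"
proof -
  have "polar_term b T (\<lambda>u v. r *\<^sub>R K u v) u v = r * polar_term b T K u v" for u v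
    by (simp add: polar_term_def bilinear_lmul[OF assms] bilinear_rmul[OF assms] form_simps algebra_simps)
  then show ?thesis
    by (simp add: mixed_polar_def Let_def sum_distrib_left mult.left_commute)
qed

lemma (in metric_atlas) tensor12_add_scaleR:
  assumes T: "tensor12 A T" and K: "tensor12 A K"
  shows "tensor12 A (\<lambda>x u v. T x u v + r *\<^sub>R K x u v)"
    "c \<in> A \<Longrightarrow> y \<in> snd c ` chart_dom c \<Longrightarrow>
      coords12 A c (\<lambda>x u v. T x u v + r *\<^sub>R K x u v) y v w = coords12 A c T y v w + r *\<^sub>R coords12 A c K y v w"
proof -
  have eq: "coords12 A c (\<lambda>x u v. T x u v + r *\<^sub>R K x u v) y v w = coords12 A c T y v w + r *\<^sub>R coords12 A c K y v w"
    if c: "c \<in> A" and y: "y \<in> snd c ` chart_dom c" for c y v w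
    using linear_to_coords[OF c chart_inv_mem[OF y]] by (simp add: coords12_def Let_def linear_add linear_scale)
  then show "c \<in> A \<Longrightarrow> y \<in> snd c ` chart_dom c \<Longrightarrow>
      coords12 A c (\<lambda>x u v. T x u v + r *\<^sub>R K x u v) y v w = coords12 A c T y v w + r *\<^sub>R coords12 A c K y v w" .
  show "tensor12 A (\<lambda>x u v. T x u v + r *\<^sub>R K x u v)"
    unfolding tensor12_def
  proof (intro conjI allI ballI)
    show "bilinear (\<lambda>u v. T x u v + r *\<^sub>R K x u v)" for x
      using T K by (intro bilinearI) (auto simp: tensor12_def bilinear_ladd bilinear_radd bilinear_lmul
          bilinear_rmul algebra_simps)
    fix c v w assume c: "c \<in> A"
    have "smooth_on (snd c ` chart_dom c) (\<lambda>y. coords12 A c T y v w + r *\<^sub>R coords12 A c K y v w)"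
      using T K c chart_homeo(2)[OF c]
      by (intro smooth_on_add smooth_on_scaleR smooth_on_const) (auto simp: tensor12_def)
    then show "smooth_on (snd c ` chart_dom c) (\<lambda>y. coords12 A c (\<lambda>x u v. T x u v + r *\<^sub>R K x u v) y v w)"
      by (rule smooth_on_cong[OF chart_homeo(2)[OF c], rotated]) (simp add: eq[OF c])
  qed
qed


text \<open>Near a point outside the chart domain, the compact support keeps the field zero.\<close>

lemma (in metric_atlas) tensor12_cube_bump_field:
  fixes \<phi> :: "'v \<Rightarrow> real"
  assumes haus: "\<And>K :: 'a set. compact K \<Longrightarrow> closed K"
    and c: "c \<in> A" and \<phi>: "smooth_on UNIV \<phi>" and K: "compact K" "K \<subseteq> snd c ` chart_dom c"
    and supp: "\<And>y. y \<notin> K \<Longrightarrow> \<phi> y = 0"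
  shows "tensor12 A (\<lambda>x. cube (g x) (bump_field A c \<phi> v0 x))"
  unfolding tensor12_def
proof (intro conjI allI ballI)
  let ?X = "bump_field A c \<phi> v0"
  show "bilinear (cube (g x) (?X x))" for x
  proof -
    interpret symmetric_form "g x" by (rule symmetric_form_metric)
    show ?thesis by (rule bilinearI) (auto simp: cube_def form_simps algebra_simps)
  qed
  fix d v w assume d: "d \<in> A"
  let ?Ud = "snd d ` chart_dom d"
  note oUd = chart_homeo(2)[OF d]
  define \<xi> where "\<xi> y = to_coords A d (chart_inv d y) (?X (chart_inv d y))" for y
  define K' where "K' = chart_inv c ` K"
  have "compact K'"
    unfolding K'_def using K chart_homeo(5)[OF c] by (intro compact_continuous_image) (auto intro: continuous_on_subset)
  then have oK': "open (- K')" using haus by (simp add: open_Compl)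
  have X0: "?X x = 0" if "x \<notin> K'" for x
  proof (cases "x \<in> chart_dom c")
    case True
    then have "snd c x \<notin> K" using that c by (force simp: K'_def)
    then show ?thesis by (simp add: bump_field_def supp)
  qed (simp add: bump_field_def)
  have smooth_\<xi>: "smooth_on ?Ud \<xi>"
  proof (rule smooth_on_local)
    fix y assume "y \<in> ?Ud"
    then obtain x where x: "x \<in> chart_dom d" "y = snd d x" by auto
    show "\<exists>U. open U \<and> y \<in> U \<and> smooth_on U \<xi>"
    proof (cases "x \<in> chart_dom c")
      case True
      let ?U = "snd d ` (chart_dom d \<inter> chart_dom c)" and ?U' = "snd c ` (chart_dom c \<inter> chart_dom d)"
      have oU: "open ?U" and oU': "open ?U'" using open_overlap c d by auto
      have im: "transition d c ` ?U \<subseteq> ?U'" using d by auto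
      let ?f = "\<lambda>z. \<phi> z *\<^sub>R frechet_derivative (transition c d) (at z) v0"
      have "smooth_on ?U' ?f"
        by (intro smooth_on_scaleR[OF oU'] smooth_on_frechet_derivative transition_smooth c d
            smooth_on_subset[OF \<phi>]) simp
      then have "smooth_on ?U (\<lambda>z. ?f (transition d c z))"
        by (rule smooth_on_compose[OF oU oU' im _ transition_smooth[OF d c]])
      moreover have "?f (transition d c z) = \<xi> z" if z: "z \<in> ?U" for z
      proof -
        obtain q where q: "q \<in> chart_dom d" "q \<in> chart_dom c" "z = snd d q" using z by auto
        have "\<xi> z = \<phi> (snd c q) *\<^sub>R to_coords A d q (from_coords A c q v0)"
          using q d linear_scale[OF linear_to_coords[OF d q(1)]] by (simp add: \<xi>_def bump_field_def)
        also have "to_coords A d q (from_coords A c q v0) = jac c d q v0"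
          using to_coords_change[OF c d q(2,1)] to_from_coords[OF c q(2)] by simp
        finally show ?thesis using q d by (simp add: jac_def)
      qed
      ultimately have "smooth_on ?U \<xi>" by (rule smooth_on_cong[OF oU, rotated])
      then show ?thesis using oU x True by auto
    next
      case False
      let ?U = "snd d ` (chart_dom d \<inter> - K')"
      have oU: "open ?U" by (rule open_chart_image[OF d oK'])
      have "K' \<subseteq> chart_dom c"
        unfolding K'_def by (intro image_subsetI chart_inv_mem subsetD[OF K(2)])
      then have "y \<in> ?U" using x False by auto
      moreover have "\<xi> z = 0" if z: "z \<in> ?U" for z
      proof -
        obtain q where q: "q \<in> chart_dom d" "q \<notin> K'" "z = snd d q" using z by auto
        then show ?thesis using d X0[OF q(2)] linear_0[OF linear_to_coords[OF d q(1)]] by (simp add: \<xi>_def)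
      qed
      then have "smooth_on ?U \<xi>"
        by (intro smooth_on_cong[OF oU _ smooth_on_const[OF oU, of 0]]) simp
      ultimately show ?thesis using oU by blast
    qed
  qed
  define h where "h u y = (\<Sum>k\<in>Basis. (\<xi> y \<bullet> k) * coords02 A d g y k u)" for u y
  have smooth_h: "smooth_on ?Ud (h u)" for u
    unfolding h_def by (intro smooth_on_sum smooth_on_mult smooth_on_inner smooth_\<xi> smooth_on_const oUd metric_smooth d)
  have "smooth_on ?Ud (\<lambda>y. (h v y * h w y) *\<^sub>R \<xi> y)"
    by (intro smooth_on_scaleR smooth_on_mult oUd smooth_h smooth_\<xi>)
  moreover have "(h v y * h w y) *\<^sub>R \<xi> y = coords12 A d (\<lambda>x. cube (g x) (?X x)) y v w" if y: "y \<in> ?Ud" for y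
  proof -
    obtain x where x: "x \<in> chart_dom d" "y = snd d x" using y by auto
    have "linear (\<lambda>z. coords02 A d g y z u)" for u
      using symmetric_form.bil[OF symmetric_form_coords02[OF d y]] by (simp add: bilinear_def)
    then have "h u y = coords02 A d g y (\<xi> y) u" for u
      using linear_euclidean_sum[of "\<lambda>z. coords02 A d g y z u" "\<xi> y"] by (simp add: h_def)
    also have "coords02 A d g y (\<xi> y) u = g x (?X x) (from_coords A d x u)" for u
      using d x by (simp add: coords02_chart \<xi>_def from_to_coords)
    finally have "h u y = g x (?X x) (from_coords A d x u)" for u .
    then show ?thesis
      using d x linear_scale[OF linear_to_coords[OF d x(1)]] by (simp add: coords12_chart cube_def \<xi>_def)
  qed
  ultimately show "smooth_on ?Ud (\<lambda>y. coords12 A d (\<lambda>x. cube (g x) (?X x)) y v w)"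
    by (rule smooth_on_cong[OF oUd, rotated])
qed

context setting
begin

lemma continuous_mixed_polar:
  assumes T: "tensor12 A T" and K: "tensor12 A K"
  shows "continuous_on UNIV (\<lambda>x. mixed_polar (g x) (W x) (T x) (K x))"
proof -
  have "mixed_polar (g x) (W x) (T x) (K x) =
      mixed_scalar (g x) (W x) (\<lambda>u v. T x u v + 1 *\<^sub>R K x u v) - mixed_scalar (g x) (W x) (T x)
      - mixed_scalar (g x) (W x) (K x)" for x
    using split_form.mixed_scalar_quadratic[OF split_form_metric, of "T x" "K x" x 1] T K by (simp add: tensor12_def)
  moreover have "continuous_on UNIV (\<lambda>x. mixed_scalar (g x) (W x) (\<lambda>u v. T x u v + 1 *\<^sub>R K x u v)
      - mixed_scalar (g x) (W x) (T x) - mixed_scalar (g x) (W x) (K x))"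
    by (intro continuous_on_diff continuous_mixed_scalar[of "\<lambda>x u v. T x u v + 1 *\<^sub>R K x u v"]
        continuous_mixed_scalar tensor12_add_scaleR T K)
  ultimately show ?thesis by simp
qed

lemma set_integrable_vol:
  assumes c: "c \<in> A" and K: "compact K" "K \<subseteq> snd c ` chart_dom c" and f: "continuous_on UNIV f"
    and B: "B \<in> sets borel" "B \<subseteq> chart_inv c ` K"
  shows "set_integrable (vol A g) B (f :: 'a \<Rightarrow> real)"
proof -
  have cK: "compact (chart_inv c ` K)"
    using K chart_homeo(5)[OF c] by (intro compact_continuous_image) (auto intro: continuous_on_subset)
  have "bounded (vol_density A c g ` K)"
    by (rule bounded_continuous_image[OF K(1) continuous_on_subset[OF continuous_vol_density[OF c] K(2)]])
  then obtain D where D: "\<forall>x\<in>vol_density A c g ` K. norm x \<le> D" unfolding bounded_iff by blast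
  have "emeasure (vol A g) (chart_inv c ` K) \<le> ennreal D * emeasure lborel K"
    using K D by (intro emeasure_vol_chart_le[OF c]) (auto simp: borel_compact abs_le_iff)
  also have "\<dots> < \<infinity>"
    using emeasure_compact_finite[OF K(1)] by (simp add: ennreal_mult_less_top)
  finally have "emeasure (vol A g) (chart_inv c ` K) < \<infinity>" .
  moreover have "emeasure (vol A g) B \<le> emeasure (vol A g) (chart_inv c ` K)"
    using B(2) borel_closed[OF compact_imp_closed[OF cK]] by (intro emeasure_mono) (auto simp: sets_vol)
  ultimately have fin: "emeasure (vol A g) B < \<infinity>" by simp
  have "bounded (f ` chart_inv c ` K)"
    by (rule bounded_continuous_image[OF cK continuous_on_subset[OF f subset_UNIV]])
  then obtain M where M: "\<forall>x\<in>f ` chart_inv c ` K. norm x \<le> M" unfolding bounded_iff by blast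
  have "f \<in> borel_measurable (vol A g)"
    using borel_measurable_continuous_onI[OF f] measurable_cong_sets[OF sets_vol refl] by blast
  then show ?thesis
    unfolding set_integrable_def
    using B M fin by (intro integrableI_bounded_set_indicator[where B = M]) (auto simp: sets_vol)
qed

text \<open>Along \<open>T + t K\<close> the action is a quadratic polynomial in \<open>t\<close> with linear coefficient the integral
  of the polarization. Whether it is an integral over \<open>M\<close> or over \<open>\<Omega>\<close> is the same for all \<open>t\<close>, since
  the perturbation is continuous with compact support.\<close>

lemma first_variation_vanishes:
  fixes v\<^sub>0 :: "real^'m"
  assumes crit: "critical A W g T" and T: "statistical A g T"
    and c: "c \<in> A" and r: "0 < r" "cball y0 r \<subseteq> snd c ` chart_dom c"
    and \<phi>: "smooth_on UNIV \<phi>" "\<And>y. y \<notin> cball y0 (r / 2) \<Longrightarrow> \<phi> y = 0"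
  defines "f \<equiv> \<lambda>x. mixed_polar (g x) (W x) (T x) (cube (g x) (bump_field A c \<phi> v\<^sub>0 x))"
  shows "integrable (vol A g) f" "(\<integral>x. f x \<partial>vol A g) = 0"
proof -
  define K where "K x = cube (g x) (bump_field A c \<phi> v\<^sub>0 x)" for x
  define \<Omega> where "\<Omega> = chart_inv c ` ball y0 r"
  have sub: "ball y0 r \<subseteq> cball y0 r" "cball y0 (r / 2) \<subseteq> cball y0 r" "cball y0 (r / 2) \<subseteq> ball y0 r"
    using r(1) by auto
  have tT: "tensor12 A T" and sT: "\<And>x. statistical_at (g x) (T x)"
    using T by (auto simp: statistical_iff)
  have tK: "tensor12 A K"
    unfolding K_def
    by (rule tensor12_cube_bump_field[OF compact_imp_closed c \<phi>(1) compact_cball[of y0 "r / 2"]])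
       (use \<phi>(2) sub r(2) in auto)
  have bilT: "bilinear (T x)" and bilK: "bilinear (K x)" for x using tT tK by (auto simp: tensor12_def)
  have sK: "statistical_at (g x) (K x)" for x
    unfolding K_def by (rule split_form.statistical_at_cube[OF split_form_metric])
  define f0 where "f0 x = mixed_scalar (g x) (W x) (T x)" for x
  define f2 where "f2 x = mixed_scalar (g x) (W x) (K x)" for x
  have f_eq: "f = (\<lambda>x. mixed_polar (g x) (W x) (T x) (K x))" by (simp add: f_def K_def)
  have cont: "continuous_on UNIV f0" "continuous_on UNIV f" "continuous_on UNIV f2"
    unfolding f0_def f_eq f2_def by (intro continuous_mixed_scalar continuous_mixed_polar tT tK)+
  have open\<Omega>: "open \<Omega>"
    unfolding \<Omega>_def using r(2) sub(1) by (intro open_chart_inv_ball[OF c]) auto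
  have sub\<Omega>: "\<Omega> \<subseteq> chart_inv c ` cball y0 r" using sub(1) by (auto simp: \<Omega>_def)
  have si: "set_integrable (vol A g) \<Omega> h" if "continuous_on UNIV h" for h :: "'a \<Rightarrow> real"
    by (rule set_integrable_vol[OF c compact_cball r(2) that _ sub\<Omega>]) (use open\<Omega> in simp)
  have supp: "chart_inv c ` cball y0 (r / 2) \<subseteq> \<Omega>" using sub(3) by (auto simp: \<Omega>_def)
  have K0: "K x u v = 0" if "x \<notin> chart_inv c ` cball y0 (r / 2)" for x u v
  proof -
    have "bump_field A c \<phi> v\<^sub>0 x = 0"
    proof (cases "x \<in> chart_dom c")
      case True
      then have "snd c x \<notin> cball y0 (r / 2)" using that c by (metis chart_inv_chart image_eqI)
      then show ?thesis by (simp add: bump_field_def \<phi>(2))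
    qed (simp add: bump_field_def)
    then show ?thesis by (simp add: K_def cube_def)
  qed
  have zero: "f x = 0" "f2 x = 0" if "x \<notin> \<Omega>" for x
  proof -
    interpret x: split_form "g x" "W x" by (rule split_form_metric)
    have "K x = (\<lambda>u v. 0 *\<^sub>R K x u v)" using K0 that supp by fastforce
    then have "mixed_polar (g x) (W x) (T x) (K x) = 0 * mixed_polar (g x) (W x) (T x) (K x)"
      using x.mixed_polar_scaleR[OF bilT, of x 0 "K x"] by metis
    then show "f x = 0" by (simp add: f_eq)
    have "K x = (\<lambda>u v. 0)" using K0 that supp by fastforce
    then show "f2 x = 0" by (simp add: f2_def mixed_scalar_def x.form_simps Let_def)
  qed
  have ind: "indicator \<Omega> x *\<^sub>R f x = f x" "indicator \<Omega> x *\<^sub>R f2 x = f2 x" for x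
    using zero[of x] by (auto simp: indicator_def)
  show int: "integrable (vol A g) f"
    using si[OF cont(2)] by (simp add: set_integrable_def ind del: real_scaleR_def)
  have int2: "integrable (vol A g) f2"
    using si[OF cont(3)] by (simp add: set_integrable_def ind del: real_scaleR_def)
  define Tt where "Tt t x u v = T x u v + t *\<^sub>R K x u v" for t :: real and x u v
  have quad: "mixed_scalar (g x) (W x) (Tt t x) = f0 x + t * f x + t\<^sup>2 * f2 x" for t x
    using split_form.mixed_scalar_quadratic[where s = t, OF split_form_metric[of x] bilT[of x] bilK[of x]]
    by (simp add: Tt_def[abs_def] f0_def f_eq f2_def)
  have "statistical_variation A \<Omega> g T 1 Tt"
    unfolding statistical_variation_def
  proof (intro conjI ballI allI)
    show "Tt 0 = T" by (simp add: Tt_def fun_eq_iff)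
    fix t :: real
    show "statistical A g (Tt t)"
      unfolding statistical_iff
    proof (intro conjI allI)
      show "tensor12 A (Tt t)" unfolding Tt_def using tensor12_add_scaleR(1)[OF tT tK] .
      fix x
      interpret x: split_form "g x" "W x" by (rule split_form_metric)
      show "statistical_at (g x) (Tt t x)"
        unfolding statistical_at_def
      proof (intro conjI allI)
        show "bilinear (Tt t x)" using \<open>tensor12 A (Tt t)\<close> by (simp add: tensor12_def)
        show "Tt t x u v = Tt t x v u" for u v
          using sT[of x] sK[of x] unfolding Tt_def statistical_at_def by metis
        show "g x (Tt t x u v) w = g x v (Tt t x u w)" for u v w
          using sT[of x] sK[of x] by (simp add: Tt_def statistical_at_def x.form_simps)
      qed
    qed
    have "vector_derivative (\<lambda>s. Tt s x v w) (at t) = K x v w" for x v w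
      unfolding Tt_def by (rule vector_derivative_at) (auto intro!: derivative_eq_intros)
    then have "{x. \<exists>v w. vector_derivative (\<lambda>s. Tt s x v w) (at t) \<noteq> 0} \<subseteq> chart_inv c ` cball y0 (r / 2)"
    proof (intro subsetI)
      fix x assume "x \<in> {x. \<exists>v w. vector_derivative (\<lambda>s. Tt s x v w) (at t) \<noteq> 0}"
      then have "\<exists>v w. K x v w \<noteq> 0"
        using \<open>\<And>x v w. vector_derivative (\<lambda>s. Tt s x v w) (at t) = K x v w\<close> by simp
      then show "x \<in> chart_inv c ` cball y0 (r / 2)" by (metis K0)
    qed
    moreover have "compact (chart_inv c ` cball y0 (r / 2))"
      using r(2) sub(2) by (intro compact_continuous_image continuous_on_subset[OF chart_homeo(5)[OF c]]) auto
    ultimately show "closure {x. \<exists>v w. vector_derivative (\<lambda>s. Tt s x v w) (at t) \<noteq> 0} \<subseteq> \<Omega>"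
      using closure_minimal[OF _ compact_imp_closed] supp by blast
  next
    fix d v w assume d: "d \<in> A"
    let ?P = "{-1<..<1::real} \<times> snd d ` chart_dom d"
    have oP: "open ?P" using chart_homeo(2)[OF d] by (intro open_Times) auto
    have s: "smooth_on ?P (\<lambda>p. coords12 A d S (snd p) v w)" if "tensor12 A S" for S
      by (rule smooth_on_compose[OF oP chart_homeo(2)[OF d] _ tensor12_smooth[OF that d]])
         (auto intro!: smooth_on_linear bounded_linear_snd oP)
    have "smooth_on ?P (\<lambda>p. coords12 A d T (snd p) v w + fst p *\<^sub>R coords12 A d K (snd p) v w)"
      by (intro smooth_on_add smooth_on_scaleR s tT tK oP smooth_on_linear bounded_linear_fst)
    then show "smooth_on ?P (\<lambda>(t, y). coords12 A d (Tt t) y v w)"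
      by (rule smooth_on_cong[OF oP, rotated]) (auto simp: Tt_def[abs_def] tensor12_add_scaleR(2)[OF tT tK d])
  qed simp
  moreover have "open \<Omega> \<and> connected \<Omega> \<and> compact (closure \<Omega>)"
  proof (intro conjI open\<Omega>)
    have "continuous_on (ball y0 r) (chart_inv c)" "continuous_on (cball y0 r) (chart_inv c)"
      using continuous_on_subset[OF chart_homeo(5)[OF c]] r(2) sub(1) by blast+
    then have "connected \<Omega>" and cK: "compact (chart_inv c ` cball y0 r)"
      unfolding \<Omega>_def by (auto intro!: connected_continuous_image compact_continuous_image)
    then show "connected \<Omega>" by blast
    have "closure \<Omega> \<subseteq> chart_inv c ` cball y0 r"
      by (rule closure_minimal[OF sub\<Omega> compact_imp_closed[OF cK]])
    then show "compact (closure \<Omega>)"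
      using compact_Int_closed[OF cK closed_closure[of \<Omega>]] by (simp add: Int_absorb1)
  qed
  ultimately have der: "((\<lambda>t. action A W \<Omega> g (Tt t)) has_real_derivative 0) (at 0)"
    using crit unfolding critical_def by blast
  have "\<exists>a. \<forall>t. action A W \<Omega> g (Tt t) = a + t * (\<integral>x. f x \<partial>vol A g) + t\<^sup>2 * (\<integral>x. f2 x \<partial>vol A g)"
  proof (cases "integrable (vol A g) f0")
    case True
    then show ?thesis
      using int int2 by (intro exI[of _ "\<integral>x. f0 x \<partial>vol A g"]) (simp add: action_def quad)
  next
    case False
    have not_int: "\<not> integrable (vol A g) (\<lambda>x. f0 x + t * f x + t\<^sup>2 * f2 x)" for t
    proof
      assume "integrable (vol A g) (\<lambda>x. f0 x + t * f x + t\<^sup>2 * f2 x)"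
      from Bochner_Integration.integrable_diff[OF this
          Bochner_Integration.integrable_add[OF integrable_mult_right[OF int, of t] integrable_mult_right[OF int2, of "t\<^sup>2"]]]
      show False using False by (simp add: algebra_simps)
    qed
    have "(LINT x:\<Omega>|vol A g. f0 x + t * f x + t\<^sup>2 * f2 x) =
        (LINT x:\<Omega>|vol A g. f0 x) + t * (\<integral>x. f x \<partial>vol A g) + t\<^sup>2 * (\<integral>x. f2 x \<partial>vol A g)" for t
    proof -
      have e: "indicator \<Omega> x *\<^sub>R (f0 x + t * f x + t\<^sup>2 * f2 x) = indicator \<Omega> x *\<^sub>R f0 x + t * f x + t\<^sup>2 * f2 x" for x
        using zero[of x] by (auto simp: indicator_def)
      show ?thesis
        unfolding set_lebesgue_integral_def e
        using si[OF cont(1)] int int2 by (simp add: set_integrable_def)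
    qed
    then show ?thesis
      by (intro exI[of _ "LINT x:\<Omega>|vol A g. f0 x"]) (simp add: action_def quad not_int)
  qed
  then obtain a where "\<And>t. action A W \<Omega> g (Tt t) = a + t * (\<integral>x. f x \<partial>vol A g) + t\<^sup>2 * (\<integral>x. f2 x \<partial>vol A g)"
    by blast
  then have "((\<lambda>t. a + t * (\<integral>x. f x \<partial>vol A g) + t\<^sup>2 * (\<integral>x. f2 x \<partial>vol A g)) has_real_derivative 0) (at 0)"
    using der by simp
  moreover have "((\<lambda>t. a + t * (\<integral>x. f x \<partial>vol A g) + t\<^sup>2 * (\<integral>x. f2 x \<partial>vol A g)) has_real_derivative (\<integral>x. f x \<partial>vol A g)) (at 0)"
    by (auto intro!: derivative_eq_intros)
  ultimately show "(\<integral>x. f x \<partial>vol A g) = 0" using DERIV_unique by blast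
qed

lemma vol_pos:
  assumes c: "c \<in> A" and U: "open U" "U \<noteq> {}" "U \<subseteq> chart_dom c"
  shows "emeasure (vol A g) U \<noteq> 0"
proof
  assume z: "emeasure (vol A g) U = 0"
  have oU: "open (snd c ` U)" using open_chart_image[OF c U(1)] U(3) by (simp add: Int_absorb1)
  have sub: "snd c ` U \<subseteq> snd c ` chart_dom c" using U(3) by auto
  have "(\<lambda>y. ennreal (indicator (snd c ` U) y * vol_density A c g y)) \<in> borel_measurable lborel"
    using measurable_density[OF c _ sub] oU by simp
  moreover have "(\<integral>\<^sup>+y. ennreal (indicator (snd c ` U) y * vol_density A c g y) \<partial>lborel) = 0"
  proof -
    have "(\<integral>\<^sup>+y. ennreal (indicator (snd c ` U) y * vol_density A c g y) \<partial>lborel)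
        = (\<integral>\<^sup>+y\<in>snd c ` U. ennreal (vol_density A c g y) \<partial>lborel)"
      by (intro nn_integral_cong) (auto simp: indicator_def)
    then show ?thesis using emeasure_vol[OF c _ U(3)] U(1) z by simp
  qed
  ultimately have "AE y in lborel. ennreal (indicator (snd c ` U) y * vol_density A c g y) = 0"
    by (simp add: nn_integral_0_iff_AE)
  then have "AE y in lborel. y \<notin> snd c ` U"
  proof eventually_elim
    case (elim y)
    show ?case
    proof
      assume y: "y \<in> snd c ` U"
      then have "vol_density A c g y > 0" using vol_density_pos[OF c] sub by blast
      then show False using elim y by simp
    qed
  qed
  then have "snd c ` U \<in> null_sets lborel"
    using oU by (subst AE_iff_null_sets) auto
  then have "negligible (snd c ` U)"
    unfolding negligible_iff_null_sets by (rule null_sets_completionI)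
  then show False using open_not_negligible[OF oU] U(2) by simp
qed

text \<open>If some direction \<open>X\<^sup>3\<close> has nonzero first variation at \<open>x0\<close>, extend \<open>X\<close> to a field supported
  near \<open>x0\<close>. Its first variation is a continuous density, which keeps its sign near \<open>x0\<close>; cutting
  the field off once more multiplies this density by the cube of the cut-off function and leaves a
  density of constant sign, not identically zero, with vanishing integral, which is absurd.\<close>

lemma critical_imp_stationary:
  assumes crit: "critical A W g T" and T: "statistical A g T"
  shows "mixed_polar (g x0) (W x0) (T x0) (cube (g x0) X) = 0"
proof (rule ccontr)
  assume nz: "mixed_polar (g x0) (W x0) (T x0) (cube (g x0) X) \<noteq> 0"
  define c where "c = chart_at A x0"
  have c: "c \<in> A" "x0 \<in> chart_dom c" using chart_at by (auto simp: c_def)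
  let ?y0 = "snd c x0"
  define v0 where "v0 = to_coords A c x0 X"
  have tT: "tensor12 A T" using T by (simp add: statistical_iff)
  have bilT: "bilinear (T x)" for x using tT by (simp add: tensor12_def)
  have "?y0 \<in> snd c ` chart_dom c" using c by auto
  then obtain r where r: "0 < r" "cball ?y0 r \<subseteq> snd c ` chart_dom c"
    using chart_homeo(2)[OF c(1)] open_contains_cball by blast
  obtain \<phi> :: "real^'m \<Rightarrow> real" where \<phi>: "smooth_on UNIV \<phi>" "\<phi> ?y0 > 0"
    "\<And>y. y \<notin> cball ?y0 (r / 2) \<Longrightarrow> \<phi> y = 0"
    by (rule exists_bump[OF half_gt_zero[OF r(1)], of ?y0]) (rule that)
  define F where "F \<phi> x = mixed_polar (g x) (W x) (T x) (cube (g x) (bump_field A c \<phi> v0 x))" for \<phi> x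
  have scale: "mixed_polar (g x) (W x) (T x) (cube (g x) (s *\<^sub>R Y)) = s ^ 3 * mixed_polar (g x) (W x) (T x) (cube (g x) Y)" for x s Y
  proof -
    interpret x: split_form "g x" "W x" by (rule split_form_metric)
    have "cube (g x) (s *\<^sub>R Y) = (\<lambda>u v. s ^ 3 *\<^sub>R cube (g x) Y u v)"
      by (intro ext) (rule x.cube_scaleR)
    then show ?thesis using x.mixed_polar_scaleR[OF bilT] by simp
  qed
  have "bump_field A c \<phi> v0 x0 = \<phi> ?y0 *\<^sub>R X"
    using c by (simp add: bump_field_def v0_def from_to_coords)
  then have F0: "F \<phi> x0 \<noteq> 0" using nz \<phi>(2) by (simp add: F_def scale)
  have contF: "continuous_on UNIV (F \<psi>)" if "smooth_on UNIV \<psi>" "\<And>y. y \<notin> cball ?y0 (r / 2) \<Longrightarrow> \<psi> y = 0" for \<psi>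
  proof -
    have "tensor12 A (\<lambda>x. cube (g x) (bump_field A c \<psi> v0 x))"
      by (rule tensor12_cube_bump_field[OF compact_imp_closed c(1) that(1) compact_cball[of ?y0 "r / 2"]])
         (use that(2) r in auto)
    then show ?thesis unfolding F_def by (rule continuous_mixed_polar[OF tT])
  qed
  define \<epsilon> where "\<epsilon> = sgn (F \<phi> x0)"
  have \<epsilon>: "\<epsilon> * F \<phi> x0 > 0" "\<epsilon> \<noteq> 0" using F0 by (auto simp: \<epsilon>_def sgn_real_def)
  define N where "N = {x. \<epsilon> * F \<phi> x > 0}"
  have "open N"
    unfolding N_def by (intro open_Collect_less continuous_intros contF \<phi>)
  then have oN: "open (snd c ` (chart_dom c \<inter> N))" by (rule open_chart_image[OF c(1)])
  have "?y0 \<in> snd c ` (chart_dom c \<inter> N)" using c \<epsilon> by (auto simp: N_def)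
  then obtain s where s: "0 < s" "cball ?y0 s \<subseteq> snd c ` (chart_dom c \<inter> N)"
    using oN open_contains_cball by blast
  obtain \<psi> :: "real^'m \<Rightarrow> real" where \<psi>: "smooth_on UNIV \<psi>" "\<And>y. \<psi> y \<ge> 0" "\<psi> ?y0 > 0"
    "\<And>y. y \<notin> cball ?y0 s \<Longrightarrow> \<psi> y = 0"
    using exists_bump[OF s(1), of ?y0] by blast
  let ?\<chi> = "\<lambda>y. \<phi> y * \<psi> y"
  have \<chi>: "smooth_on UNIV ?\<chi>" "\<And>y. y \<notin> cball ?y0 (r / 2) \<Longrightarrow> ?\<chi> y = 0"
    using \<phi>(1,3) \<psi>(1) by (auto intro: smooth_on_mult)
  have F\<chi>: "F ?\<chi> x = (if x \<in> chart_dom c then \<psi> (snd c x) else 0) ^ 3 * F \<phi> x" for x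
    by (simp only: F_def bump_field_mult scale)
  have nonneg: "0 \<le> \<epsilon> * F ?\<chi> x" for x
  proof (cases "x \<in> chart_dom c \<and> snd c x \<in> cball ?y0 s")
    case True
    then obtain z where z: "z \<in> chart_dom c" "z \<in> N" "snd c x = snd c z" using s(2) by blast
    then have "x = z" using chart_homeo(3)[OF c(1)] True by (auto simp: inj_on_def)
    then have "\<epsilon> * F \<phi> x > 0" using z by (simp add: N_def)
    then have "0 \<le> \<psi> (snd c x) ^ 3 * (\<epsilon> * F \<phi> x)" using \<psi>(2) by simp
    then show ?thesis using True by (simp add: F\<chi> mult.left_commute)
  next
    case False
    then show ?thesis using \<psi>(4)[of "snd c x"] by (auto simp: F\<chi>)
  qed
  note fv = first_variation_vanishes[OF crit T c(1) r \<chi>, of v0, folded F_def]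
  have "integrable (vol A g) (\<lambda>x. \<epsilon> * F ?\<chi> x)" "(\<integral>x. \<epsilon> * F ?\<chi> x \<partial>vol A g) = 0"
    using fv by simp_all
  then have ae: "AE x in vol A g. \<epsilon> * F ?\<chi> x = 0"
    using integral_nonneg_eq_0_iff_AE nonneg by blast
  define U where "U = chart_dom c \<inter> {x. \<epsilon> * F ?\<chi> x > 0}"
  have oU: "open U"
    unfolding U_def by (intro open_Int chart_homeo(1)[OF c(1)] open_Collect_less continuous_intros contF \<chi>)
  have "x0 \<in> U"
  proof -
    have "0 < \<psi> ?y0 ^ 3 * (\<epsilon> * F \<phi> x0)" using \<psi>(3) \<epsilon>(1) by simp
    then show ?thesis using c by (simp add: U_def F\<chi> mult.left_commute)
  qed
  then have "emeasure (vol A g) U \<noteq> 0"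
    using vol_pos[OF c(1) oU] by (auto simp: U_def)
  moreover have "AE x in vol A g. x \<notin> U"
    using ae by eventually_elim (auto simp: U_def)
  then have "U \<in> null_sets (vol A g)"
    using oU by (subst AE_iff_null_sets) (auto simp: sets_vol)
  ultimately show False by auto
qed

end

theorem corollary3p2:
  fixes A :: "('a::{t2_space,second_countable_topology}, real^'m) chart set"
    and W :: "'a \<Rightarrow> (real^'m) set"
    and g :: "'a \<Rightarrow> real^'m \<Rightarrow> real^'m \<Rightarrow> real"
    and T :: "'a \<Rightarrow> real^'m \<Rightarrow> real^'m \<Rightarrow> real^'m"
    and n p :: nat
  assumes "smooth_atlas A" and "connected (UNIV :: 'a set)"
    and "smooth_distribution A n W" and "n \<ge> 1"
    and "pseudo_riemannian A g" and "\<And>x. nondegenerate_on (g x) (W x)"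
    and "\<And>x. dim (orth (g x) (W x)) = p" and "p \<ge> 1"
    and "statistical A g T"
  shows "critical A W g T \<longleftrightarrow>
    (\<forall>x. top_part (g x) (W x) (Tr_top (g x) (W x) (T x)) = 0 \<and>
         perp_part (g x) (W x) (Tr_perp (g x) (W x) (T x)) = 0 \<and>
         (\<forall>X\<in>W x. \<forall>Y\<in>W x. perp_part (g x) (W x) (T x X Y) = 0) \<and>
         (\<forall>U\<in>orth (g x) (W x). \<forall>V\<in>orth (g x) (W x). top_part (g x) (W x) (T x U V) = 0))"
proof -
  interpret metric_atlas A g
    using assms(1,5) by (intro metric_atlas.intro atlas.intro metric_atlas_axioms.intro)
  interpret distribution_atlas A g W n
    using assms(3,6) by unfold_locales
  interpret volume_atlas A g by unfold_locales
  interpret setting A g W n by unfold_locales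
  have "critical A W g T \<longleftrightarrow> (\<forall>x. critical_at (g x) (W x) (T x))"
  proof
    assume crit: "critical A W g T"
    show "\<forall>x. critical_at (g x) (W x) (T x)"
    proof
      fix x
      have "dim (W x) \<ge> 1" using assms(3,4) by (simp add: smooth_distribution_def)
      then show "critical_at (g x) (W x) (T x)"
        using split_form.stationary_imp_critical_at[OF split_form_metric, of x "T x"]
          critical_imp_stationary[OF crit assms(9)] assms(7,8,9) by (auto simp: statistical_iff)
    qed
  qed (use critical_at_imp_critical assms(9) in blast)
  then show ?thesis by (simp only: critical_at_def)
qed

end
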